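(* For a graph $G$, the following conditions are equivalent: (i) $G$ is a prime pre-median graph; (ii) $G$ is a $2$--connected pre-median graph and each square of $G$ is included in an induced $W_4$ or an induced $M_4$; (iii) $G$ is a $2$--connected pre-median graph and its triangle complex (and hence its clique complex) is simply connected; (iv) $G$ is a $2$--connected locally weakly modular graph not containing induced $K_{2,3}$ and $W_4^-$, and its triangle complex is simply connected.
   Context: Graphs are simple, undirected, connected, possibly infinite; $d$ is graph distance, $I(u,v)=\{x:d(u,x)+d(x,v)=d(u,v)\}$. Weakly modular: for every vertex $u$, (TC) for $v,w$ with $1=d(v,w)<d(u,v)=d(u,w)$ there is a common neighbor $x$ of $v,w$ with $d(u,x)=d(u,v)-1$, and (QC) for $v,w,z$ with $d(v,z)=d(w,z)=1$, $2=d(v,w)\le d(u,v)=d(u,w)=d(u,z)-1$ there is a common neighbor $x$ of $v,w$ with $d(u,x)=d(u,v)-1$. Locally weakly modular: for every $u$, (LTC) for adjacent $v,w$ with $d(u,v)=d(u,w)=2$ there is a common neighbor of $u,v,w$, and (LQC) for $v,w,z$ with $z\sim v,w$, $d(v,w)=d(u,v)=d(u,w)=d(u,z)-1=2$ there is a common neighbor of $u,v,w$. A square is an induced $4$--cycle. $W_4$ is a $4$--cycle plus a vertex adjacent to all its vertices; $W_4^-$ is $W_4$ with one edge from the central vertex removed. $M_4$ consists of an induced $4$--cycle $(x_1,x_2,x_3,x_4)$ and four pairwise adjacent vertices $a_1,a_2,a_3,a_4$ with $a_1\sim x_1,x_2$; $a_2\sim x_2,x_3$; $a_3\sim x_3,x_4$;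 $a_4\sim x_4,x_1$ and no other edges between the $a_i$ and the $x_j$. A pre-median graph is a weakly modular graph with no induced $K_{2,3}$ and no induced $W_4^-$. An induced subgraph $H$ of $G$ is gated if every vertex $x$ has a vertex $x'\in H$ with $x'\in I(x,y)$ for all $y\in H$. $G$ is a gated amalgam of $G_1,G_2$ if $G_1,G_2$ are isomorphic to two intersecting gated subgraphs of $G$ whose union is $G$. A graph with at least two vertices is prime if it is neither a Cartesian product of smaller graphs nor a gated amalgam of smaller graphs. The triangle complex is the $2$--complex with $1$--skeleton $G$ and $2$--cells glued along all $3$--cycles; the clique complex has the finite cliques as simplices. *)

theory Defs
  imports Main
begin

definition walk :: "'a set \<Rightarrow> ('a \<Rightarrow> 'a \<Rightarrow> bool) \<Rightarrow> 'a list \<Rightarrow> bool" where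
  "walk V E p \<longleftrightarrow> p \<noteq> [] \<and> set p \<subseteq> V \<and> (\<forall>i < length p - 1. E (p ! i) (p ! Suc i))"

definition connected_graph :: "'a set \<Rightarrow> ('a \<Rightarrow> 'a \<Rightarrow> bool) \<Rightarrow> bool" where
  "connected_graph V E \<longleftrightarrow> V \<noteq> {} \<and>
     (\<forall>u\<in>V. \<forall>v\<in>V. \<exists>p. walk V E p \<and> hd p = u \<and> last p = v)"

definition graph :: "'a set \<Rightarrow> ('a \<Rightarrow> 'a \<Rightarrow> bool) \<Rightarrow> bool" where
  "graph V E \<longleftrightarrow> (\<forall>x y. E x y \<longrightarrow> x \<in> V \<and> y \<in> V) \<and> (\<forall>x y. E x y \<longrightarrow> E y x)
     \<and> (\<forall>x. \<not> E x x) \<and> connected_graph V E"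

definition nontrivial_set :: "'a set \<Rightarrow> bool" where
  "nontrivial_set V \<longleftrightarrow> (\<exists>x\<in>V. \<exists>y\<in>V. x \<noteq> y)"

definition gdist :: "'a set \<Rightarrow> ('a \<Rightarrow> 'a \<Rightarrow> bool) \<Rightarrow> 'a \<Rightarrow> 'a \<Rightarrow> nat" where
  "gdist V E u v = (LEAST n. \<exists>p. walk V E p \<and> hd p = u \<and> last p = v \<and> length p = Suc n)"

definition interval :: "'a set \<Rightarrow> ('a \<Rightarrow> 'a \<Rightarrow> bool) \<Rightarrow> 'a \<Rightarrow> 'a \<Rightarrow> 'a set" where
  "interval V E u v = {x \<in> V. gdist V E u x + gdist V E x v = gdist V E u v}"

definition two_connected :: "'a set \<Rightarrow> ('a \<Rightarrow> 'a \<Rightarrow> bool) \<Rightarrow> bool" where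
  "two_connected V E \<longleftrightarrow> nontrivial_set V \<and> connected_graph V E \<and>
     (\<forall>z\<in>V. connected_graph (V - {z}) (\<lambda>x y. E x y \<and> x \<noteq> z \<and> y \<noteq> z))"

definition weakly_modular :: "'a set \<Rightarrow> ('a \<Rightarrow> 'a \<Rightarrow> bool) \<Rightarrow> bool" where
  "weakly_modular V E \<longleftrightarrow>
    (\<forall>u\<in>V. \<forall>v\<in>V. \<forall>w\<in>V.
       gdist V E v w = 1 \<and> 1 < gdist V E u v \<and> gdist V E u v = gdist V E u w \<longrightarrow>
       (\<exists>x\<in>V. E x v \<and> E x w \<and> gdist V E u x = gdist V E u v - 1)) \<and>
    (\<forall>u\<in>V. \<forall>v\<in>V. \<forall>w\<in>V. \<forall>z\<in>V.
       gdist V E v z = 1 \<and> gdist V E w z = 1 \<and> gdist V E v w = 2 \<and>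
       2 \<le> gdist V E u v \<and> gdist V E u v = gdist V E u w \<and>
       gdist V E u v = gdist V E u z - 1 \<longrightarrow>
       (\<exists>x\<in>V. E x v \<and> E x w \<and> gdist V E u x = gdist V E u v - 1))"

definition locally_weakly_modular :: "'a set \<Rightarrow> ('a \<Rightarrow> 'a \<Rightarrow> bool) \<Rightarrow> bool" where
  "locally_weakly_modular V E \<longleftrightarrow>
    (\<forall>u\<in>V. \<forall>v\<in>V. \<forall>w\<in>V.
       E v w \<and> gdist V E u v = 2 \<and> gdist V E u w = 2 \<longrightarrow>
       (\<exists>x\<in>V. E x u \<and> E x v \<and> E x w)) \<and>
    (\<forall>u\<in>V. \<forall>v\<in>V. \<forall>w\<in>V. \<forall>z\<in>V.
       E z v \<and> E z w \<and> gdist V E v w = 2 \<and> gdist V E u v = 2 \<and> gdist V E u w = 2 \<and>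
       gdist V E u z = 3 \<longrightarrow>
       (\<exists>x\<in>V. E x u \<and> E x v \<and> E x w))"

definition is_square :: "'a set \<Rightarrow> ('a \<Rightarrow> 'a \<Rightarrow> bool) \<Rightarrow> 'a \<Rightarrow> 'a \<Rightarrow> 'a \<Rightarrow> 'a \<Rightarrow> bool" where
  "is_square V E x1 x2 x3 x4 \<longleftrightarrow> {x1, x2, x3, x4} \<subseteq> V \<and> distinct [x1, x2, x3, x4] \<and>
     E x1 x2 \<and> E x2 x3 \<and> E x3 x4 \<and> E x4 x1 \<and> \<not> E x1 x3 \<and> \<not> E x2 x4"

definition has_induced_K23 :: "'a set \<Rightarrow> ('a \<Rightarrow> 'a \<Rightarrow> bool) \<Rightarrow> bool" where
  "has_induced_K23 V E \<longleftrightarrow> (\<exists>a1 a2 b1 b2 b3. {a1, a2, b1, b2, b3} \<subseteq> V \<and>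
     distinct [a1, a2, b1, b2, b3] \<and>
     E a1 b1 \<and> E a1 b2 \<and> E a1 b3 \<and> E a2 b1 \<and> E a2 b2 \<and> E a2 b3 \<and>
     \<not> E a1 a2 \<and> \<not> E b1 b2 \<and> \<not> E b1 b3 \<and> \<not> E b2 b3)"

definition induced_W4 :: "'a set \<Rightarrow> ('a \<Rightarrow> 'a \<Rightarrow> bool) \<Rightarrow> 'a \<Rightarrow> 'a \<Rightarrow> 'a \<Rightarrow> 'a \<Rightarrow> 'a \<Rightarrow> bool" where
  "induced_W4 V E c x1 x2 x3 x4 \<longleftrightarrow> c \<in> V \<and> is_square V E x1 x2 x3 x4 \<and>
     distinct [c, x1, x2, x3, x4] \<and> E c x1 \<and> E c x2 \<and> E c x3 \<and> E c x4"

definition has_induced_W4_minus :: "'a set \<Rightarrow> ('a \<Rightarrow> 'a \<Rightarrow> bool) \<Rightarrow> bool" where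
  "has_induced_W4_minus V E \<longleftrightarrow> (\<exists>c x1 x2 x3 x4. c \<in> V \<and> is_square V E x1 x2 x3 x4 \<and>
     distinct [c, x1, x2, x3, x4] \<and> E c x1 \<and> E c x2 \<and> E c x3 \<and> \<not> E c x4)"

definition induced_M4 :: "'a set \<Rightarrow> ('a \<Rightarrow> 'a \<Rightarrow> bool) \<Rightarrow> 'a \<Rightarrow> 'a \<Rightarrow> 'a \<Rightarrow> 'a \<Rightarrow>
    'a \<Rightarrow> 'a \<Rightarrow> 'a \<Rightarrow> 'a \<Rightarrow> bool" where
  "induced_M4 V E x1 x2 x3 x4 a1 a2 a3 a4 \<longleftrightarrow> is_square V E x1 x2 x3 x4 \<and>
     {a1, a2, a3, a4} \<subseteq> V \<and> distinct [x1, x2, x3, x4, a1, a2, a3, a4] \<and>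
     E a1 a2 \<and> E a1 a3 \<and> E a1 a4 \<and> E a2 a3 \<and> E a2 a4 \<and> E a3 a4 \<and>
     E a1 x1 \<and> E a1 x2 \<and> \<not> E a1 x3 \<and> \<not> E a1 x4 \<and>
     \<not> E a2 x1 \<and> E a2 x2 \<and> E a2 x3 \<and> \<not> E a2 x4 \<and>
     \<not> E a3 x1 \<and> \<not> E a3 x2 \<and> E a3 x3 \<and> E a3 x4 \<and>
     E a4 x1 \<and> \<not> E a4 x2 \<and> \<not> E a4 x3 \<and> E a4 x4"

definition squares_in_W4_or_M4 :: "'a set \<Rightarrow> ('a \<Rightarrow> 'a \<Rightarrow> bool) \<Rightarrow> bool" where
  "squares_in_W4_or_M4 V E \<longleftrightarrow> (\<forall>x1 x2 x3 x4. is_square V E x1 x2 x3 x4 \<longrightarrow>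
     (\<exists>c y1 y2 y3 y4. induced_W4 V E c y1 y2 y3 y4 \<and>
        {x1, x2, x3, x4} \<subseteq> {c, y1, y2, y3, y4}) \<or>
     (\<exists>y1 y2 y3 y4 a1 a2 a3 a4. induced_M4 V E y1 y2 y3 y4 a1 a2 a3 a4 \<and>
        {x1, x2, x3, x4} \<subseteq> {y1, y2, y3, y4, a1, a2, a3, a4}))"

definition pre_median :: "'a set \<Rightarrow> ('a \<Rightarrow> 'a \<Rightarrow> bool) \<Rightarrow> bool" where
  "pre_median V E \<longleftrightarrow> weakly_modular V E \<and> \<not> has_induced_K23 V E \<and> \<not> has_induced_W4_minus V E"

definition gated :: "'a set \<Rightarrow> ('a \<Rightarrow> 'a \<Rightarrow> bool) \<Rightarrow> 'a set \<Rightarrow> bool" where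
  "gated V E A \<longleftrightarrow> A \<subseteq> V \<and> A \<noteq> {} \<and>
     (\<forall>x\<in>V. \<exists>x'\<in>A. \<forall>y\<in>A. x' \<in> interval V E x y)"

definition is_gated_amalgam :: "'a set \<Rightarrow> ('a \<Rightarrow> 'a \<Rightarrow> bool) \<Rightarrow> bool" where
  "is_gated_amalgam V E \<longleftrightarrow> (\<exists>A B. gated V E A \<and> gated V E B \<and> A \<noteq> V \<and> B \<noteq> V \<and>
     A \<inter> B \<noteq> {} \<and> A \<union> B = V \<and>
     (\<forall>x y. E x y \<longrightarrow> (x \<in> A \<and> y \<in> A) \<or> (x \<in> B \<and> y \<in> B)))"

definition cprod_adj :: "('a \<Rightarrow> 'a \<Rightarrow> bool) \<Rightarrow> ('a \<Rightarrow> 'a \<Rightarrow> bool) \<Rightarrow> 'a \<times> 'a \<Rightarrow> 'a \<times> 'a \<Rightarrow> bool" where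
  "cprod_adj E1 E2 p q \<longleftrightarrow> (fst p = fst q \<and> E2 (snd p) (snd q)) \<or> (snd p = snd q \<and> E1 (fst p) (fst q))"

text \<open>G is isomorphic to a Cartesian product of two nontrivial graphs
 (the factors can be represented on the vertex type of G, since each embeds in G)\<close>
definition is_cartesian_product :: "'a set \<Rightarrow> ('a \<Rightarrow> 'a \<Rightarrow> bool) \<Rightarrow> bool" where
  "is_cartesian_product V E \<longleftrightarrow> (\<exists>(V1::'a set) E1 (V2::'a set) E2 f.
     graph V1 E1 \<and> graph V2 E2 \<and> nontrivial_set V1 \<and> nontrivial_set V2 \<and>
     bij_betw f V (V1 \<times> V2) \<and> (\<forall>x\<in>V. \<forall>y\<in>V. E x y \<longleftrightarrow> cprod_adj E1 E2 (f x) (f y)))"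

definition prime_graph :: "'a set \<Rightarrow> ('a \<Rightarrow> 'a \<Rightarrow> bool) \<Rightarrow> bool" where
  "prime_graph V E \<longleftrightarrow> nontrivial_set V \<and> \<not> is_cartesian_product V E \<and> \<not> is_gated_amalgam V E"

text \<open>Elementary homotopies of edge paths in the triangle complex:
 removing a backtrack u v u, or replacing the two sides u v w of a triangle by the edge u w.\<close>
definition htpy_step :: "('a \<Rightarrow> 'a \<Rightarrow> bool) \<Rightarrow> 'a list \<Rightarrow> 'a list \<Rightarrow> bool" where
  "htpy_step E p q \<longleftrightarrow>
     (\<exists>xs ys u v. p = xs @ [u, v, u] @ ys \<and> q = xs @ [u] @ ys \<and> E u v) \<or>
     (\<exists>xs ys u v w. p = xs @ [u, v, w] @ ys \<and> q = xs @ [u, w] @ ys \<and> E u v \<and> E v w \<and> E u w)"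

definition edge_path_homotopic :: "('a \<Rightarrow> 'a \<Rightarrow> bool) \<Rightarrow> 'a list \<Rightarrow> 'a list \<Rightarrow> bool" where
  "edge_path_homotopic E = (\<lambda>p q. htpy_step E p q \<or> htpy_step E q p)\<^sup>*\<^sup>*"

definition triangle_complex_simply_connected :: "'a set \<Rightarrow> ('a \<Rightarrow> 'a \<Rightarrow> bool) \<Rightarrow> bool" where
  "triangle_complex_simply_connected V E \<longleftrightarrow> connected_graph V E \<and>
     (\<forall>p. walk V E p \<and> hd p = last p \<longrightarrow> edge_path_homotopic E p [hd p])"

end

theory Submission
  imports Defs
begin

text \<open>(i) to (ii): for a vertex \<open>x\<close> and a union \<open>A\<close> of components of the link of \<open>x\<close>, the vertices that all geodesics
  from \<open>x\<close> reach through \<open>A\<close> form a gated set. So the gated hull \<open>H\<close> of an edge has connected links, and then the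
  fibers of the gate map onto \<open>H\<close> have uniform boundaries. Either some fiber differs from its boundary, and \<open>G\<close> is a
  gated amalgam along it, or \<open>G\<close> is the Cartesian product of \<open>H\<close> and a fiber. Hence in a prime graph all links are
  connected, and a shortest link path between opposite corners of a square yields a \<open>W\<^sub>4\<close> or an \<open>M\<^sub>4\<close>.

  (ii) to (iii): any two geodesics with the same ends differ by triangles and squares, and squares are null-homotopic.

  (iii) to (i): a nontrivial proper gated set, or a product decomposition, gives a cocycle that is not a coboundary.

  (iv) to (iii): the universal cover is built level by level around a base vertex; local weak modularity makes the
  construction work and the cover weakly modular at the base vertex, and simple connectivity identifies it with \<open>G\<close>.\<close>

section \<open>Walks and distances\<close>

text \<open>Gatedness speaks of all distances, while the forbidden subgraphs control only
  neighborhoods. The bridge is \<open>two_closed_gated\<close>: in a weakly modular graph, a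
  connected set containing every common neighbor of any two of its vertices is gated. Cones, fibers,
  boundaries, intersections and the second half of an amalgam are all checked in this local form.
  For cones and fibers the two forbidden subgraphs act through one configuration: two nonadjacent
  vertices with three common neighbors, one of which sees neither of the others
  (\<open>three_common_neighbors\<close>). The hull of an edge enters because primeness is a global
  hypothesis about links that might be disconnected: the hull is small enough to lie in a single
  cone, so its own links are connected, and primeness then makes it everything. In the cover,
  identification of nodes must be transitive at each level. This needs that three levels up means
  distance three in \<open>G\<close>, which in turn needs common neighbors to lift at lower levels;
  hence one induction over levels (\<open>stage\<close>) carries all three facts. Integer 1-cochains
  detect essential cycles, so no fundamental group is built.\<close>

lemma walk_single [simp]: "walk V E [x] \<longleftrightarrow> x \<in> V"
  by (simp add: walk_def)

lemma walk_Cons2 [simp]: "walk V E (x # y # p) \<longleftrightarrow> x \<in> V \<and> E x y \<and> walk V E (y # p)"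
proof
  assume w: "walk V E (x # y # p)"
  then have a: "\<forall>i < Suc (length p). E ((x # y # p) ! i) ((x # y # p) ! Suc i)" and b: "x \<in> V" "y \<in> V" "set p \<subseteq> V"
    by (auto simp: walk_def)
  from a have "E x y" by (metis nth_Cons_0 nth_Cons_Suc zero_less_Suc)
  moreover have "\<forall>i < length p. E ((y # p) ! i) ((y # p) ! Suc i)"
    using a by (metis Suc_mono nth_Cons_Suc)
  ultimately show "x \<in> V \<and> E x y \<and> walk V E (y # p)" using b by (auto simp: walk_def)
next
  assume w: "x \<in> V \<and> E x y \<and> walk V E (y # p)"
  then show "walk V E (x # y # p)"
    unfolding walk_def by (auto simp: nth_Cons split: nat.splits)
qed

lemma walk_not_Nil: "walk V E p \<Longrightarrow> p \<noteq> []"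
  by (simp add: walk_def)

lemma walk_append:
  "walk V E p \<Longrightarrow> walk V E (last p # q) \<Longrightarrow> walk V E (p @ q)"
proof (induction p)
  case Nil then show ?case by (simp add: walk_def)
next
  case (Cons a p)
  then show ?case by (cases p) auto
qed

lemma walk_appendD:
  "walk V E (p @ [x] @ q) \<Longrightarrow> walk V E (p @ [x]) \<and> walk V E (x # q)"
proof (induction p)
  case Nil then show ?case by (cases q) (auto simp: walk_def)
next
  case (Cons a p)
  then show ?case by (cases p) auto
qed

lemma walk_rev:
  assumes "\<And>x y. E x y \<Longrightarrow> E y x" "walk V E p"
  shows "walk V E (rev p)"
  using assms(2)
proof (induction p)
  case Nil then show ?case by simp
next
  case (Cons a p)
  show ?case
  proof (cases p)
    case Nil then show ?thesis using Cons by simp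
  next
    case (Cons b q)
    have "walk V E p" "E a b" "a \<in> V" using Cons Cons.prems by auto
    then have "walk V E (rev p)" "E b a" "a \<in> V" "b \<in> V"
      using Cons Cons.IH assms(1) by (auto simp: walk_def)
    then have "walk V E (rev p @ [a])" using Cons by (intro walk_append) auto
    then show ?thesis by simp
  qed
qed

lemma walk_rtranclp:
  "walk V E p \<Longrightarrow> (\<lambda>x y. E x y \<and> x \<in> V \<and> y \<in> V)\<^sup>*\<^sup>* (hd p) (last p)"
proof (induction p)
  case Nil then show ?case by (simp add: walk_def)
next
  case (Cons a p)
  show ?case
  proof (cases p)
    case Nil then show ?thesis by simp
  next
    case (Cons b q)
    then have "E a b" "a \<in> V" "walk V E p" using Cons.prems by auto
    moreover from this have "b \<in> V" using Cons by (auto simp: walk_def)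
    ultimately show ?thesis using Cons.IH Cons by (auto intro: converse_rtranclp_into_rtranclp)
  qed
qed

lemma rtranclp_walk:
  assumes "(\<lambda>x y. E x y \<and> x \<in> V \<and> y \<in> V)\<^sup>*\<^sup>* u v" "u \<in> V"
  shows "\<exists>p. walk V E p \<and> hd p = u \<and> last p = v"
  using assms
proof (induction rule: rtranclp_induct)
  case base then show ?case by (intro exI[of _ "[u]"]) simp
next
  case (step y z)
  then obtain p where p: "walk V E p" "hd p = u" "last p = y" by blast
  then have "walk V E (p @ [z])" using step by (intro walk_append) auto
  then show ?case using p walk_not_Nil[of V E p] by (intro exI[of _ "p @ [z]"]) auto
qed

lemma connected_graphI:
  assumes "V \<noteq> {}" "\<And>u v. u \<in> V \<Longrightarrow> v \<in> V \<Longrightarrow> (\<lambda>x y. E x y \<and> x \<in> V \<and> y \<in> V)\<^sup>*\<^sup>* u v"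
  shows "connected_graph V E"
  using assms rtranclp_walk[of E V] by (auto simp: connected_graph_def)

lemma connected_graphD:
  assumes "connected_graph V E" "u \<in> V" "v \<in> V"
  shows "(\<lambda>x y. E x y \<and> x \<in> V \<and> y \<in> V)\<^sup>*\<^sup>* u v"
proof -
  obtain p where "walk V E p" "hd p = u" "last p = v" using assms unfolding connected_graph_def by blast
  then show ?thesis using walk_rtranclp[of V E p] by simp
qed

lemma crossing_edge:
  assumes "connected_graph V E" "u \<in> V" "v \<in> V" "u \<in> S" "v \<notin> S"
  obtains s t where "s \<in> S" "t \<notin> S" "s \<in> V" "t \<in> V" "E s t"
proof -
  have "(\<lambda>x y. E x y \<and> x \<in> V \<and> y \<in> V)\<^sup>*\<^sup>* u v"
    by (rule connected_graphD[OF assms(1-3)])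
  then have "v \<notin> S \<longrightarrow> (\<exists>s t. s \<in> S \<and> t \<notin> S \<and> s \<in> V \<and> t \<in> V \<and> E s t)"
    using assms(4)
  proof (induction rule: rtranclp_induct)
    case (step y z)
    then show ?case by (cases "y \<in> S") auto
  qed simp
  then show ?thesis using that assms(5) by blast
qed

locale cgraph =
  fixes V :: "'a set" and E :: "'a \<Rightarrow> 'a \<Rightarrow> bool"
  assumes graph: "graph V E"
begin

abbreviation d :: "'a \<Rightarrow> 'a \<Rightarrow> nat" where "d \<equiv> gdist V E"

lemma sym: "E x y \<Longrightarrow> E y x" and irrefl: "\<not> E x x"
  and inV: "E x y \<Longrightarrow> x \<in> V" "E x y \<Longrightarrow> y \<in> V" and conn: "connected_graph V E"
  using graph unfolding graph_def by blast+

lemma neq: "E x y \<Longrightarrow> x \<noteq> y"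
  using irrefl by blast

lemma geodesic:
  assumes "u \<in> V" "v \<in> V"
  obtains p where "walk V E p" "hd p = u" "last p = v" "length p = Suc (d u v)"
proof -
  obtain p where "walk V E p \<and> hd p = u \<and> last p = v" using conn assms unfolding connected_graph_def by blast
  moreover from this have "length p = Suc (length p - 1)" using walk_not_Nil[of V E p] by (cases p) auto
  ultimately have "\<exists>n p. walk V E p \<and> hd p = u \<and> last p = v \<and> length p = Suc n" by blast
  from LeastI_ex[OF this] show ?thesis using that unfolding gdist_def by blast
qed

lemma d_le_walk:
  assumes "walk V E p" "hd p = u" "last p = v" "length p = Suc n"
  shows "d u v \<le> n"
  unfolding gdist_def by (rule Least_le) (use assms in blast)

lemma d_refl [simp]: "u \<in> V \<Longrightarrow> d u u = 0"
  using d_le_walk[of "[u]" u u 0] by simp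

lemma d_0: assumes "u \<in> V" "v \<in> V" shows "d u v = 0 \<longleftrightarrow> u = v"
proof
  assume "d u v = 0"
  then obtain p where "walk V E p" "hd p = u" "last p = v" "length p = Suc 0"
    using geodesic[OF assms] by metis
  then show "u = v" by (cases p) auto
qed (use assms in simp)

lemma d_sym: assumes "u \<in> V" "v \<in> V" shows "d u v = d v u"
proof -
  have "d b a \<le> d a b" if ab: "a \<in> V" "b \<in> V" for a b
  proof -
    obtain p where p: "walk V E p" "hd p = a" "last p = b" "length p = Suc (d a b)"
      using geodesic[OF ab] .
    show ?thesis
      using walk_rev[OF sym p(1)] p walk_not_Nil[of V E p]
      by (intro d_le_walk[of "rev p"]) (auto simp: hd_rev last_rev)
  qed
  then show ?thesis using assms by (simp add: le_antisym)
qed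

lemma d_triangle: assumes "u \<in> V" "v \<in> V" "w \<in> V" shows "d u w \<le> d u v + d v w"
proof -
  obtain p where p: "walk V E p" "hd p = u" "last p = v" "length p = Suc (d u v)"
    using geodesic[OF assms(1,2)] .
  obtain q where q: "walk V E q" "hd q = v" "last q = w" "length q = Suc (d v w)"
    using geodesic[OF assms(2,3)] .
  then have "q = v # tl q" by (cases q) auto
  then have *: "walk V E (last p # tl q)" using q p by simp
  show ?thesis
  proof (rule d_le_walk[OF walk_append[OF p(1) *]])
    show "hd (p @ tl q) = u" using p walk_not_Nil[OF p(1)] by simp
    show "last (p @ tl q) = w" using p q \<open>q = v # tl q\<close>
      by (metis append_Nil2 last.simps last_appendR)
    show "length (p @ tl q) = Suc (d u v + d v w)" using p q by simp
  qed
qed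

lemma d_edge: "E u v \<Longrightarrow> d u v = Suc 0"
  using d_le_walk[of "[u, v]" u v 1] inV[of u v] d_0[of u v] irrefl[of u] by fastforce

lemma d_pred:
  assumes "u \<in> V" "v \<in> V" "d u v = Suc k"
  obtains w where "w \<in> V" "E w v" "d u w = k"
proof -
  obtain p where p: "walk V E p" "hd p = u" "last p = v" "length p = Suc (d u v)"
    using geodesic[OF assms(1,2)] .
  have "length p = Suc (Suc k)" using p assms by simp
  then obtain q x where "p = q @ [x]" "length q = Suc k" by (metis length_Suc_conv_rev)
  moreover then obtain q' w where "q = q' @ [w]" by (metis length_Suc_conv_rev)
  ultimately obtain q w x where pq: "p = q @ [w, x]" by simp
  then have "x = v" using p by simp
  have w: "walk V E (q @ [w])" "walk V E (w # [x])" using walk_appendD[of V E q w "[x]"] p pq by auto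
  have "hd (q @ [w]) = u" using p pq by (cases q) auto
  then have "d u w \<le> k" using w pq p assms by (intro d_le_walk[OF w(1)]) auto
  moreover have e: "E w v" "w \<in> V" using w \<open>x = v\<close> by auto
  moreover have "d u v \<le> d u w + d w v" using d_triangle assms e by blast
  ultimately show ?thesis using that d_edge[of w v] assms by force
qed

lemma d_1: assumes "u \<in> V" "v \<in> V" shows "d u v = Suc 0 \<longleftrightarrow> E u v"
  using d_pred[OF assms, of 0] d_edge[of u v] d_0 assms by metis

lemma d_step: "u \<in> V \<Longrightarrow> E v w \<Longrightarrow> d u w \<le> Suc (d u v)"
  using d_triangle[of u v w] d_edge[of v w] inV[of v w] by simp

lemma d_2I: "E u w \<Longrightarrow> E w v \<Longrightarrow> u \<noteq> v \<Longrightarrow> \<not> E u v \<Longrightarrow> d u v = 2"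
  using d_step[of u w v] inV[of u w] inV[of w v] d_edge[of u w] d_0[of u v] d_1[of u v]
  by (cases "d u v = 0"; cases "d u v = 1") auto

lemma d_2D: assumes "d u v = 2" "u \<in> V" "v \<in> V"
  shows "u \<noteq> v \<and> \<not> E u v \<and> (\<exists>w. E u w \<and> E w v)"
proof -
  obtain w where "E w v" "d u w = 1" "w \<in> V" using d_pred[of u v 1] assms by (metis One_nat_def Suc_1)
  then show ?thesis using assms d_1[of u w] d_edge[of u v] d_0[of u v] by auto
qed

lemma connected_edge:
  assumes "nontrivial_set V" shows "\<exists>u v. E u v"
proof -
  obtain x y where "x \<in> V" "y \<in> V" "x \<noteq> y" using assms unfolding nontrivial_set_def by blast
  then show ?thesis using crossing_edge[OF conn, of x y "{x}"] by blast
qed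

end

section \<open>Gated sets\<close>

text \<open>\<open>u\<close> and \<open>v\<close> may be adjacent or not, so closure under triangles
  and under paths of length two are bundled. This is the local shadow of gatedness
  (\<open>gated_two_closed\<close>, \<open>two_closed_gated\<close>).\<close>

definition two_closed :: "'a set \<Rightarrow> ('a \<Rightarrow> 'a \<Rightarrow> bool) \<Rightarrow> 'a set \<Rightarrow> bool" where
  "two_closed V E A \<longleftrightarrow> (\<forall>y\<in>V. \<forall>u\<in>A. \<forall>v\<in>A. u \<noteq> v \<and> E u y \<and> E v y \<longrightarrow> y \<in> A)"

definition gate :: "'a set \<Rightarrow> ('a \<Rightarrow> 'a \<Rightarrow> bool) \<Rightarrow> 'a set \<Rightarrow> 'a \<Rightarrow> 'a" where
  "gate V E A x = (SOME x'. x' \<in> A \<and> (\<forall>y\<in>A. x' \<in> interval V E x y))"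

context cgraph
begin

lemma two_closedD: "two_closed V E A \<Longrightarrow> u \<in> A \<Longrightarrow> v \<in> A \<Longrightarrow> u \<noteq> v \<Longrightarrow> E u y \<Longrightarrow> E v y \<Longrightarrow> y \<in> A"
  unfolding two_closed_def using inV by blast

abbreviation g :: "'a set \<Rightarrow> 'a \<Rightarrow> 'a" where "g \<equiv> gate V E"

lemma gated_subset: "gated V E A \<Longrightarrow> A \<subseteq> V"
  unfolding gated_def by blast

lemma gated_inV: "gated V E A \<Longrightarrow> x \<in> A \<Longrightarrow> x \<in> V"
  unfolding gated_def by blast

lemma gate:
  assumes "gated V E A" "x \<in> V"
  shows "g A x \<in> A" "y \<in> A \<Longrightarrow> d x y = d x (g A x) + d (g A x) y"
proof -
  have "\<exists>x'. x' \<in> A \<and> (\<forall>y\<in>A. x' \<in> interval V E x y)" using assms unfolding gated_def by blast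
  from someI_ex[OF this] show "g A x \<in> A" "y \<in> A \<Longrightarrow> d x y = d x (g A x) + d (g A x) y"
    unfolding gate_def interval_def by auto
qed

lemma gate_V: "gated V E A \<Longrightarrow> x \<in> V \<Longrightarrow> g A x \<in> V"
  using gate(1) gated_inV by blast

text \<open>The gate splits \<open>d x z\<close>, so a vertex of \<open>A\<close> that is no farther
  from \<open>x\<close> has distance 0 from the gate. Gates are computed below by this
  criterion.\<close>

lemma gate_unique:
  assumes "gated V E A" "x \<in> V" "z \<in> A" "d x z \<le> d x (g A x)"
  shows "g A x = z"
proof -
  have "d (g A x) z = 0" using gate(2)[OF assms(1-3)] assms(4) by simp
  then show ?thesis using d_0[OF gate_V[OF assms(1,2)]] gated_inV[OF assms(1,3)] by simp
qed

lemma gate_in: "gated V E A \<Longrightarrow> x \<in> A \<Longrightarrow> g A x = x"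
  using gate_unique[of A x x] gated_inV by fastforce

lemma gate_le: "gated V E A \<Longrightarrow> x \<in> V \<Longrightarrow> y \<in> A \<Longrightarrow> d x (g A x) \<le> d x y"
  using gate(2) by fastforce

lemma gate_neighbor:
  assumes "gated V E A" "x \<notin> A" "y \<in> A" "E x y"
  shows "g A x = y"
proof -
  have x: "x \<in> V" using inV assms by blast
  have "d x (g A x) \<noteq> 0" using d_0[OF x gate_V[OF assms(1) x]] gate(1)[OF assms(1) x] assms by auto
  then show ?thesis using gate_unique[OF assms(1) x assms(3)] d_edge[OF assms(4)] by simp
qed

text \<open>Add the gate equations for \<open>x\<close> against \<open>g A y\<close> and for
  \<open>y\<close> against \<open>g A x\<close>: the distances to the gates cancel and twice the
  claim remains.\<close>

lemma gate_nonexpansive: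
  assumes "gated V E A" "x \<in> V" "y \<in> V"
  shows "d (g A x) (g A y) \<le> d x y"
proof -
  note V = gate_V[OF assms(1,2)] gate_V[OF assms(1,3)]
  have "d x (g A y) = d x (g A x) + d (g A x) (g A y)" "d y (g A x) = d y (g A y) + d (g A y) (g A x)"
    using gate assms by blast+
  moreover have "d x (g A y) \<le> d x y + d y (g A y)" "d y (g A x) \<le> d y x + d x (g A x)"
    using d_triangle assms V by blast+
  moreover have "d y x = d x y" "d (g A y) (g A x) = d (g A x) (g A y)" using d_sym assms V by blast+
  ultimately show ?thesis by linarith
qed

lemma gate_edge:
  assumes "gated V E A" "E x y" "g A x \<noteq> g A y"
  shows "E (g A x) (g A y)"
proof -
  note xy = inV[OF assms(2)]
  note V = gate_V[OF assms(1) xy(1)] gate_V[OF assms(1) xy(2)]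
  have "d (g A x) (g A y) \<le> Suc 0" using gate_nonexpansive[OF assms(1) xy] d_edge[OF assms(2)] by simp
  then have "d (g A x) (g A y) = Suc 0" using d_0[OF V] assms(3) by simp
  then show ?thesis using d_1[OF V] by simp
qed

text \<open>Fibers of the gate map are therefore star-shaped around their base vertex, which gives
  \<open>fiber_down\<close> and later the vanishing of a cocycle along fibers.\<close>

lemma gate_on_geodesic:
  assumes "gated V E A" "x \<in> V" "w \<in> V" "d x w + d w (g A x) = d x (g A x)"
  shows "g A w = g A x"
proof -
  note V = gate_V[OF assms(1,2)] gate_V[OF assms(1,3)]
  have "d x (g A w) \<le> d x w + d w (g A w)" using d_triangle assms(2,3) V by blast
  moreover have "d x (g A w) = d x (g A x) + d (g A x) (g A w)" "d w (g A x) = d w (g A w) + d (g A w) (g A x)"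
    using gate assms by blast+
  ultimately have "d (g A w) (g A x) = 0" using assms(4) by linarith
  then show ?thesis using d_0 V by blast
qed

text \<open>Both \<open>d w x\<close> and \<open>d w y\<close> pass through the gate of
  \<open>w\<close>; a gate other than \<open>w\<close> would give a shortcut from \<open>x\<close>
  to \<open>y\<close>.\<close>

lemma gated_convex:
  assumes "gated V E A" "x \<in> A" "y \<in> A" "w \<in> V" "d x w + d w y = d x y"
  shows "w \<in> A"
proof -
  have V: "x \<in> V" "y \<in> V" "g A w \<in> V" using gate_V gated_inV assms by blast+
  have "d w x = d w (g A w) + d (g A w) x" "d w y = d w (g A w) + d (g A w) y" using gate assms by blast+
  moreover have "d x y \<le> d x (g A w) + d (g A w) y" using d_triangle V by blast
  moreover have "d x w = d w x" "d x (g A w) = d (g A w) x" using d_sym V assms by blast+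
  ultimately have "d w (g A w) = 0" using assms(5) by linarith
  then have "w = g A w" using d_0[OF assms(4) V(3)] by simp
  then show ?thesis using gate(1)[OF assms(1,4)] by simp
qed

lemma gated_two_closed:
  assumes "gated V E A" shows "two_closed V E A"
  unfolding two_closed_def
proof (intro ballI impI)
  fix y u v assume "y \<in> V" "u \<in> A" "v \<in> A" and *: "u \<noteq> v \<and> E u y \<and> E v y"
  then show "y \<in> A" using gate_neighbor[OF assms, of y u] gate_neighbor[OF assms, of y v] sym by blast
qed

lemma gated_reachable:
  assumes "gated V E A" "x \<in> A" "y \<in> A"
  shows "(\<lambda>x y. E x y \<and> x \<in> A \<and> y \<in> A)\<^sup>*\<^sup>* x y"
  using assms(3)
proof (induction "d x y" arbitrary: y)
  case 0
  then show ?case using d_0[of x y] gated_inV assms by auto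
next
  case (Suc k)
  have V: "x \<in> V" "y \<in> V" using gated_inV assms Suc by blast+
  obtain w where w: "w \<in> V" "E w y" "d x w = k" using d_pred[OF V] Suc(2) by metis
  then have "w \<in> A" using gated_convex[OF assms(1,2) Suc(3) w(1)] Suc(2) d_edge by simp
  then show ?case using Suc(1)[of w] w Suc(3) by (simp add: rtranclp.rtrancl_into_rtrancl)
qed

text \<open>Strict descent in \<open>d x\<close> can stop only at \<open>x\<close>, so both vertices
  are joined to \<open>x\<close> inside \<open>A\<close>. This supplies the connectivity of cones,
  fibers, boundaries and intersections.\<close>

lemma descending_reachable:
  assumes desc: "\<And>v. v \<in> A \<Longrightarrow> v \<noteq> x \<Longrightarrow> \<exists>w\<in>A. E w v \<and> d x w < d x v" and "u \<in> A" "v \<in> A"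
  shows "(\<lambda>p q. E p q \<and> p \<in> A \<and> q \<in> A)\<^sup>*\<^sup>* u v"
proof -
  let ?R = "\<lambda>p q. E p q \<and> p \<in> A \<and> q \<in> A"
  have reach: "?R\<^sup>*\<^sup>* x v" if "v \<in> A" for v
    using that
  proof (induction "d x v" arbitrary: v rule: less_induct)
    case less
    show ?case
    proof (cases "v = x")
      case False
      then obtain w where w: "w \<in> A" "E w v" "d x w < d x v" using desc less by blast
      have "?R\<^sup>*\<^sup>* x w" by (rule less(1)[OF w(3,1)])
      then show ?thesis by (rule rtranclp.rtrancl_into_rtrancl) (use w less in simp)
    qed simp
  qed
  have "symp ?R" using sym by (auto intro: sympI)
  then have "symp ?R\<^sup>*\<^sup>*" by (rule symp_rtranclp)
  then have "?R\<^sup>*\<^sup>* u x" using reach[OF assms(2)] by (rule sympD)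
  then show ?thesis using reach[OF assms(3)] by (rule rtranclp_trans)
qed

text \<open>Gates compose: project to \<open>A\<close>, then to \<open>B\<close>. The second gate
  lies on a geodesic between two vertices of \<open>A\<close>, so convexity keeps it in
  \<open>A\<close>.\<close>

lemma gated_Int:
  assumes A: "gated V E A" and B: "gated V E B" and "A \<inter> B \<noteq> {}"
  shows "gated V E (A \<inter> B)"
proof -
  obtain c where c: "c \<in> A" "c \<in> B" using assms by blast
  have "\<exists>x'\<in>A \<inter> B. \<forall>y\<in>A \<inter> B. x' \<in> interval V E x y" if x: "x \<in> V" for x
  proof -
    define a where "a = g A x"
    define b where "b = g B a"
    have V: "a \<in> V" "b \<in> V" using a_def b_def gate_V A B x by auto
    have "b \<in> B" "d a c = d a b + d b c"
      using gate(1)[OF B V(1)] gate(2)[OF B V(1) c(2)] unfolding b_def by blast+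
    moreover have aA: "a \<in> A" using gate(1)[OF A x] a_def by simp
    ultimately have "b \<in> A \<inter> B" using gated_convex[OF A aA c(1) V(2)] by simp
    moreover have "b \<in> interval V E x y" if y: "y \<in> A \<inter> B" for y
    proof -
      have "d x y = d x a + d a y" "d x b = d x a + d a b" "d a y = d a b + d b y"
        using gate(2)[OF A x, of y] gate(2)[OF A x, of b] gate(2)[OF B V(1), of y] y \<open>b \<in> A \<inter> B\<close>
        unfolding a_def b_def by blast+
      then show ?thesis using V by (simp add: interval_def)
    qed
    ultimately show ?thesis by blast
  qed
  then show ?thesis using assms gated_subset[OF A] unfolding gated_def by blast
qed

end

section \<open>Weakly modular graphs: gatedness as a local property\<close>

locale wmgraph = cgraph +
  assumes weakly_modular: "weakly_modular V E"
begin

lemma tc: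
  assumes "u \<in> V" "E v w" "d u v = Suc k" "d u w = Suc k"
  obtains x where "x \<in> V" "E x v" "E x w" "d u x = k"
proof (cases k)
  case 0
  then show ?thesis using that[of u] assms d_1 inV by simp
next
  case (Suc j)
  have "v \<in> V" "w \<in> V" using inV assms by auto
  moreover have "d v w = 1" using d_edge[OF assms(2)] by simp
  moreover have "1 < d u v" "d u v = d u w" using assms Suc by auto
  ultimately obtain x where "x\<in>V" "E x v" "E x w" "d u x = d u v - 1"
    using weakly_modular assms(1) unfolding weakly_modular_def by blast
  then show ?thesis using that assms by simp
qed

text \<open>Adjacent \<open>v\<close>, \<open>w\<close> are handed to the triangle condition and
  \<open>k = 0\<close> to the vertex \<open>u\<close>, so later arguments need not ask whether two
  lower neighbors of \<open>z\<close> are adjacent.\<close>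

lemma qc:
  assumes "u \<in> V" "E v z" "E w z" "v \<noteq> w" "d u v = Suc k" "d u w = Suc k" "d u z = Suc (Suc k)"
  obtains x where "x \<in> V" "E x v" "E x w" "d u x = k"
proof (cases "E v w")
  case True
  then show ?thesis using tc[OF assms(1) True assms(5,6)] that by blast
next
  case False
  show ?thesis
  proof (cases k)
    case 0
    then show ?thesis using that[of u] assms d_1 inV by simp
  next
    case (Suc j)
    have "v \<in> V" "w \<in> V" "z \<in> V" using inV assms by auto
    moreover have "d v z = 1" "d w z = 1" using d_edge[OF assms(2)] d_edge[OF assms(3)] by simp_all
    moreover have "2 \<le> d u v" "d u v = d u w" "d u v = d u z - 1" using assms Suc by auto
    moreover have "d v w = 2" using d_2I[OF assms(2) sym[OF assms(3)] assms(4) False] .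
    ultimately obtain x where "x\<in>V" "E x v" "E x w" "d u x = d u v - 1"
      using weakly_modular assms(1) unfolding weakly_modular_def by blast
    then show ?thesis using that assms by simp
  qed
qed

text \<open>Starting from a vertex \<open>m\<close> of \<open>A\<close> closest to \<open>x\<close>, the triangle and quadrangle conditions take place
  inside \<open>A\<close>, so the set of vertices of \<open>A\<close> that are reached from \<open>m\<close> by paths of \<open>A\<close> strictly ascending with
  respect to \<open>x\<close> is closed under adjacency in \<open>A\<close>.\<close>

lemma two_closed_gated:
  assumes AV: "A \<subseteq> V" "A \<noteq> {}"
    and cl: "two_closed V E A"
    and con: "\<And>x y. x \<in> A \<Longrightarrow> y \<in> A \<Longrightarrow> (\<lambda>x y. E x y \<and> x \<in> A \<and> y \<in> A)\<^sup>*\<^sup>* x y"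
  shows "gated V E A"
  unfolding gated_def
proof (intro conjI ballI)
  fix x assume x: "x \<in> V"
  obtain m where m: "m \<in> A" and min: "\<And>y. y \<in> A \<Longrightarrow> d x m \<le> d x y"
    using ex_has_least_nat[of "\<lambda>y. y \<in> A" _ "d x"] AV by blast
  define R where "R a b \<longleftrightarrow> E a b \<and> a \<in> A \<and> b \<in> A \<and> d x b = Suc (d x a)" for a b
  have RA: "y \<in> A" if "R\<^sup>*\<^sup>* m y" for y using that by (cases rule: rtranclp.cases) (auto simp: R_def m)
  have down: "R\<^sup>*\<^sup>* m z" if "R\<^sup>*\<^sup>* m y" "z \<in> A" "E z y" "Suc (d x z) = d x y" for y z
    using that
  proof (induction "d x y" arbitrary: y z rule: less_induct)
    case less
    from less.prems(1) show ?case
    proof (cases rule: rtranclp.cases)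
      case rtrancl_refl
      then show ?thesis using less.prems min[of z] by simp
    next
      case (rtrancl_into_rtrancl p)
      then have p: "R\<^sup>*\<^sup>* m p" "E p y" "p \<in> A" "y \<in> A" "d x y = Suc (d x p)" by (auto simp: R_def)
      show ?thesis
      proof (cases "p = z")
        case False
        have "d x z \<noteq> 0" using d_0[of x z] d_0[of x p] x p False less.prems AV by auto
        then obtain k where k: "d x z = Suc k" by (cases "d x z") auto
        then obtain s where s: "s \<in> V" "E s p" "E s z" "d x s = k"
          using qc[OF x p(2) less.prems(3) False, of k] p less.prems by auto
        then have "s \<in> A" using two_closedD[OF cl p(3) less.prems(2) False, of s] sym by blast
        moreover from this have "R\<^sup>*\<^sup>* m s" using less.hyps[OF _ p(1), of s] p s k less.prems by simp
        moreover have "R s z" using \<open>s \<in> A\<close> s less.prems k unfolding R_def by simp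
        ultimately show ?thesis by simp
      qed (use p in simp)
    qed
  qed
  have across: "R\<^sup>*\<^sup>* m z" if "R\<^sup>*\<^sup>* m y" "z \<in> A" "E z y" "d x z = d x y" for y z
  proof -
    have y: "y \<in> A" using RA that by blast
    have "d x z \<noteq> 0" using d_0[of x z] d_0[of x y] x y that AV neq[OF that(3)] by auto
    then obtain k where k: "d x z = Suc k" by (cases "d x z") auto
    have "d x y = Suc k" using k that by simp
    from tc[OF x \<open>E z y\<close> k this] obtain s where s: "s \<in> V" "E s z" "E s y" "d x s = k" .
    then have "s \<in> A" using two_closedD[OF cl that(2) y neq[OF that(3)], of s] sym by blast
    then have "R\<^sup>*\<^sup>* m s" "R s z" using down[OF that(1)] s k that unfolding R_def by auto
    then show ?thesis by simp
  qed
  have all: "R\<^sup>*\<^sup>* m y" if "y \<in> A" for y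
    using con[OF m that]
  proof (induction rule: rtranclp_induct)
    case (step y z)
    then have yz: "E y z" "y \<in> A" "z \<in> A" "y \<in> V" "z \<in> V" using inV by auto
    have "d x z \<le> Suc (d x y)" "d x y \<le> Suc (d x z)" using d_step x yz(1) sym by blast+
    then consider "d x z = Suc (d x y)" | "Suc (d x z) = d x y" | "d x z = d x y" by linarith
    then show ?case
    proof cases
      case 1
      then have "R y z" using yz unfolding R_def by simp
      then show ?thesis using step.IH by simp
    qed (use down[OF step.IH yz(3) sym[OF yz(1)]] across[OF step.IH yz(3) sym[OF yz(1)]] in auto)
  qed simp
  have "m \<in> interval V E x y" if "y \<in> A" for y
  proof -
    have mV: "m \<in> V" using m AV by blast
    \<comment> \<open>Along an ascending path \<open>d x\<close> grows by exactly one per edge and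
      \<open>d m\<close> by at most one, so \<open>m\<close> lies on a geodesic from
      \<open>x\<close> to \<open>y\<close>.\<close>
    have "d x m + d m y \<le> d x y" using all[OF that]
    proof (induction rule: rtranclp_induct)
      case (step y z)
      then show ?case using d_step[OF mV, of y z] unfolding R_def by simp
    qed (use mV in simp)
    moreover have "d x y \<le> d x m + d m y" using d_triangle[OF x mV, of y] that AV by blast
    ultimately show ?thesis using mV by (simp add: interval_def)
  qed
  then show "\<exists>x'\<in>A. \<forall>y\<in>A. x' \<in> interval V E x y" using m by blast
qed (use assms in auto)

end

section \<open>Pre-median graphs and cones over links\<close>

definition link_conn :: "('a \<Rightarrow> 'a \<Rightarrow> bool) \<Rightarrow> 'a \<Rightarrow> 'a \<Rightarrow> 'a \<Rightarrow> bool" where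
  "link_conn E x = (\<lambda>p q. E x p \<and> E x q \<and> E p q)\<^sup>*\<^sup>*"

locale premedian = cgraph +
  assumes pre_median: "pre_median V E"
begin

sublocale wmgraph
  using pre_median by unfold_locales (simp add: pre_median_def)

lemma no_K23:
  assumes "E a1 b1" "E a1 b2" "E a1 b3" "E a2 b1" "E a2 b2" "E a2 b3" "a1 \<noteq> a2" "\<not> E a1 a2"
    "b1 \<noteq> b2" "b1 \<noteq> b3" "b2 \<noteq> b3" "\<not> E b1 b2" "\<not> E b1 b3" "\<not> E b2 b3"
  shows False
proof -
  have "has_induced_K23 V E" unfolding has_induced_K23_def
    by (rule exI[of _ a1], rule exI[of _ a2], rule exI[of _ b1], rule exI[of _ b2], rule exI[of _ b3])
      (use assms inV neq in auto)
  then show False using pre_median unfolding pre_median_def by blast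
qed

lemma no_W4_minus:
  assumes "E x1 x2" "E x2 x3" "E x3 x4" "E x4 x1" "x1 \<noteq> x3" "x2 \<noteq> x4" "\<not> E x1 x3" "\<not> E x2 x4"
    "E c x1" "E c x2" "E c x3" "c \<noteq> x4"
  shows "E c x4"
proof (rule ccontr)
  assume "\<not> E c x4"
  then have "has_induced_W4_minus V E" unfolding has_induced_W4_minus_def is_square_def
    by (intro exI[of _ c] exI[of _ x1] exI[of _ x2] exI[of _ x3] exI[of _ x4])
      (use assms inV neq in auto)
  then show False using pre_median unfolding pre_median_def by blast
qed

text \<open>If \<open>u\<close>, \<open>v\<close> are nonadjacent, the five vertices induce
  \<open>K23\<close>. If they are adjacent, \<open>p, u, q, w\<close> is a square and
  \<open>v\<close> sees three of its corners, so it must see \<open>w\<close>.\<close>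

lemma three_common_neighbors:
  assumes "E p u" "E p v" "E p w" "E q u" "E q v" "E q w" "p \<noteq> q" "\<not> E p q"
    "u \<noteq> v" "w \<noteq> u" "w \<noteq> v" "\<not> E w u" "\<not> E w v"
  shows False
proof (cases "E u v")
  case True
  then have "E v w" using no_W4_minus[of p u q w v] assms sym by blast
  then show ?thesis using assms sym by blast
next
  case False
  then show ?thesis using no_K23[of p u v w q] assms sym by blast
qed

definition cone :: "'a \<Rightarrow> 'a set \<Rightarrow> 'a set" where
  "cone x A = {v \<in> V. \<forall>b. E x b \<and> Suc (d b v) = d x v \<longrightarrow> b \<in> A}"

lemma cone_down:
  assumes "x \<in> V" "v \<in> cone x A" "w \<in> V" "d x w + d w v = d x v"
  shows "w \<in> cone x A"
  unfolding cone_def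
proof (intro CollectI conjI allI impI)
  fix b assume b: "E x b \<and> Suc (d b w) = d x w"
  have V: "b \<in> V" "v \<in> V" using b inV assms unfolding cone_def by blast+
  have "d b v \<le> d b w + d w v" "d x v \<le> d x b + d b v" using d_triangle V assms by blast+
  then have "Suc (d b v) = d x v" using assms b d_edge[of x b] by simp
  then show "b \<in> A" using assms b unfolding cone_def by blast
qed fact

lemma cone_edge_down:
  assumes "x \<in> V" "v \<in> cone x A" "E w v" "Suc (d x w) = d x v"
  shows "w \<in> cone x A"
  using cone_down[OF assms(1,2), of w] assms inV[of w v] d_edge[of w v] by auto

lemma cone_base: "x \<in> V \<Longrightarrow> x \<in> cone x A"
  unfolding cone_def by simp

lemma cone_neighbor: assumes "E x a" shows "a \<in> cone x A \<longleftrightarrow> a \<in> A"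
proof -
  have "x \<in> V" "a \<in> V" using inV assms by auto
  moreover have "b = a" if "E x b" "Suc (d b a) = d x a" for b
    using that d_edge[OF assms] d_0[of b a] inV[of x b] \<open>a \<in> V\<close> by auto
  ultimately show ?thesis using assms d_edge[OF assms] unfolding cone_def by auto
qed

text \<open>Shorten at \<open>y\<close> a geodesic that leaves \<open>x\<close> through some
  \<open>b\<close> outside \<open>A\<close>: it still leaves through \<open>b\<close>. Level at
  least two keeps \<open>w\<close> away from the apex, which always belongs to the cone.\<close>

lemma not_cone_pred:
  assumes "x \<in> V" "y \<in> V" "y \<notin> cone x A" "d x y \<ge> 2"
  obtains w where "E w y" "Suc (d x w) = d x y" "w \<notin> cone x A"
proof -
  obtain b where b: "E x b" "Suc (d b y) = d x y" "b \<notin> A" using assms unfolding cone_def by blast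
  have bV: "b \<in> V" using inV b by blast
  obtain k where "d b y = Suc k" using b assms by (cases "d b y") auto
  then obtain w where w: "w \<in> V" "E w y" "d b w = k" using d_pred[OF bV assms(2)] by blast
  have "d x w \<le> d x b + d b w" "d x y \<le> Suc (d x w)" using d_triangle d_step assms bV w by blast+
  then have "d x w = Suc k" using d_edge[OF b(1)] b w \<open>d b y = Suc k\<close> by simp
  then show ?thesis using that[OF w(2)] b w \<open>d b y = Suc k\<close> unfolding cone_def by auto
qed

text \<open>Induction on \<open>d x y\<close>, by the levels of \<open>u\<close> and
  \<open>v\<close> relative to \<open>y\<close>. A \<open>y\<close> outside the cone has a lower
  neighbor \<open>w\<close> outside, and the induction hypothesis for \<open>w\<close> says that
  \<open>w\<close> has at most one neighbor in the cone.\<close>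

lemma cone_two_closed:
  assumes x: "x \<in> V" and A: "A \<subseteq> {a. E x a}" and union: "\<And>a b. a \<in> A \<Longrightarrow> E x b \<Longrightarrow> E a b \<Longrightarrow> b \<in> A"
  shows "two_closed V E (cone x A)"
proof -
  have "y \<in> cone x A" if "u \<in> cone x A" "v \<in> cone x A" "u \<noteq> v" "E u y" "E v y" for y u v
    using that
  proof (induction "d x y" arbitrary: y u v rule: less_induct)
    case less
    note IH = less(1) and u = less(2) and v = less(3) and uv = less(4) and uy = less(5) and vy = less(6)
    have V: "y \<in> V" "u \<in> V" "v \<in> V" using inV uy vy by blast+
    have lev: "d x y \<le> Suc (d x u)" "d x u \<le> Suc (d x y)" if "E u y" for u
      using d_step[OF x that] d_step[OF x sym[OF that]] by auto
    show ?case
    proof (cases "d x y \<ge> 2")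
      case False
      then consider "d x y = 0" | "d x y = 1" by linarith
      then show ?thesis
      proof cases
        case 1 then show ?thesis using d_0 V x cone_base by auto
      next
        case 2
        then have xy: "E x y" using d_1 V x by simp
        \<comment> \<open>One of \<open>u\<close>, \<open>v\<close> is not the apex. If it is
          adjacent to \<open>x\<close>, the closure of \<open>A\<close> in the link applies;
          otherwise it lies above \<open>y\<close>.\<close>
        obtain w where w: "w \<in> cone x A" "E w y" "w \<noteq> x" using u v uv uy vy by (cases "u = x") auto
        have wV: "w \<in> V" "d x w \<noteq> 0" using w inV x d_0[of x w] by auto
        show ?thesis
        proof (cases "d x w = 1")
          case True
          then have xw: "E x w" using d_1 wV x by simp
          then have "w \<in> A" using w cone_neighbor by blast
          then show ?thesis using union[OF _ xy w(2)] cone_neighbor[OF xy] by blast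
        next
          case False
          then have "Suc (d x y) = d x w" using lev[OF w(2)] 2 wV by linarith
          then show ?thesis using cone_edge_down[OF x w(1) sym[OF w(2)]] by blast
        qed
      qed
    next
      case y2: True
      then have "d x y = Suc (Suc (d x y - 2))" by simp
      then obtain k where k: "d x y = Suc (Suc k)" by blast
      \<comment> \<open>Both below: \<open>c2\<close> and \<open>c3\<close> are cone neighbors of
        \<open>w\<close>, hence equal, and \<open>w\<close> sees neither \<open>u\<close> nor
        \<open>v\<close>. Then \<open>c2\<close> and \<open>y\<close> have the forbidden three
        common neighbors.\<close>
      have step1: "y \<in> cone x A" if u: "u \<in> cone x A" "E u y" "d x u = Suc k"
        and v: "v \<in> cone x A" "E v y" "d x v = Suc k" and uv: "u \<noteq> v" for u v
      proof (rule ccontr)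
        assume ny: "y \<notin> cone x A"
        then obtain w where w: "E w y" "d x w = Suc k" "w \<notin> cone x A"
          using not_cone_pred[OF x V(1) ny y2] k by auto
        then have ne: "w \<noteq> u" "w \<noteq> v" using u v by auto
        obtain c2 where c2: "c2 \<in> V" "E c2 u" "E c2 w" "d x c2 = k"
          using qc[OF x u(2) w(1) ne(1)[symmetric] u(3) w(2) k] .
        obtain c3 where c3: "c3 \<in> V" "E c3 v" "E c3 w" "d x c3 = k"
          using qc[OF x v(2) w(1) ne(2)[symmetric] v(3) w(2) k] .
        have cc: "c2 \<in> cone x A" "c3 \<in> cone x A"
          using cone_edge_down[OF x u(1) c2(2)] cone_edge_down[OF x v(1) c3(2)] u v c2 c3 by auto
        have wlt: "d x w < d x y" using w k by simp
        have "c2 = c3" using IH[OF wlt cc _ c2(3) c3(3)] w by blast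
        moreover have "\<not> E w u" using IH[OF wlt cc(1) u(1) neq[OF c2(2)] c2(3)] w(3) sym by blast
        moreover have "\<not> E w v" using IH[OF wlt cc(2) v(1) neq[OF c3(2)] c3(3)] w(3) sym by blast
        moreover have "c2 \<noteq> y" "\<not> E c2 y" using c2 k d_step[OF x, of c2 y] by auto
        ultimately show False
          using three_common_neighbors[of c2 u v w y] c2 c3 u v w uv ne sym by blast
      qed
      \<comment> \<open>One below, one level with \<open>y\<close>: the triangle condition seen from
        \<open>v\<close>, for the edge from \<open>c\<close> to \<open>w\<close>, gives a second
        cone neighbor \<open>s\<close> of \<open>w\<close>.\<close>
      have step2: "y \<in> cone x A" if u: "u \<in> cone x A" "E u y" "d x u = Suc k"
        and v: "v \<in> cone x A" "E v y" "d x v = Suc (Suc k)" for u v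
      proof (rule ccontr)
        assume ny: "y \<notin> cone x A"
        obtain t where t: "t \<in> V" "E t v" "E t y" "d x t = Suc k" using tc[OF x v(2,3) k] .
        have "t \<in> cone x A" using cone_edge_down[OF x v(1) t(2)] t v by simp
        then have "t = u" using step1[OF u _ t(3,4)] ny by blast
        obtain w where w: "E w y" "d x w = Suc k" "w \<notin> cone x A"
          using not_cone_pred[OF x V(1) ny y2] k by auto
        then have ne: "w \<noteq> u" using u by auto
        obtain c where c: "c \<in> V" "E c u" "E c w" "d x c = k"
          using qc[OF x u(2) w(1) ne[symmetric] u(3) w(2) k] .
        have "c \<in> cone x A" using cone_edge_down[OF x u(1) c(2)] u c by simp
        have "\<not> E w v" using cone_edge_down[OF x v(1), of w] w v by auto
        moreover have "w \<noteq> v" using w v by auto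
        ultimately have wv: "d v w = 2" using d_2I[OF v(2) sym[OF w(1)]] sym by blast
        have "\<not> E c v" "c \<noteq> v" using c v d_step[OF x, of c v] by auto
        then have "d v c = 2" using d_2I[of v u c] c t \<open>t = u\<close> sym by blast
        then obtain s where s: "s \<in> V" "E s c" "E s w" "d v s = 1"
          using tc[OF _ c(3), of v 1] wv inV[OF v(2)] by (auto simp: numeral_2_eq_2)
        then have sv: "E s v" using d_1[of v s] inV v sym by auto
        have "d x s = Suc k" using d_step[OF x s(2)] d_step[OF x sym[OF s(2)]] d_step[OF x sv] v c by auto
        then have "s \<in> cone x A" "s \<noteq> c" using cone_edge_down[OF x v(1) sv] v c by auto
        then show False using IH[of w s c] \<open>c \<in> cone x A\<close> s c w k by auto
      qed
      \<comment> \<open>A single level neighbor suffices, since its common lower neighbor with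
        \<open>y\<close> is in the cone and leads back to \<open>step2\<close>.\<close>
      have step3: "y \<in> cone x A" if "u \<in> cone x A" "E u y" "d x u = Suc (Suc k)" for u
      proof -
        from tc[OF x that(2,3) k] obtain t where t: "t \<in> V" "E t u" "E t y" "d x t = Suc k" .
        then have "t \<in> cone x A" using cone_edge_down[OF x that(1) t(2)] that by simp
        then show ?thesis using step2[OF _ t(3,4) that] by blast
      qed
      have step4: "y \<in> cone x A" if "u \<in> cone x A" "E u y" "d x u = Suc (Suc (Suc k))" for u
        using cone_edge_down[OF x that(1) sym[OF that(2)]] that k by simp
      show ?thesis
      proof (cases "d x u = Suc k \<and> d x v = Suc k")
        case True
        then show ?thesis using step1[OF u uy _ v vy _ uv] by blast
      next
        case False
        then consider "d x u = Suc (Suc k)" | "d x u = Suc (Suc (Suc k))"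
          | "d x v = Suc (Suc k)" | "d x v = Suc (Suc (Suc k))"
          using lev[OF uy] lev[OF vy] k by linarith
        then show ?thesis using step3[OF u uy] step4[OF u uy] step3[OF v vy] step4[OF v vy] by cases blast+
      qed
    qed
  qed
  then show ?thesis unfolding two_closed_def by blast
qed

lemma cone_gated:
  assumes x: "x \<in> V" and A: "A \<subseteq> {a. E x a}" and union: "\<And>a b. a \<in> A \<Longrightarrow> E x b \<Longrightarrow> E a b \<Longrightarrow> b \<in> A"
  shows "gated V E (cone x A)"
proof (rule two_closed_gated)
  have desc: "\<exists>w\<in>cone x A. E w v \<and> d x w < d x v" if v: "v \<in> cone x A" "v \<noteq> x" for v
  proof -
    have "v \<in> V" using v by (auto simp: cone_def)
    then obtain k where k: "d x v = Suc k" using d_0[OF x, of v] v by (cases "d x v") auto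
    then obtain w where w: "w \<in> V" "E w v" "d x w = k" using d_pred[OF x \<open>v \<in> V\<close>] by blast
    then have "w \<in> cone x A" using cone_edge_down[OF x v(1) w(2)] k by simp
    then show ?thesis using w k by auto
  qed
  show "(\<lambda>p q. E p q \<and> p \<in> cone x A \<and> q \<in> cone x A)\<^sup>*\<^sup>* u v"
    if "u \<in> cone x A" "v \<in> cone x A" for u v
    using descending_reachable[OF desc that] .
qed (use cone_two_closed[OF assms] cone_base[OF x] in \<open>auto simp: cone_def\<close>)

section \<open>Fibers of a gated set\<close>

definition fiber :: "'a set \<Rightarrow> 'a \<Rightarrow> 'a set" where
  "fiber H h = {x \<in> V. g H x = h}"

lemma fiberD: "x \<in> fiber H h \<Longrightarrow> x \<in> V" "x \<in> fiber H h \<Longrightarrow> g H x = h"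
  unfolding fiber_def by auto

lemma fiber_base: "gated V E H \<Longrightarrow> h \<in> H \<Longrightarrow> h \<in> fiber H h"
  using gate_in gated_inV unfolding fiber_def by blast

lemma fiber_Int: "gated V E H \<Longrightarrow> x \<in> H \<Longrightarrow> x \<in> fiber H h \<Longrightarrow> x = h"
  using gate_in fiberD by force

text \<open>\<open>d x (g H y)\<close> exceeds \<open>d x (g H x)\<close> by one and
  \<open>d y (g H y)\<close> by at most one; exchanging \<open>x\<close> and \<open>y\<close> gives
  equality. Thus an edge between fibers is horizontal: its ends have the same height over
  \<open>H\<close>.\<close>

lemma fiber_cross:
  assumes H: "gated V E H" and xy: "E x y" "g H x \<noteq> g H y"
  shows "E (g H x) (g H y)" "d (g H y) y = d (g H x) x" "d (g H x) y = Suc (d (g H x) x)"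
proof -
  note V = inV[OF xy(1)] gate_V[OF H inV(1)[OF xy(1)]] gate_V[OF H inV(2)[OF xy(1)]]
  show e: "E (g H x) (g H y)" using gate_edge[OF H xy] .
  have "d x (g H y) = d x (g H x) + d (g H x) (g H y)" "d y (g H x) = d y (g H y) + d (g H y) (g H x)"
    using gate H V by blast+
  moreover have "d (g H y) x \<le> Suc (d (g H y) y)" "d (g H x) y \<le> Suc (d (g H x) x)"
    using d_step V xy sym by blast+
  moreover have "d x (g H y) = d (g H y) x" "d y (g H x) = d (g H x) y"
    "d x (g H x) = d (g H x) x" "d y (g H y) = d (g H y) y" using d_sym V by blast+
  ultimately show "d (g H y) y = d (g H x) x" "d (g H x) y = Suc (d (g H x) x)"
    using d_edge[OF e] d_edge[OF sym[OF e]] by auto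
qed

lemma fiber_down:
  assumes H: "gated V E H" and x: "x \<in> fiber H h" and w: "E w x" "Suc (d h w) = d h x"
  shows "w \<in> fiber H h"
proof -
  have V: "x \<in> V" "w \<in> V" "h \<in> V" using inV w fiberD[OF x] gate_V[OF H] by blast+
  have "d x w = 1" "d w h = d h w" "d x h = d h x" using d_edge[OF sym[OF w(1)]] d_sym V by auto
  then have "g H w = g H x" using gate_on_geodesic[OF H V(1,2)] fiberD[OF x] w by simp
  then show ?thesis using fiberD[OF x] V unfolding fiber_def by simp
qed

text \<open>The scheme of \<open>cone_two_closed\<close> again, with the height over
  \<open>H\<close> as induction parameter. Since edges between fibers are horizontal, only the case
  with \<open>u\<close> and \<open>v\<close> both below \<open>y\<close>, as seen from
  \<open>h\<close>, occurs.\<close>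

lemma fiber_gated:
  assumes H: "gated V E H" and h: "h \<in> H"
  shows "gated V E (fiber H h)"
proof (rule two_closed_gated)
  have hV: "h \<in> V" using gated_inV H h by blast
  have "y \<in> fiber H h" if "u \<in> fiber H h" "v \<in> fiber H h" "u \<noteq> v" "E u y" "E v y" for y u v
    using that
  proof (induction "d (g H y) y" arbitrary: y u v rule: less_induct)
    case less
    note IH = less(1) and u = less(2) and v = less(3) and uv = less(4) and uy = less(5) and vy = less(6)
    have V: "y \<in> V" "u \<in> V" "v \<in> V" using inV uy vy by blast+
    define h' where "h' = g H y"
    have h'V: "h' \<in> V" "h' \<in> H" using gate_V[OF H V(1)] gate(1)[OF H V(1)] h'_def by simp_all
    show ?case
    proof (rule ccontr)
      assume "y \<notin> fiber H h"
      then have hh': "h' \<noteq> h" using V unfolding fiber_def h'_def by simp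
      have gu: "g H u = h" "g H v = h" using u v fiberD by blast+
      have cu: "E h h'" "d h' y = d h u" "d h y = Suc (d h u)" "d h' y = d h v"
        using fiber_cross[OF H uy] fiber_cross[OF H vy] gu hh' h'_def by auto
      \<comment> \<open>At height 0 both \<open>u\<close> and \<open>v\<close> would be
        \<open>h\<close>. So \<open>y\<close> has a lower neighbor \<open>w\<close> in its own
        fiber; seen from \<open>h\<close>, it is level with \<open>u\<close> and \<open>v\<close>
        and plays the part of the bad predecessor.\<close>
      have "d h u \<noteq> 0" using d_0[OF hV V(2)] d_0[OF hV V(3)] cu uv by auto
      then obtain j where j: "d h u = Suc j" by (cases "d h u") auto
      obtain w where w: "w \<in> V" "E w y" "d h' w = j" using d_pred[OF h'V(1) V(1), of j] cu j by auto
      have wf: "w \<in> fiber H h'" using fiber_down[OF H _ w(2), of h'] w cu j V h'_def unfolding fiber_def by simp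
      then have nwf: "w \<notin> fiber H h" using hh' fiberD by blast
      then have ne: "w \<noteq> u" "w \<noteq> v" using u v by auto
      have "d w h = d w h' + d h' h" using gate(2)[OF H w(1) h] fiberD[OF wf] by simp
      then have dhw: "d h w = Suc j" using d_sym hV h'V w d_edge[OF cu(1)] by simp
      obtain c2 where c2: "c2 \<in> V" "E c2 u" "E c2 w" "d h c2 = j"
        using qc[OF hV uy w(2) ne(1)[symmetric] j dhw] cu j by auto
      obtain c3 where c3: "c3 \<in> V" "E c3 v" "E c3 w" "d h c3 = j"
        using qc[OF hV vy w(2) ne(2)[symmetric] _ dhw] cu j by auto
      have cf: "c2 \<in> fiber H h" "c3 \<in> fiber H h"
        using fiber_down[OF H u c2(2)] fiber_down[OF H v c3(2)] c2 c3 cu j by auto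
      have less: "d (g H w) w < d (g H y) y" using fiberD[OF wf] w cu j h'_def by simp
      have "c2 = c3" using IH[OF less cf _ c2(3) c3(3)] nwf by blast
      moreover have "\<not> E w u" using IH[OF less cf(1) u neq[OF c2(2)] c2(3)] nwf sym by blast
      moreover have "\<not> E w v" using IH[OF less cf(2) v neq[OF c3(2)] c3(3)] nwf sym by blast
      moreover have "c2 \<noteq> y" "\<not> E c2 y" using d_step[OF hV, of c2 y] c2 cu j by auto
      ultimately show False
        using three_common_neighbors[of c2 u v w y] c2 c3 uy vy w uv ne sym by blast
    qed
  qed
  then show "two_closed V E (fiber H h)" unfolding two_closed_def by blast
  have desc: "\<exists>w\<in>fiber H h. E w v \<and> d h w < d h v" if v: "v \<in> fiber H h" "v \<noteq> h" for v
  proof -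
    have "v \<in> V" using v fiberD by blast
    then obtain k where k: "d h v = Suc k" using d_0[OF hV, of v] v by (cases "d h v") auto
    then obtain w where w: "w \<in> V" "E w v" "d h w = k" using d_pred[OF hV \<open>v \<in> V\<close>] by blast
    then have "w \<in> fiber H h" using fiber_down[OF H v(1) w(2)] k by simp
    then show ?thesis using w k by auto
  qed
  show "(\<lambda>p q. E p q \<and> p \<in> fiber H h \<and> q \<in> fiber H h)\<^sup>*\<^sup>* u v"
    if "u \<in> fiber H h" "v \<in> fiber H h" for u v
    using descending_reachable[OF desc that] .
qed (use fiber_base[OF assms] in \<open>auto simp: fiber_def\<close>)

text \<open>Two neighbors in the gated fiber would pull \<open>y\<close> into it. Edges between two
  fibers thus form a partial matching.\<close>

lemma fiber_neighbor_unique: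
  assumes H: "gated V E H" and h: "h \<in> H" "h \<noteq> g H y" and "u \<in> fiber H h" "v \<in> fiber H h" "E y u" "E y v"
  shows "u = v"
proof (rule ccontr)
  assume "u \<noteq> v"
  then have "y \<in> fiber H h"
    using two_closedD[OF gated_two_closed[OF fiber_gated[OF H h(1)]] assms(4,5)] assms(6,7) sym by blast
  then show False using h fiberD by blast
qed

definition boundary :: "'a set \<Rightarrow> 'a \<Rightarrow> 'a \<Rightarrow> 'a set" where
  "boundary H h h' = {y \<in> fiber H h. \<exists>y'\<in>fiber H h'. E y y'}"

text \<open>Let \<open>c'\<close> be a lower neighbor of \<open>y'\<close> in its fiber. Seen from
  \<open>h\<close>, both \<open>y\<close> and \<open>c'\<close> are at level \<open>k + 1\<close>
  and \<open>y'\<close> at level \<open>k + 2\<close>, so the quadrangle condition yields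
  \<open>c\<close>.\<close>

lemma boundary_down:
  assumes H: "gated V E H" and hh: "h \<noteq> h'" and y: "y \<in> fiber H h" "y' \<in> fiber H h'" "E y y'" "d h y = Suc k"
  obtains c c' where "c \<in> fiber H h" "c' \<in> fiber H h'" "E c c'" "E c y" "E c' y'" "d h c = k" "d h' c' = k"
proof -
  have V: "y \<in> V" "y' \<in> V" "h \<in> V" "h' \<in> V" using y fiberD gate_V[OF H] by blast+
  have gy: "g H y = h" "g H y' = h'" using y fiberD by blast+
  have cr: "E h h'" "d h' y' = Suc k" "d h y' = Suc (Suc k)"
    using fiber_cross[OF H y(3)] gy hh y(4) by auto
  obtain c' where c': "c' \<in> V" "E c' y'" "d h' c' = k" using d_pred[OF V(4,2) cr(2)] .
  have cf': "c' \<in> fiber H h'" using fiber_down[OF H y(2) c'(2)] c' cr by simp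
  then have ne: "c' \<noteq> y" using gy hh fiberD by blast
  have "h \<in> H" using gate(1)[OF H V(1)] gy by simp
  then have "d c' h = d c' h' + d h' h" using gate(2)[OF H c'(1)] fiberD[OF cf'] by simp
  then have "d h c' = Suc k" using d_sym V c' d_edge[OF cr(1)] by simp
  then obtain c where c: "c \<in> V" "E c y" "E c c'" "d h c = k"
    using qc[OF V(3) y(3) c'(2) ne[symmetric] y(4) _ cr(3)] by blast
  have "c \<in> fiber H h" using fiber_down[OF H y(1) c(2)] c y by simp
  then show ?thesis using that cf' c c' by blast
qed

lemma boundary_gated:
  assumes H: "gated V E H" and h: "h \<in> H" "h' \<in> H" "E h h'"
  shows "gated V E (boundary H h h')"
proof (rule two_closed_gated)
  note F = fiber_gated[OF H h(1)] and F' = fiber_gated[OF H h(2)]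
  have hV: "h \<in> V" using inV h by blast
  show "two_closed V E (boundary H h h')" unfolding two_closed_def
  proof (intro ballI impI)
    fix s y z assume s: "s \<in> V" and yz: "y \<in> boundary H h h'" "z \<in> boundary H h h'"
      and *: "y \<noteq> z \<and> E y s \<and> E z s"
    from yz have yzf: "y \<in> fiber H h" "z \<in> fiber H h" unfolding boundary_def by auto
    from yz obtain y' z' where y': "y' \<in> fiber H h'" "E y y'" and z': "z' \<in> fiber H h'" "E z z'"
      unfolding boundary_def by blast
    have V: "y \<in> V" "z \<in> V" "y' \<in> V" "z' \<in> V" using y' z' inV by blast+
    have sf: "s \<in> fiber H h" using two_closedD[OF gated_two_closed[OF F] yzf] * by blast
    \<comment> \<open>The matched vertices \<open>y'\<close> and \<open>z'\<close> are distinct and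
      within distance two of \<open>s\<close>. Were the gate \<open>q\<close> at distance two or
      more, \<open>gate_unique\<close> would equate it with both; so \<open>q\<close> is a neighbor
      of \<open>s\<close>.\<close>
    define q where "q = g (fiber H h') s"
    have q: "q \<in> fiber H h'" "q \<in> V" using gate(1)[OF F' s] gate_V[OF F' s] q_def by auto
    have "y' \<noteq> z'" using fiber_neighbor_unique[OF H h(1), of y' y z] y' z' * yzf fiberD neq[OF h(3)] sym by blast
    moreover have "d s y' \<le> 2" "d s z' \<le> 2"
      using d_step[OF s y'(2)] d_step[OF s z'(2)] * d_edge[of s y] d_edge[of s z] sym by auto
    moreover have "q = y'" if "d s y' \<le> d s q" using gate_unique[OF F' s y'(1)] that q_def by simp
    moreover have "q = z'" if "d s z' \<le> d s q" using gate_unique[OF F' s z'(1)] that q_def by simp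
    ultimately have "\<not> 2 \<le> d s q" using le_trans[of "d s y'" 2 "d s q"] le_trans[of "d s z'" 2 "d s q"] by blast
    then have "d s q \<le> 1" by simp
    moreover have "s \<noteq> q" using q sf fiberD neq[OF h(3)] by blast
    ultimately have "E s q" using d_0[OF s q(2)] d_1[OF s q(2)] by (cases "d s q") auto
    then show "s \<in> boundary H h h'" using sf q unfolding boundary_def by blast
  qed
  show "(\<lambda>p q. E p q \<and> p \<in> boundary H h h' \<and> q \<in> boundary H h h')\<^sup>*\<^sup>* u v"
    if "u \<in> boundary H h h'" "v \<in> boundary H h h'" for u v
  proof (rule descending_reachable[OF _ that, of h])
    fix v assume v: "v \<in> boundary H h h'" "v \<noteq> h"
    then obtain v' where v': "v \<in> fiber H h" "v' \<in> fiber H h'" "E v v'" unfolding boundary_def by blast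
    then have "v \<in> V" using inV by blast
    then obtain k where "d h v = Suc k" using d_0[OF hV, of v] v by (cases "d h v") auto
    then obtain c c' where "c \<in> fiber H h" "c' \<in> fiber H h'" "E c c'" "E c v" "d h c = k"
      using boundary_down[OF H neq[OF h(3)] v'] by metis
    then show "\<exists>w\<in>boundary H h h'. E w v \<and> d h w < d h v"
      using \<open>d h v = Suc k\<close> unfolding boundary_def by auto
  qed
qed (use fiber_base[OF H] h fiberD in \<open>auto simp: boundary_def\<close>)

lemma fiber_triangle:
  assumes H: "gated V E H" and h: "h \<in> H" "h' \<in> H" "h'' \<in> H" "E h h'" "E h h''" "E h' h''"
    and y: "y \<in> fiber H h" "y' \<in> fiber H h'" "E y y'"
  obtains t where "t \<in> fiber H h''" "E t y" "E t y'"
proof -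
  have hV: "h \<in> V" using inV h by blast
  have "\<exists>t\<in>fiber H h''. E t y \<and> E t y'" using y
  proof (induction "d h y" arbitrary: y y')
    case 0
    then have "y = h" using d_0[OF hV] fiberD by metis
    have "g H y = h" "g H y' = h'" using 0 fiberD by blast+
    then have "d h' y' = 0" using fiber_cross(2)[OF H 0(4)] neq[OF h(4)] 0(1) by simp
    then have "y' = h'" using d_0 inV h 0 fiberD by metis
    then show ?case using \<open>y = h\<close> h fiber_base[OF H] sym by blast
  next
    case (Suc k)
    have gy: "g H y = h" "g H y' = h'" using Suc fiberD by blast+
    have dy': "d h' y' = Suc k" using fiber_cross(2)[OF H Suc(5)] gy neq[OF h(4)] Suc(2) by simp
    obtain c c' where c: "c \<in> fiber H h" "c' \<in> fiber H h'" "E c c'" "E c y" "E c' y'" "d h c = k" "d h' c' = k"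
      using boundary_down[OF H neq[OF h(4)] Suc(3-5) Suc(2)[symmetric]] .
    obtain t where t: "t \<in> fiber H h''" "E t c" "E t c'" using Suc(1)[of c c'] c by metis
    have gt: "g H t = h''" using t fiberD by blast
    have gc: "g H c = h" using c fiberD by blast
    have lev_t: "d h'' t = k" using fiber_cross(2)[OF H sym[OF t(2)]] gt gc neq[OF h(5)] c by simp
    have nt: "\<not> E t y" "t \<noteq> y" "\<not> E t y'" "t \<noteq> y'"
      using fiber_cross(2)[OF H, of t y] fiber_cross(2)[OF H, of t y'] gt gy neq[OF h(5)] neq[OF h(6)] lev_t Suc(2) dy'
      by auto
    then have d2: "d t y = 2" "d t y' = 2" using d_2I t c by blast+
    have tV: "t \<in> V" using t inV by blast
    \<comment> \<open>The triangle condition seen from \<open>t\<close>. Uniqueness in the matchings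
      keeps \<open>s\<close> out of the fibers of \<open>h\<close> and \<open>h'\<close>, so
      \<open>s\<close> has height \<open>k + 1\<close>. As \<open>t\<close> has height
      \<open>k\<close>, the edge from \<open>t\<close> to \<open>s\<close> is not horizontal, hence
      stays in the fiber of \<open>h''\<close>.\<close>
    obtain s where s: "s \<in> V" "E s y" "E s y'" "d t s = 1"
      using tc[OF tV Suc(5), of 1] d2 by (auto simp: numeral_2_eq_2)
    then have ts: "E t s" using d_1[OF tV, of s] by simp
    have n1: "g H s \<noteq> h"
    proof
      assume "g H s = h"
      then have "s \<in> fiber H h" "h \<noteq> g H y'" using s gy neq[OF h(4)] unfolding fiber_def by auto
      then show False
        using fiber_neighbor_unique[OF H h(1) _ _ Suc(3)] s(3) Suc(5) neq[OF s(2)] sym by blast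
    qed
    have n2: "g H s \<noteq> h'"
    proof
      assume "g H s = h'"
      then have "s \<in> fiber H h'" "h' \<noteq> g H y" using s gy neq[OF h(4)] unfolding fiber_def by auto
      then show False
        using fiber_neighbor_unique[OF H h(2) _ _ Suc(4)] s(2) Suc(5) neq[OF s(3)] sym by blast
    qed
    have "d (g H s) s = Suc k" using fiber_cross(2)[OF H s(2)] n1 gy Suc(2) by simp
    then have "g H s = h''" using fiber_cross(2)[OF H ts] gt lev_t by fastforce
    then show ?case using s unfolding fiber_def by blast
  qed
  then show ?thesis using that by blast
qed

end

section \<open>Prime graphs have connected links\<close>

context cgraph
begin

lemma gated_graph:
  assumes "gated V E A"
  shows "graph A (\<lambda>x y. E x y \<and> x \<in> A \<and> y \<in> A)"
proof -
  have "connected_graph A (\<lambda>x y. E x y \<and> x \<in> A \<and> y \<in> A)"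
    by (rule connected_graphI) (use gated_reachable[OF assms] assms in \<open>auto simp: gated_def\<close>)
  then show ?thesis using sym irrefl unfolding graph_def by blast
qed

end

section \<open>Gated hulls\<close>

context wmgraph
begin

text \<open>All members are convex, so a geodesic between two vertices of the intersection stays in
  every one of them, even for an infinite family.\<close>

lemma gated_Inter:
  assumes K: "\<And>A. A \<in> K \<Longrightarrow> gated V E A" "K \<noteq> {}" "\<Inter>K \<noteq> {}"
  shows "gated V E (\<Inter>K)"
proof (rule two_closed_gated)
  show "\<Inter>K \<subseteq> V" using K gated_subset by blast
  show "two_closed V E (\<Inter>K)"
    using K(1) gated_two_closed unfolding two_closed_def by blast
  fix x y assume x: "x \<in> \<Inter>K" and y: "y \<in> \<Inter>K"
  have xV: "x \<in> V" using K x gated_subset by blast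
  have desc: "\<exists>w\<in>\<Inter>K. E w v \<and> d x w < d x v" if v: "v \<in> \<Inter>K" "v \<noteq> x" for v
  proof -
    have vV: "v \<in> V" using K v gated_subset by blast
    then obtain k where k: "d x v = Suc k" using d_0[OF xV, of v] v by (cases "d x v") auto
    then obtain w where w: "w \<in> V" "E w v" "d x w = k" using d_pred[OF xV vV] by blast
    have "w \<in> A" if "A \<in> K" for A
      using gated_convex[OF K(1)[OF that], of x v w] x v w k that d_edge[OF w(2)] by auto
    then show ?thesis using w k by auto
  qed
  show "(\<lambda>x y. E x y \<and> x \<in> \<Inter>K \<and> y \<in> \<Inter>K)\<^sup>*\<^sup>* x y"
    using descending_reachable[OF desc x y] .
qed (use assms in auto)

definition hull :: "'a set \<Rightarrow> 'a set" where
  "hull A = \<Inter>{K. gated V E K \<and> A \<subseteq> K}"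

lemma V_gated: "gated V E V"
proof -
  have "x \<in> interval V E x y" if "x \<in> V" for x y using that by (simp add: interval_def)
  moreover have "V \<noteq> {}" using conn unfolding connected_graph_def by blast
  ultimately show ?thesis unfolding gated_def by blast
qed

lemma hull_gated: assumes "A \<subseteq> V" "A \<noteq> {}" shows "gated V E (hull A)"
  unfolding hull_def by (rule gated_Inter) (use assms V_gated in auto)

lemma hull_subset: "A \<subseteq> hull A"
  unfolding hull_def by blast

lemma hull_least: "gated V E K \<Longrightarrow> A \<subseteq> K \<Longrightarrow> hull A \<subseteq> K"
  unfolding hull_def by blast

end

context premedian
begin

text \<open>The path may use the whole link of \<open>h\<close>; for gated \<open>H\<close> it stays
  in \<open>H\<close> anyway, being a chain of triangles over \<open>h\<close> that starts in
  \<open>H\<close>.\<close>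

definition link_connected_in :: "'a set \<Rightarrow> bool" where
  "link_connected_in H \<longleftrightarrow> (\<forall>h\<in>H. \<forall>p\<in>H. \<forall>q\<in>H. E h p \<and> E h q \<longrightarrow> link_conn E h p q)"

lemma boundary_triangle:
  assumes H: "gated V E H" and h: "h \<in> H" "p \<in> H" "q \<in> H" "E h p" "E h q" "E p q"
  shows "boundary H h p \<subseteq> boundary H h q"
proof
  fix y assume "y \<in> boundary H h p"
  then obtain y' where y: "y \<in> fiber H h" "y' \<in> fiber H p" "E y y'" unfolding boundary_def by blast
  obtain t where "t \<in> fiber H q" "E t y" "E t y'" using fiber_triangle[OF H h y] .
  then show "y \<in> boundary H h q" using y sym unfolding boundary_def by blast
qed

lemma boundary_link:
  assumes H: "gated V E H" and h: "h \<in> H" "p \<in> H" and "link_conn E h p q"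
  shows "q = p \<or> q \<in> H \<and> E h q \<and> boundary H h p \<subseteq> boundary H h q"
  using assms(4) unfolding link_conn_def
proof (induction rule: rtranclp_induct)
  case (step r s)
  then have r: "r \<in> H" "E h r" "boundary H h p \<subseteq> boundary H h r" using h by blast+
  have "s \<in> H" using two_closedD[OF gated_two_closed[OF H] h(1) r(1) neq] step by blast
  then show ?case using boundary_triangle[OF H h(1) r(1) _ r(2)] r step by blast
qed simp

lemma link_connected_in_boundary:
  assumes H: "gated V E H" and L: "link_connected_in H" and h: "h \<in> H" "p \<in> H" "q \<in> H" "E h p" "E h q"
  shows "boundary H h p \<subseteq> boundary H h q"
  using boundary_link[OF H h(1,2)] L h unfolding link_connected_in_def by blast

text \<open>Otherwise \<open>G\<close> would be the gated amalgam of the fiber of \<open>h\<close> and of the union of the other fibers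
  and the boundary, glued along the boundary.\<close>

lemma fiber_eq_boundary:
  assumes H: "gated V E H" and L: "link_connected_in H" and h: "h \<in> H" "p \<in> H" "E h p"
    and na: "\<not> is_gated_amalgam V E"
  shows "fiber H h = boundary H h p"
proof -
  define U where "U = boundary H h p"
  define B where "B = (V - fiber H h) \<union> U"
  note F = fiber_gated[OF H h(1)] and Ug = boundary_gated[OF H h]
  have UF: "U \<subseteq> fiber H h" unfolding U_def boundary_def by blast
  have FV: "fiber H h \<subseteq> V" unfolding fiber_def by blast
  have BV: "B \<subseteq> V" using UF FV unfolding B_def by blast
  have pB: "p \<in> fiber H p" "p \<notin> fiber H h" "p \<in> V"
    using fiber_base[OF H h(2)] neq[OF h(3)] inV h fiberD by blast+
  have hU: "h \<in> U" using fiber_base[OF H] h unfolding U_def boundary_def by blast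
  \<comment> \<open>Link connectivity makes the boundaries of the fiber towards all neighbors of
    \<open>h\<close> in \<open>H\<close> equal, so \<open>U\<close> contains every vertex of the
    fiber with an edge to the outside.\<close>
  have out: "x \<in> U" if "x \<in> fiber H h" "E x y" "y \<in> V - fiber H h" for x y
  proof -
    have gx: "g H x = h" and gy: "g H y \<noteq> h" using that fiberD unfolding fiber_def by blast+
    have "E h (g H y)" using fiber_cross(1)[OF H that(2)] gx gy by simp
    moreover have "g H y \<in> H" using gate(1)[OF H] that by blast
    moreover have "x \<in> boundary H h (g H y)" using that unfolding boundary_def fiber_def by blast
    ultimately show ?thesis using link_connected_in_boundary[OF H L h(1) _ h(2) _ h(3)] unfolding U_def by blast
  qed
  have clB: "two_closed V E B" unfolding two_closed_def
  proof (intro ballI impI)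
    fix y u v assume *: "y \<in> V" "u \<in> B" "v \<in> B" "u \<noteq> v \<and> E u y \<and> E v y"
    show "y \<in> B"
    proof (cases "y \<in> fiber H h \<and> u \<in> U \<and> v \<in> U")
      case True
      then show ?thesis using two_closedD[OF gated_two_closed[OF Ug]] * unfolding B_def U_def by blast
    next
      case False
      then show ?thesis using * out[of y u] out[of y v] sym unfolding B_def by blast
    qed
  qed
  let ?R = "\<lambda>p q. E p q \<and> p \<in> B \<and> q \<in> B"
  have mono: "?R\<^sup>*\<^sup>* x y" if "(\<lambda>p q. E p q \<and> p \<in> K \<and> q \<in> K)\<^sup>*\<^sup>* x y" "K \<subseteq> B" for x y K
  proof -
    have "(\<lambda>p q. E p q \<and> p \<in> K \<and> q \<in> K) \<le> ?R" using that(2) by blast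
    then show ?thesis using that(1) rtranclp_mono by blast
  qed
  have reach: "?R\<^sup>*\<^sup>* x h" if "x \<in> B" for x
  proof (cases "x \<in> fiber H h")
    case True
    then have "x \<in> U" using that unfolding B_def by blast
    then show ?thesis using gated_reachable[OF Ug, of x h] hU mono[of U] unfolding U_def B_def by blast
  next
    case False
    define q where "q = g H x"
    have q: "x \<in> fiber H q" "q \<in> H" "q \<noteq> h" using False that BV gate(1)[OF H] unfolding q_def fiber_def by auto
    have "fiber H q \<subseteq> B" using q fiberD unfolding B_def fiber_def by blast
    then have "?R\<^sup>*\<^sup>* x q"
      using gated_reachable[OF fiber_gated[OF H q(2)] q(1) fiber_base[OF H q(2)]] mono by blast
    moreover have "H \<subseteq> B" using hU fiber_Int[OF H, of _ h] gated_subset[OF H] unfolding B_def by blast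
    then have "?R\<^sup>*\<^sup>* q h" using gated_reachable[OF H q(2) h(1)] mono by blast
    ultimately show ?thesis by (rule rtranclp_trans)
  qed
  have "symp ?R" using sym by (auto intro: sympI)
  then have sR: "symp ?R\<^sup>*\<^sup>*" by (rule symp_rtranclp)
  have Bg: "gated V E B"
  proof (rule two_closed_gated[OF BV _ clB])
    fix x y assume "x \<in> B" "y \<in> B"
    then show "?R\<^sup>*\<^sup>* x y" using rtranclp_trans[OF reach sympD[OF sR reach]] by blast
  qed (use hU B_def in auto)
  have "B = V"
  proof (rule ccontr)
    assume BneV: "B \<noteq> V"
    have "is_gated_amalgam V E" unfolding is_gated_amalgam_def
    proof (rule exI[of _ "fiber H h"], rule exI[of _ B], intro conjI F Bg)
      show "fiber H h \<inter> B \<noteq> {}" using hU UF unfolding B_def by blast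
      show "\<forall>x y. E x y \<longrightarrow> x \<in> fiber H h \<and> y \<in> fiber H h \<or> x \<in> B \<and> y \<in> B"
        using out inV sym unfolding B_def by blast
      show "fiber H h \<noteq> V" "B \<noteq> V" "fiber H h \<union> B = V" using pB FV BV BneV unfolding B_def by blast+
    qed
    then show False using na by blast
  qed
  then show ?thesis using UF FV unfolding B_def U_def by blast
qed

text \<open>\<open>full\<close> makes the matchings between adjacent fibers perfect. Geodesics of
  \<open>H\<close> then lift from any vertex, so the distance from \<open>x\<close> to a fiber
  depends only on the gate of \<open>x\<close>. The coordinates are the gate in \<open>H\<close> and
  the gate \<open>pr\<close> in one fixed fiber.\<close>

lemma product_or_whole:
  assumes H: "gated V E H" and nt: "nontrivial_set H"
    and full: "\<And>h p y. h \<in> H \<Longrightarrow> p \<in> H \<Longrightarrow> E h p \<Longrightarrow> y \<in> fiber H h \<Longrightarrow> \<exists>y'\<in>fiber H p. E y y'"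
    and HV: "H \<noteq> V"
  shows "is_cartesian_product V E"
proof -
  have dist: "d x (g (fiber H k) x) = d k (g H x)" if "k \<in> H" "x \<in> V" for k x
    using that(2)
  proof (induction "d k (g H x)" arbitrary: x rule: less_induct)
    case less
    note F = fiber_gated[OF H that(1)]
    have xV: "x \<in> V" and kV: "k \<in> V" and hV: "g H x \<in> V" and h: "g H x \<in> H"
      using less gated_inV[OF H that(1)] gate_V[OF H] gate(1)[OF H] by auto
    define z where "z = g (fiber H k) x"
    have z: "z \<in> fiber H k" "z \<in> V" using gate(1)[OF F xV] gate_V[OF F xV] z_def by auto
    have "d (g H x) (g H z) \<le> d x z" using gate_nonexpansive[OF H xV z(2)] .
    then have ge: "d k (g H x) \<le> d x z" using fiberD[OF z(1)] d_sym[OF hV kV] by simp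
    have "d x z \<le> d k (g H x)"
    proof (cases "d k (g H x)")
      case 0
      then have "x \<in> fiber H k" using d_0[OF kV hV] xV unfolding fiber_def by simp
      then show ?thesis using gate_in[OF F] z_def xV by simp
    next
      case (Suc j)
      obtain q where q: "q \<in> V" "E q (g H x)" "d k q = j" using d_pred[OF kV hV Suc] .
      have qH: "q \<in> H" using gated_convex[OF H that(1) h q(1)] q Suc d_edge[OF q(2)] by simp
      obtain x' where x': "x' \<in> fiber H q" "E x x'"
        using full[OF h qH sym[OF q(2)], of x] xV unfolding fiber_def by blast
      have x'V: "x' \<in> V" "g H x' = q" using fiberD[OF x'(1)] by auto
      have "d x' (g (fiber H k) x') = j" using less(1)[of x'] x'V q Suc by simp
      moreover have "d x z \<le> d x (g (fiber H k) x')" using gate_le[OF F xV gate(1)[OF F x'V(1)]] z_def by simp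
      moreover have "d x (g (fiber H k) x') \<le> d x x' + d x' (g (fiber H k) x')"
        using d_triangle[OF xV x'V(1) gate_V[OF F x'V(1)]] .
      ultimately show ?thesis using d_edge[OF x'(2)] Suc by simp
    qed
    then show ?case using ge z_def by simp
  qed
  \<comment> \<open>The base fiber is taken through a vertex outside \<open>H\<close>, which makes
    the second factor nontrivial.\<close>
  obtain y0 where y0: "y0 \<in> V" "y0 \<notin> H" using HV gated_subset[OF H] by blast
  define h0 where "h0 = g H y0"
  define F0 where "F0 = fiber H h0"
  have h0: "h0 \<in> H" "h0 \<in> V" using gate(1)[OF H y0(1)] gate_V[OF H y0(1)] h0_def by auto
  have F0: "gated V E F0" using fiber_gated[OF H h0(1)] F0_def by simp
  have ntF: "nontrivial_set F0"
  proof -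
    have "h0 \<in> F0" "y0 \<in> F0" "h0 \<noteq> y0"
      using fiber_base[OF H h0(1)] y0 h0 unfolding F0_def fiber_def by (auto simp: h0_def)
    then show ?thesis unfolding nontrivial_set_def by blast
  qed
  define pr where "pr = g F0"
  have prV: "pr x \<in> F0" "pr x \<in> V" "g H (pr x) = h0" if "x \<in> V" for x
    using gate(1)[OF F0 that] gate_V[OF F0 that] fiberD(2)[of "pr x" H h0] unfolding pr_def F0_def by auto
  have dpr: "d x (pr x) = d h0 (g H x)" if "x \<in> V" for x
    using dist[OF h0(1) that] unfolding pr_def F0_def .
  \<comment> \<open>Walking from \<open>y\<close> over \<open>x\<close> to \<open>pr x\<close> costs
    exactly the distance from \<open>y\<close> to the base fiber, so \<open>pr x\<close> is the gate
    of \<open>y\<close>.\<close>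
  have same1: "pr y = pr x" if "E x y" "d h0 (g H y) = Suc (d h0 (g H x))" for x y
  proof -
    have V: "x \<in> V" "y \<in> V" using inV that by auto
    have "d y (pr x) \<le> d y x + d x (pr x)" using d_triangle V prV by blast
    then have "d y (pr x) \<le> d y (pr y)" using dpr V that d_edge[OF sym[OF that(1)]] by simp
    then show ?thesis using gate_unique[OF F0 V(2) prV(1)[OF V(1)]] unfolding pr_def by blast
  qed
  have same: "pr x = pr y" if xy: "E x y" "g H x \<noteq> g H y" for x y
  proof -
    have V: "x \<in> V" "y \<in> V" "g H x \<in> V" "g H y \<in> V" "g H x \<in> H" "g H y \<in> H"
      using inV[OF xy(1)] gate_V[OF H] gate(1)[OF H] by auto
    have e: "E (g H x) (g H y)" using fiber_cross(1)[OF H xy] .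
    have "d h0 (g H y) \<le> Suc (d h0 (g H x))" "d h0 (g H x) \<le> Suc (d h0 (g H y))"
      using d_step[OF h0(2)] e sym by blast+
    then consider "d h0 (g H y) = Suc (d h0 (g H x))" | "d h0 (g H x) = Suc (d h0 (g H y))"
      | "d h0 (g H x) = d h0 (g H y)" by linarith
    then show ?thesis
    proof cases
      case 1 then show ?thesis using same1[OF xy(1)] by simp
    next
      case 2 then show ?thesis using same1[OF sym[OF xy(1)]] by simp
    next
      case 3
      \<comment> \<open>Gates level with respect to \<open>h0\<close>: the triangle condition gives
        a lower \<open>q\<close> in \<open>H\<close>, and the lifted triangle replaces the edge by
        two edges of the previous kind.\<close>
      have "d h0 (g H x) \<noteq> 0" using d_0[OF h0(2) V(3)] d_0[OF h0(2) V(4)] 3 xy by auto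
      then obtain k where k: "d h0 (g H x) = Suc k" by (cases "d h0 (g H x)") auto
      obtain q where q: "q \<in> V" "E q (g H x)" "E q (g H y)" "d h0 q = k"
        using tc[OF h0(2) e k] 3 k by auto
      have qH: "q \<in> H" using two_closedD[OF gated_two_closed[OF H] V(5,6) xy(2)] q sym by blast
      obtain t where t: "t \<in> fiber H q" "E t x" "E t y"
        using fiber_triangle[OF H V(5,6) qH e sym[OF q(2)] sym[OF q(3)], of x y] V xy unfolding fiber_def by blast
      have "g H t = q" using fiberD(2)[OF t(1)] .
      then have "pr x = pr t" "pr y = pr t"
        using same1[OF t(2)] same1[OF t(3)] 3 k q by simp_all
      then show ?thesis by simp
    qed
  qed
  \<comment> \<open>Both projections realize the distance from \<open>h\<close> to
    \<open>h0\<close>, so by \<open>gate_unique\<close> each undoes the other.\<close>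
  have inv1: "g (fiber H h) (pr x) = x" if "h \<in> H" "x \<in> fiber H h" for h x
  proof -
    have x: "x \<in> V" "g H x = h" "h \<in> V" using fiberD[OF that(2)] gated_inV[OF H that(1)] by auto
    have "d (pr x) x = d (pr x) (g (fiber H h) (pr x))"
      using dist[OF that(1) prV(2)[OF x(1)]] dpr[OF x(1)] x prV[OF x(1)] h0 d_sym by metis
    then show ?thesis using gate_unique[OF fiber_gated[OF H that(1)] prV(2)[OF x(1)] that(2)] by simp
  qed
  have inv2: "pr (g (fiber H h) y) = y" if "h \<in> H" "y \<in> F0" for h y
  proof -
    define x where "x = g (fiber H h) y"
    note Fh = fiber_gated[OF H that(1)]
    have y: "y \<in> V" "g H y = h0" "h \<in> V" using fiberD[of y H h0] that gated_inV[OF H that(1)] F0_def by auto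
    have x: "x \<in> V" "g H x = h" using gate_V[OF Fh y(1)] gate(1)[OF Fh y(1)] fiberD x_def by blast+
    have "d x y = d x (pr x)"
      using dist[OF that(1) y(1)] dpr[OF x(1)] x y h0 d_sym x_def by metis
    then show ?thesis using gate_unique[OF F0 x(1) that(2)] unfolding pr_def x_def by simp
  qed
  define f where "f x = (g H x, pr x)" for x
  have inj: "x = y" if "x \<in> V" "y \<in> V" "g H x = g H y" "pr x = pr y" for x y
  proof -
    have "x \<in> fiber H (g H x)" "y \<in> fiber H (g H x)" using that unfolding fiber_def by auto
    then show ?thesis using inv1[OF gate(1)[OF H that(1)]] that(4) by metis
  qed
  have bij: "bij_betw f V (H \<times> F0)"
  proof (rule bij_betwI')
    fix x y assume "x \<in> V" "y \<in> V" then show "(f x = f y) = (x = y)" using inj[of x y] unfolding f_def by auto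
  next
    fix x assume "x \<in> V" then show "f x \<in> H \<times> F0" using gate(1)[OF H] prV unfolding f_def by auto
  next
    fix z assume z: "z \<in> H \<times> F0"
    obtain h y where hy: "z = (h, y)" "h \<in> H" "y \<in> F0" using z by blast
    then have yV: "y \<in> V" using gated_inV[OF F0] by blast
    have "f (g (fiber H h) y) = z" "g (fiber H h) y \<in> V"
      using inv2[OF hy(2,3)] gate(1)[OF fiber_gated[OF H hy(2)] yV] hy fiberD unfolding f_def by auto
    then show "\<exists>x\<in>V. z = f x" by blast
  qed
  define E1 where "E1 = (\<lambda>x y. E x y \<and> x \<in> H \<and> y \<in> H)"
  define E2 where "E2 = (\<lambda>x y. E x y \<and> x \<in> F0 \<and> y \<in> F0)"
  have adj: "E x y \<longleftrightarrow> cprod_adj E1 E2 (f x) (f y)" if xy: "x \<in> V" "y \<in> V" for x y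
  proof
    assume e: "E x y"
    show "cprod_adj E1 E2 (f x) (f y)"
    proof (cases "g H x = g H y")
      case True
      then have "pr x \<noteq> pr y" using inj[OF xy True] neq[OF e] by blast
      then have "E (pr x) (pr y)" using gate_edge[OF F0 e] unfolding pr_def by blast
      then show ?thesis using True prV xy unfolding cprod_adj_def f_def E2_def by simp
    next
      case False
      then show ?thesis using same[OF e False] fiber_cross(1)[OF H e False] gate(1)[OF H] xy
        unfolding cprod_adj_def f_def E1_def by simp
    qed
  next
    assume c: "cprod_adj E1 E2 (f x) (f y)"
    then consider "g H x = g H y" "E (pr x) (pr y)" | "pr x = pr y" "E (g H x) (g H y)"
      unfolding cprod_adj_def f_def E1_def E2_def by auto
    then show "E x y"
    proof cases
      case 1
      have h: "g H x \<in> H" using gate(1)[OF H xy(1)] .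
      have "g (fiber H (g H x)) (pr x) = x" "g (fiber H (g H x)) (pr y) = y"
        using inv1[OF h, of x] inv1[OF h, of y] xy 1 unfolding fiber_def by auto
      moreover have "x \<noteq> y" using neq[OF 1(2)] by auto
      ultimately show ?thesis using gate_edge[OF fiber_gated[OF H h] 1(2)] by simp
    next
      case 2
      obtain x' where x': "x' \<in> fiber H (g H y)" "E x x'"
        using full[OF gate(1)[OF H xy(1)] gate(1)[OF H xy(2)] 2(2), of x] xy unfolding fiber_def by blast
      then have "x' \<in> V" "g H x' = g H y" using fiberD by blast+
      moreover from this have "pr x' = pr y" using same[OF x'(2)] 2 neq[OF 2(2)] by simp
      ultimately show ?thesis using inj[of x' y] xy x' by simp
    qed
  qed
  have "graph H E1" "graph F0 E2" unfolding E1_def E2_def using gated_graph H F0 by blast+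
  then show ?thesis unfolding is_cartesian_product_def using nt ntF bij adj by blast
qed

lemma prime_link_connected_whole:
  assumes H: "gated V E H" "nontrivial_set H" "link_connected_in H" and "prime_graph V E"
  shows "H = V"
proof (rule ccontr)
  assume "H \<noteq> V"
  have "\<exists>y'\<in>fiber H p. E y y'" if "h \<in> H" "p \<in> H" "E h p" "y \<in> fiber H h" for h p y
    using fiber_eq_boundary[OF H(1,3) that(1-3)] assms(4) that(4) unfolding prime_graph_def boundary_def by blast
  then show False using product_or_whole[OF H(1,2) _ \<open>H \<noteq> V\<close>] assms(4) unfolding prime_graph_def by blast
qed

definition link_class :: "'a \<Rightarrow> 'a \<Rightarrow> 'a set" where
  "link_class x a = {p. E x p \<and> link_conn E x a p}"

lemma link_class_cone:
  assumes "E x a"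
  shows "gated V E (cone x (link_class x a))"
proof (rule cone_gated)
  show "x \<in> V" using inV assms by blast
  fix p b assume "p \<in> link_class x a" "E x b" "E p b"
  then show "b \<in> link_class x a"
    unfolding link_class_def link_conn_def by (auto intro: rtranclp.rtrancl_into_rtrancl)
qed (auto simp: link_class_def)

text \<open>The cone over the link component of \<open>a\<close> is gated and contains the edge,
  hence the hull; so neighbors of \<open>x\<close> in the hull lie in that component. Along a link
  path each triangle puts the next edge into the hull of the previous one and conversely, so the
  hull does not change.\<close>

lemma hull_edge_link:
  assumes "E x a" "E x p" "p \<in> hull {x, a}"
  shows "link_conn E x a p" "hull {x, p} = hull {x, a}"
proof -
  have xV: "x \<in> V" "a \<in> V" using inV assms by blast+
  have "a \<in> link_class x a" using assms unfolding link_class_def link_conn_def by simp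
  then have "{x, a} \<subseteq> cone x (link_class x a)"
    using cone_base[OF xV(1)] cone_neighbor[OF assms(1)] by simp
  then have "hull {x, a} \<subseteq> cone x (link_class x a)"
    by (rule hull_least[OF link_class_cone[OF assms(1)]])
  then have "p \<in> link_class x a" using assms(3) cone_neighbor[OF assms(2)] by blast
  then show lc: "link_conn E x a p" unfolding link_class_def by simp
  have "E x p \<and> hull {x, p} = hull {x, a}"
    using lc unfolding link_conn_def
  proof (induction rule: rtranclp_induct)
    case (step r s)
    have V: "r \<in> V" "s \<in> V" using inV step by blast+
    have sub: "hull {x, s} \<subseteq> hull {x, r}" if "E x r" "E x s" "E r s" for r s
    proof -
      have g: "gated V E (hull {x, r})" using hull_gated[of "{x, r}"] inV that by blast
      have xr: "x \<in> hull {x, r}" "r \<in> hull {x, r}" using hull_subset by blast+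
      then have "s \<in> hull {x, r}" using two_closedD[OF gated_two_closed[OF g] _ _ neq[OF that(1)] that(2,3)] by blast
      then have "{x, s} \<subseteq> hull {x, r}" using xr by simp
      then show ?thesis by (rule hull_least[OF g])
    qed
    show ?case using sub[of r s] sub[of s r] step sym by blast
  qed (use assms in simp)
  then show "hull {x, p} = hull {x, a}" by blast
qed

text \<open>Every vertex of \<open>H\<close> has an edge with hull \<open>H\<close>: this passes
  along a path of \<open>H\<close>, since by \<open>hull_edge_link\<close> all edges of
  \<open>H\<close> at one vertex have the same hull. The cone argument then applies at each
  vertex.\<close>

lemma hull_edge_link_connected:
  assumes "E x a" shows "link_connected_in (hull {x, a})"
proof -
  define H where "H = hull {x, a}"
  have Hg: "gated V E H" using hull_gated[of "{x, a}"] inV assms H_def by blast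
  have xa: "x \<in> H" "a \<in> H" using hull_subset H_def by blast+
  have key: "\<exists>p. E h p \<and> hull {h, p} = H" if "h \<in> H" for h
    using gated_reachable[OF Hg xa(1) that]
  proof (induction rule: rtranclp_induct)
    case (step y z)
    then obtain p where p: "E y p" "hull {y, p} = H" by blast
    have "hull {y, z} = H" using hull_edge_link(2)[OF p(1), of z] p step by blast
    then show ?case using step sym by (metis insert_commute)
  qed (use assms H_def in blast)
  show ?thesis unfolding link_connected_in_def H_def[symmetric]
  proof (intro ballI impI)
    fix h p q assume h: "h \<in> H" "p \<in> H" "q \<in> H" "E h p \<and> E h q"
    obtain b where b: "E h b" "hull {h, b} = H" using key[OF h(1)] by blast
    have "hull {h, p} = H" using hull_edge_link(2)[OF b(1), of p] b h by blast
    then show "link_conn E h p q" using hull_edge_link(1)[of h p q] h by blast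
  qed
qed

lemma prime_link_connected:
  assumes "prime_graph V E" "E x p" "E x q"
  shows "link_conn E x p q"
proof -
  have "gated V E (hull {x, p})" "nontrivial_set (hull {x, p})"
    using hull_gated[of "{x, p}"] inV assms neq[OF assms(2)] hull_subset[of "{x, p}"]
    unfolding nontrivial_set_def by blast+
  then have "hull {x, p} = V"
    using prime_link_connected_whole hull_edge_link_connected assms by blast
  then show ?thesis using hull_edge_link(1)[OF assms(2,3)] inV assms by blast
qed

end

section \<open>Cut vertices and squares\<close>

context cgraph
begin

text \<open>A path entering \<open>S\<close> from outside must enter at \<open>z\<close>, so
  \<open>z\<close> is the gate of all outer vertices.\<close>

lemma gated_of_cut_vertex:
  assumes S: "S \<subseteq> V" "z \<in> S" and cut: "\<And>s t. s \<in> S \<Longrightarrow> t \<notin> S \<Longrightarrow> E s t \<Longrightarrow> s = z"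
  shows "gated V E S"
proof -
  have zV: "z \<in> V" using S by blast
  have le: "d x z + d z y \<le> d x y" if "x \<in> V" "x \<notin> S" "y \<in> S" for x y
    using that(3)
  proof (induction "d x y" arbitrary: y)
    case 0
    then show ?case using d_0[of x y] that S by auto
  next
    case (Suc n)
    have yV: "y \<in> V" using Suc S by blast
    from d_pred[OF that(1) yV Suc(2)[symmetric]] obtain w where w: "w \<in> V" "E w y" "d x w = n" .
    show ?case
    proof (cases "w \<in> S")
      case True
      then show ?thesis using Suc w d_step[OF zV w(2)] by force
    next
      case False
      then have "y = z" using cut Suc(3) w sym by blast
      then show ?thesis using zV by simp
    qed
  qed
  have "\<exists>x'\<in>S. \<forall>y\<in>S. x' \<in> interval V E x y" if x: "x \<in> V" for x
  proof (cases "x \<in> S")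
    case True
    then show ?thesis using x by (auto simp: interval_def intro!: bexI[of _ x])
  next
    case False
    have "z \<in> interval V E x y" if "y \<in> S" for y
      using le[OF x False that] d_triangle[OF x zV, of y] S zV that unfolding interval_def by force
    then show ?thesis using S by blast
  qed
  then show ?thesis using S unfolding gated_def by blast
qed

text \<open>If \<open>z\<close> separates \<open>u\<close> from \<open>v\<close>, the component
  \<open>C\<close> of \<open>u\<close> with \<open>z\<close> added and the complement of
  \<open>C\<close> are gated and glued at \<open>z\<close> alone.\<close>

lemma two_connected_of_no_amalgam:
  assumes nt: "nontrivial_set V" and na: "\<not> is_gated_amalgam V E"
  shows "two_connected V E"
  unfolding two_connected_def
proof (intro conjI ballI nt conn)
  fix z assume z: "z \<in> V"
  let ?E = "\<lambda>x y. E x y \<and> x \<noteq> z \<and> y \<noteq> z"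
  let ?R = "\<lambda>x y. ?E x y \<and> x \<in> V - {z} \<and> y \<in> V - {z}"
  show "connected_graph (V - {z}) ?E"
  proof (rule connected_graphI)
    show "V - {z} \<noteq> {}" using nt unfolding nontrivial_set_def by blast
    fix u v assume u: "u \<in> V - {z}" and v: "v \<in> V - {z}"
    show "?R\<^sup>*\<^sup>* u v"
    proof (rule ccontr)
      assume nr: "\<not> ?R\<^sup>*\<^sup>* u v"
      define C where "C = {x. ?R\<^sup>*\<^sup>* u x}"
      have CV: "C \<subseteq> V - {z}"
      proof
        fix x assume "x \<in> C"
        then have "?R\<^sup>*\<^sup>* u x" unfolding C_def by simp
        then show "x \<in> V - {z}" by (induction rule: rtranclp_induct) (use u in auto)
      qed
      have edge: "t = z" if "s \<in> C" "t \<notin> C" "E s t" for s t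
      proof (rule ccontr)
        assume "t \<noteq> z"
        then have "?R s t" using that CV inV by blast
        then show False using that unfolding C_def by (auto intro: rtranclp.rtrancl_into_rtrancl)
      qed
      have uC: "u \<in> C" unfolding C_def by simp
      have vC: "v \<notin> C" using nr unfolding C_def by simp
      have "gated V E (insert z C)" by (rule gated_of_cut_vertex[of _ z]) (use CV z edge in auto)
      moreover have "gated V E (V - C)" by (rule gated_of_cut_vertex[of _ z]) (use CV z edge inV sym in blast)+
      moreover have "insert z C \<noteq> V" "V - C \<noteq> V" using uC vC u v by auto
      moreover have "insert z C \<inter> (V - C) \<noteq> {}" "insert z C \<union> (V - C) = V" using z CV by auto
      moreover have "\<forall>x y. E x y \<longrightarrow> x \<in> insert z C \<and> y \<in> insert z C \<or> x \<in> V - C \<and> y \<in> V - C"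
        using edge inV sym by blast
      ultimately have "is_gated_amalgam V E" unfolding is_gated_amalgam_def by blast
      then show False using na by blast
    qed
  qed
qed

end

section \<open>Squares and link paths between their opposite corners\<close>

context premedian
begin

definition square :: "'a \<Rightarrow> 'a \<Rightarrow> 'a \<Rightarrow> 'a \<Rightarrow> bool" where
  "square x y w z \<longleftrightarrow> E x y \<and> E y w \<and> E w z \<and> E z x \<and> x \<noteq> w \<and> y \<noteq> z \<and> \<not> E x w \<and> \<not> E y z"

text \<open>A path from \<open>y\<close> to \<open>z\<close> of length two (\<open>a = b\<close>) or
  three in the link of \<open>x\<close>. These two lengths will produce \<open>W4\<close> and
  \<open>M4\<close>.\<close>

definition short_link :: "'a \<Rightarrow> 'a \<Rightarrow> 'a \<Rightarrow> bool" where
  "short_link x y z \<longleftrightarrow> (\<exists>a b. E x a \<and> E x b \<and> E y a \<and> E b z \<and> (a = b \<or> E a b))"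

lemma square_rot: "square x y w z \<Longrightarrow> square y w z x"
  unfolding square_def using sym by blast

lemma square_flip: "square x y w z \<Longrightarrow> square x z w y"
  unfolding square_def using sym by blast

lemma square_three:
  assumes "square x y w z" "E c x" "E c y" "E c w" "c \<noteq> z" shows "E c z"
  using no_W4_minus[of x y w z c] assms unfolding square_def by blast

text \<open>A third common neighbor of \<open>x\<close> and \<open>w\<close> sees \<open>y\<close>
  or \<open>z\<close> by \<open>three_common_neighbors\<close>, hence both by
  \<open>square_three\<close>, and would be a link path of length two.\<close>

lemma square_common_neighbor:
  assumes sq: "square x y w z" and t: "E t x" "E t w" and ns: "\<not> short_link x y z"
  shows "t = y \<or> t = z"
proof (rule ccontr)
  assume n: "\<not> (t = y \<or> t = z)"
  note s = sq[unfolded square_def]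
  have "E t y \<or> E t z"
    using three_common_neighbors[of x y z t w] s t n sym by blast
  moreover have "E t z" if "E t y" using square_three[OF sq] that t n by blast
  moreover have "E t y" if "E t z" using square_three[OF square_flip[OF sq]] that t n by blast
  ultimately have "E t y" "E t z" by blast+
  then show False using ns t sym unfolding short_link_def by blast
qed

text \<open>The triangle condition seen from \<open>a\<close>, for the edge from \<open>w\<close> to
  \<open>z\<close>, whose ends are both at distance two.\<close>

lemma square_opposite:
  assumes sq: "square x y w z" and a: "E x a" "E y a" "\<not> E a z" "\<not> E a w"
  obtains q where "E q a" "E q z" "E q w"
proof -
  note s = sq[unfolded square_def]
  have V: "a \<in> V" using inV a by blast
  have "a \<noteq> z" "a \<noteq> w" using s a sym by blast+
  then have "d a z = 2" "d a w = 2" using d_2I[of a x z] d_2I[of a y w] s a sym by blast+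
  then obtain q where q: "q \<in> V" "E q z" "E q w" "d a q = 1"
    using tc[OF V sym, of w z 1] s by (auto simp: numeral_2_eq_2)
  then show ?thesis using that d_1[OF V, of q] sym by auto
qed

text \<open>A link path \<open>y, a, ..., z\<close> transports the square \<open>x, y, w, z\<close> to a square \<open>x, a, q, z\<close>, which leaves only link
  paths of length at most four; the quadrangle condition excludes length four.\<close>

lemma short_link_of_link:
  assumes "((\<lambda>p q. E x p \<and> E x q \<and> E p q) ^^ m) y z" "square x y w z"
  shows "short_link x y z"
  using assms
proof (induction m arbitrary: y w)
  case 0
  then show ?case by (simp add: square_def)
next
  case (Suc m)
  note sq = Suc(3)
  note s = sq[unfolded square_def]
  obtain a where a: "E x a" "E y a" and rest: "((\<lambda>p q. E x p \<and> E x q \<and> E p q) ^^ m) a z"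
    using relpowp_Suc_D2[OF Suc(2)] by blast
  have V: "w \<in> V" "a \<in> V" using inV a s by blast+
  show ?case
  proof (rule ccontr)
    assume ns: "\<not> short_link x y z"
    have nb: "t = y \<or> t = z" if "E t x" "E t w" for t using square_common_neighbor[OF sq that ns] .
    have az: "\<not> E a z" using ns a unfolding short_link_def by blast
    have aw: "\<not> E a w" using nb[of a] a s az neq sym by blast
    obtain q where q: "E q a" "E q z" "E q w" using square_opposite[OF sq a az aw] .
    have xq: "\<not> E x q" using nb[of q] q s neq sym by blast
    have "x \<noteq> q" "a \<noteq> z" using q s a sym by blast+
    then have "square x a q z" using a q xq az s sym unfolding square_def by blast
    then have "short_link x a z" using Suc(1)[OF rest] by blast
    \<comment> \<open>By induction the link path may be taken as \<open>y, a, b, c, z\<close>. It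
      remains to exclude the possible distances two and three from \<open>w\<close> to
      \<open>b\<close>.\<close>
    then obtain b c where bc: "E x b" "E x c" "E a b" "E c z" "b = c \<or> E b c" unfolding short_link_def by blast
    then have bc': "E b c" "\<not> E b y" "\<not> E a c" "\<not> E b z" "a \<noteq> c" "\<not> E c y" "c \<noteq> y"
      using ns a sym unfolding short_link_def by blast+
    have Vbc: "b \<in> V" "c \<in> V" "x \<in> V" using inV bc by blast+
    have bw: "\<not> E b w" using nb[of b] bc bc' az a sym by blast
    have cw: "\<not> E c w" using nb[of c] bc bc' neq sym by blast
    have bne: "b \<noteq> w" "c \<noteq> w" "a \<noteq> w" using bc s a by blast+
    have dist: "d w a = 2" "d w c = 2" "d w x = 2"
      using d_2I[of w y a] d_2I[of w z c] d_2I[of w z x] s a bc aw cw bne sym by blast+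
    \<comment> \<open>Here the triangle condition would give a common neighbor of \<open>x\<close>,
      \<open>w\<close> and \<open>b\<close>. It would be \<open>y\<close> or \<open>z\<close>, but
      \<open>b\<close> sees neither.\<close>
    have "d w b \<noteq> 2"
    proof
      assume "d w b = 2"
      then obtain t where t: "t \<in> V" "E t x" "E t b" "d w t = 1"
        using tc[OF V(1) bc(1), of 1] dist by (auto simp: numeral_2_eq_2)
      then have "E t w" using d_1[OF V(1) t(1)] sym by simp
      then show False using nb[of t] t bc' bc sym by blast
    qed
    moreover have "d w b \<le> 3" using d_step[OF V(1) bc(3)] dist by simp
    moreover have "d w b \<noteq> 0" "d w b \<noteq> 1" using d_0[OF V(1) Vbc(1)] d_1[OF V(1) Vbc(1)] bne bw sym by auto
    ultimately have "d w b = 3" by linarith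
    \<comment> \<open>The quadrangle condition from \<open>w\<close> completes the square
      \<open>a, x, c, r\<close>. Seeing \<open>a\<close>, \<open>x\<close> and \<open>c\<close>, the
      vertex \<open>b\<close> also sees \<open>r\<close>, a neighbor of \<open>w\<close>, against
      distance three.\<close>
    then obtain r where r: "r \<in> V" "E r a" "E r c" "d w r = 1"
      using qc[OF V(1) bc(3) sym[OF bc'(1)] bc'(5), of 1] dist by (auto simp: numeral_2_eq_2 numeral_3_eq_3)
    then have rw: "E r w" using d_1[OF V(1) r(1)] sym by simp
    have xr: "\<not> E x r" using nb[of r] rw r bc' az sym by blast
    have "x \<noteq> r" using rw s by blast
    then have "square a x c r" using a bc bc' r xr sym unfolding square_def by blast
    moreover have "b \<noteq> r" using bw rw by blast
    ultimately have "E b r" using square_three[of a x c r b] bc bc' sym by blast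
    then show False using \<open>d w b = 3\<close> d_step[OF V(1) sym[OF \<open>E b r\<close>]] r by simp
  qed
qed

text \<open>Without a \<open>W4\<close> on this square the link path has \<open>a\<close> distinct
  from \<open>b\<close>. Opposite vertices \<open>q\<close> and \<open>p\<close> come from
  \<open>square_opposite\<close> on either side, and \<open>square_three\<close> in small auxiliary
  squares makes \<open>a, p, q, b\<close> a clique.\<close>

lemma square_W4_or_M4:
  assumes sq: "square x y w z" and sl: "short_link x y z"
  shows "(\<exists>c. induced_W4 V E c x y w z) \<or> (\<exists>a p q b. induced_M4 V E x y w z a p q b)"
proof -
  note s = sq[unfolded square_def]
  have sqE: "is_square V E x y w z" using s inV irrefl unfolding is_square_def by auto
  have W4: "\<exists>c. induced_W4 V E c x y w z" if "E c x" "E c w" "E c y \<or> E c z" for c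
  proof -
    have "c \<noteq> y" "c \<noteq> z" "c \<noteq> x" "c \<noteq> w" using that s neq sym by blast+
    moreover from this have "E c y" "E c z"
      using square_three[OF sq, of c] square_three[OF square_flip[OF sq], of c] that by blast+
    ultimately show ?thesis using that sqE inV unfolding induced_W4_def is_square_def by auto
  qed
  show ?thesis
  proof (cases "\<exists>c. induced_W4 V E c x y w z")
    case False
    obtain a b where ab: "E x a" "E x b" "E y a" "E b z" "a = b \<or> E a b" using sl unfolding short_link_def by blast
    have aw: "\<not> E a w" "\<not> E b w" using W4 False ab sym by blast+
    have az: "\<not> E a z"
    proof
      assume "E a z"
      then have "E a w" using square_three[of y x z w a] sq ab s sym unfolding square_def by blast
      then show False using aw by blast
    qed
    have b_y: "\<not> E b y"
    proof
      assume "E b y"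
      then have "E b w" using square_three[of y x z w b] sq ab s sym unfolding square_def by blast
      then show False using aw by blast
    qed
    have eab: "E a b" using ab az by blast
    obtain q where q: "E q a" "E q z" "E q w" using square_opposite[OF sq ab(1,3) az aw(1)] .
    obtain p where p: "E p b" "E p y" "E p w"
      using square_opposite[OF square_flip[OF sq] ab(2) sym[OF ab(4)] b_y aw(2)] .
    have px: "\<not> E p x" "\<not> E q x" using W4 False p q by blast+
    have pne: "p \<noteq> z" "q \<noteq> y" "p \<noteq> x" "q \<noteq> x" "p \<noteq> a" "q \<noteq> b" "a \<noteq> w" "b \<noteq> w"
      using p q s px aw ab sym by blast+
    have "square y x b p" using s ab p px b_y pne neq sym unfolding square_def by blast
    then have pa: "E a p" using square_three[of y x b p a] ab eab pne sym by blast
    have "square z x a q" using s ab q px az pne neq sym unfolding square_def by blast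
    then have qb: "E b q" using square_three[of z x a q b] ab eab pne sym by blast
    have pz: "\<not> E p z" using square_three[OF square_rot[OF sq], of p] p px pne by blast
    have qy: "\<not> E q y" using square_three[OF square_rot[OF square_flip[OF sq]], of q] q px pne by blast
    have "p \<noteq> q" using p qy by blast
    have "square b z w p" using ab s p pz aw pne neq sym unfolding square_def by blast
    then have pq: "E q p" using square_three[of b z w p q] qb q \<open>p \<noteq> q\<close> sym by blast
    have "induced_M4 V E x y w z a p q b" unfolding induced_M4_def
      using sqE inV ab p q pa qb pq eab px pz qy aw az b_y neq sym s by auto
    then show ?thesis by blast
  qed blast
qed

lemma squares_of_link_connected:
  assumes "\<And>x p q. E x p \<Longrightarrow> E x q \<Longrightarrow> link_conn E x p q"
  shows "squares_in_W4_or_M4 V E"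
  unfolding squares_in_W4_or_M4_def
proof (intro allI impI)
  fix x y w z assume "is_square V E x y w z"
  then have sq: "square x y w z" unfolding is_square_def square_def by auto
  then have "link_conn E x y z" using assms sym unfolding square_def by blast
  then obtain m where "((\<lambda>p q. E x p \<and> E x q \<and> E p q) ^^ m) y z"
    unfolding link_conn_def using rtranclp_imp_relpowp by metis
  then have "(\<exists>c. induced_W4 V E c x y w z) \<or> (\<exists>a p q b. induced_M4 V E x y w z a p q b)"
    using square_W4_or_M4[OF sq short_link_of_link[OF _ sq]] by blast
  then show "(\<exists>c y1 y2 y3 y4. induced_W4 V E c y1 y2 y3 y4 \<and> {x, y, w, z} \<subseteq> {c, y1, y2, y3, y4}) \<or>
     (\<exists>y1 y2 y3 y4 a1 a2 a3 a4. induced_M4 V E y1 y2 y3 y4 a1 a2 a3 a4 \<and>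
        {x, y, w, z} \<subseteq> {y1, y2, y3, y4, a1, a2, a3, a4})"
  proof
    assume "\<exists>c. induced_W4 V E c x y w z"
    then obtain c where "induced_W4 V E c x y w z" by blast
    moreover have "{x, y, w, z} \<subseteq> {c, x, y, w, z}" by blast
    ultimately show ?thesis by blast
  next
    assume "\<exists>a p q b. induced_M4 V E x y w z a p q b"
    then obtain a p q b where "induced_M4 V E x y w z a p q b" by blast
    moreover have "{x, y, w, z} \<subseteq> {x, y, w, z, a, p, q, b}" by blast
    ultimately show ?thesis by blast
  qed
qed

end

section \<open>Homotopies\<close>

lemma homotopic_refl [simp]: "edge_path_homotopic E p p"
  unfolding edge_path_homotopic_def by simp

lemma homotopic_trans [trans]:
  "edge_path_homotopic E p q \<Longrightarrow> edge_path_homotopic E q r \<Longrightarrow> edge_path_homotopic E p r"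
  unfolding edge_path_homotopic_def by (rule rtranclp_trans)

lemma homotopic_sym: "edge_path_homotopic E p q \<Longrightarrow> edge_path_homotopic E q p"
proof -
  have "symp (\<lambda>p q. htpy_step E p q \<or> htpy_step E q p)" by (auto intro: sympI)
  then show "edge_path_homotopic E p q \<Longrightarrow> edge_path_homotopic E q p"
    unfolding edge_path_homotopic_def by (rule sympD[OF symp_rtranclp])
qed

lemma htpy_step_context:
  assumes "htpy_step E p q" shows "htpy_step E (xs @ p @ ys) (xs @ q @ ys)"
proof -
  from assms consider a b u v where "p = a @ [u, v, u] @ b" "q = a @ [u] @ b" "E u v"
    | a b u v w where "p = a @ [u, v, w] @ b" "q = a @ [u, w] @ b" "E u v" "E v w" "E u w"
    unfolding htpy_step_def by blast
  then show ?thesis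
  proof cases
    case 1
    then show ?thesis unfolding htpy_step_def
      by (intro disjI1 exI[of _ "xs @ a"] exI[of _ "b @ ys"]) auto
  next
    case 2
    then show ?thesis unfolding htpy_step_def
      by (intro disjI2 exI[of _ "xs @ a"] exI[of _ "b @ ys"]) auto
  qed
qed

lemma homotopic_context:
  assumes "edge_path_homotopic E p q"
  shows "edge_path_homotopic E (xs @ p @ ys) (xs @ q @ ys)"
  using assms unfolding edge_path_homotopic_def
proof (induction rule: rtranclp_induct)
  case (step q r)
  then have "htpy_step E (xs @ q @ ys) (xs @ r @ ys) \<or> htpy_step E (xs @ r @ ys) (xs @ q @ ys)"
    using htpy_step_context by blast
  then show ?case using step.IH by (simp add: rtranclp.rtrancl_into_rtrancl)
qed simp

lemma homotopic_append: "edge_path_homotopic E p q \<Longrightarrow> edge_path_homotopic E (p @ ys) (q @ ys)"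
  using homotopic_context[of E p q "[]" ys] by simp

lemma homotopic_of_step: "htpy_step E p q \<Longrightarrow> edge_path_homotopic E p q"
  unfolding edge_path_homotopic_def by (simp add: r_into_rtranclp)

lemma homotopic_backtrack:
  assumes "E u v" shows "edge_path_homotopic E (xs @ u # v # u # ys) (xs @ u # ys)"
proof (rule homotopic_of_step)
  have "xs @ u # v # u # ys = xs @ [u, v, u] @ ys" "xs @ u # ys = xs @ [u] @ ys" by simp_all
  then show "htpy_step E (xs @ u # v # u # ys) (xs @ u # ys)"
    using assms unfolding htpy_step_def by blast
qed

lemma homotopic_triangle:
  assumes "E u v" "E v w" "E u w"
  shows "edge_path_homotopic E (xs @ u # v # w # ys) (xs @ u # w # ys)"
proof (rule homotopic_of_step)
  have "xs @ u # v # w # ys = xs @ [u, v, w] @ ys" "xs @ u # w # ys = xs @ [u, w] @ ys" by simp_all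
  then show "htpy_step E (xs @ u # v # w # ys) (xs @ u # w # ys)"
    using assms unfolding htpy_step_def by blast
qed

section \<open>Null-homotopic squares\<close>

context cgraph
begin

abbreviation homotopic (infix "\<simeq>" 50) where "p \<simeq> q \<equiv> edge_path_homotopic E p q"

lemma cone_null:
  assumes "E c x" "E c y" "E c w" "E c z" "E x y" "E y w" "E w z" "E z x"
  shows "[x, y, w] \<simeq> [x, z, w]"
proof -
  have half: "[x, y, w] \<simeq> [x, c, w]" if "E c y" "E x y" "E y w" for y
  proof -
    have "[x, c, y, w] \<simeq> [x, y, w]" using homotopic_triangle[of E x c y "[]" "[w]"] that assms sym by simp
    moreover have "[x, c, y, w] \<simeq> [x, c, w]" using homotopic_triangle[of E c y w "[x]" "[]"] that assms sym by simp
    ultimately show ?thesis using homotopic_sym homotopic_trans by metis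
  qed
  show ?thesis using half[of y] half[of z] assms sym homotopic_sym homotopic_trans by metis
qed

text \<open>Conjugation by one edge moves the starting corner, so \<open>M4_null\<close> need be
  computed at a single corner.\<close>

lemma null_rot:
  assumes "[x, y, w] \<simeq> [x, z, w]" "E x y" "E y w" "E w z" "E z x"
  shows "[y, w, z] \<simeq> [y, x, z]"
proof -
  have "[y, x, z, w, z] \<simeq> [y, x, z]" using homotopic_backtrack[of E z w "[y, x]" "[]"] assms sym by simp
  moreover have "[y, x, y, w, z] \<simeq> [y, x, z, w, z]" using homotopic_context[OF assms(1), of "[y]" "[z]"] by simp
  moreover have "[y, x, y, w, z] \<simeq> [y, w, z]" using homotopic_backtrack[of E y x "[]" "[w, z]"] assms sym by simp
  ultimately show ?thesis using homotopic_sym homotopic_trans by metis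
qed

text \<open>The sweep crosses a disc of ten triangles: four with an outer edge, four with one outer
  vertex, and two halves of the inner clique.\<close>

lemma M4_null:
  assumes "induced_M4 V E y1 y2 y3 y4 a1 a2 a3 a4"
  shows "[y1, y2, y3] \<simeq> [y1, y4, y3]"
proof -
  note m = assms[unfolded induced_M4_def is_square_def]
  have "[y1, a1, y2, y3] \<simeq> [y1, y2, y3]" using homotopic_triangle[of E y1 a1 y2 "[]" "[y3]"] m sym by simp
  moreover have "[y1, a1, y2, a2, y3] \<simeq> [y1, a1, y2, y3]"
    using homotopic_triangle[of E y2 a2 y3 "[y1, a1]" "[]"] m sym by simp
  moreover have "[y1, a1, y2, a2, y3] \<simeq> [y1, a1, a2, y3]"
    using homotopic_triangle[of E a1 y2 a2 "[y1]" "[y3]"] m sym by simp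
  moreover have "[y1, a4, a1, a2, y3] \<simeq> [y1, a1, a2, y3]"
    using homotopic_triangle[of E y1 a4 a1 "[]" "[a2, y3]"] m sym by simp
  moreover have "[y1, a4, a1, a2, y3] \<simeq> [y1, a4, a2, y3]"
    using homotopic_triangle[of E a4 a1 a2 "[y1]" "[y3]"] m sym by simp
  moreover have "[y1, a4, a2, a3, y3] \<simeq> [y1, a4, a2, y3]"
    using homotopic_triangle[of E a2 a3 y3 "[y1, a4]" "[]"] m sym by simp
  moreover have "[y1, a4, a2, a3, y3] \<simeq> [y1, a4, a3, y3]"
    using homotopic_triangle[of E a4 a2 a3 "[y1]" "[y3]"] m sym by simp
  moreover have "[y1, a4, y4, a3, y3] \<simeq> [y1, a4, a3, y3]"
    using homotopic_triangle[of E a4 y4 a3 "[y1]" "[y3]"] m sym by simp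
  moreover have "[y1, a4, y4, a3, y3] \<simeq> [y1, y4, a3, y3]"
    using homotopic_triangle[of E y1 a4 y4 "[]" "[a3, y3]"] m sym by simp
  moreover have "[y1, y4, a3, y3] \<simeq> [y1, y4, y3]"
    using homotopic_triangle[of E y4 a3 y3 "[y1]" "[]"] m sym by simp
  ultimately show ?thesis by (meson homotopic_sym homotopic_trans)
qed

text \<open>Squares are only assumed to lie within the vertices of an \<open>M4\<close>, so besides
  the outer cycle with its rotations and reflections there may be others; those are coned off by a
  vertex.\<close>

lemma square_in_M4:
  assumes M: "induced_M4 V E y1 y2 y3 y4 a1 a2 a3 a4"
    and sq: "is_square V E x1 x2 x3 x4" and sub: "{x1, x2, x3, x4} \<subseteq> {y1, y2, y3, y4, a1, a2, a3, a4}"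
  shows "(\<exists>c. E c x1 \<and> E c x2 \<and> E c x3 \<and> E c x4) \<or>
    [x1, x2, x3, x4] \<in> {[y1, y2, y3, y4], [y2, y3, y4, y1], [y3, y4, y1, y2], [y4, y1, y2, y3],
       [y1, y4, y3, y2], [y4, y3, y2, y1], [y3, y2, y1, y4], [y2, y1, y4, y3]}"
proof -
  note m = M[unfolded induced_M4_def is_square_def]
  note s = sq[unfolded is_square_def]
  have pos: "E y1 y2" "E y2 y3" "E y3 y4" "E y4 y1" "E a1 a2" "E a1 a3" "E a1 a4" "E a2 a3" "E a2 a4" "E a3 a4"
    "E a1 y1" "E a1 y2" "E a2 y2" "E a2 y3" "E a3 y3" "E a3 y4" "E a4 y1" "E a4 y4" using m by simp_all
  have neg: "\<not> E y1 y3" "\<not> E y2 y4" "\<not> E a1 y3" "\<not> E a1 y4" "\<not> E a2 y1" "\<not> E a2 y4" "\<not> E a3 y1" "\<not> E a3 y2"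
    "\<not> E a4 y2" "\<not> E a4 y3" using m by simp_all
  note pos' = pos pos[THEN sym]
  have neg': "\<not> E y3 y1" "\<not> E y4 y2" "\<not> E y3 a1" "\<not> E y4 a1" "\<not> E y1 a2" "\<not> E y4 a2" "\<not> E y1 a3" "\<not> E y2 a3"
    "\<not> E y2 a4" "\<not> E y3 a4" using neg sym by blast+
  have mem: "x2 \<in> {y1, y2, y3, y4, a1, a2, a3, a4}" "x4 \<in> {y1, y2, y3, y4, a1, a2, a3, a4}" using sub by auto
  \<comment> \<open>A vertex \<open>c\<close> among the common neighbors of \<open>p\<close> and
    \<open>q\<close> that sees all the others. Neither remaining corner of a square on
    \<open>p\<close>, \<open>q\<close> can be \<open>c\<close>, as those corners are nonadjacent; so
    \<open>c\<close> sees all four.\<close>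
  define center where "center p q \<longleftrightarrow> (\<exists>c. E c p \<and> E c q \<and>
    (\<forall>x\<in>{y1, y2, y3, y4, a1, a2, a3, a4}. E x p \<and> E x q \<longrightarrow> x = c \<or> E c x))" for p q
  have center_sym: "center q p" if "center p q" for p q using that unfolding center_def by blast
  have c1: "center a1 y3" unfolding center_def by (rule exI[of _ a2]) (simp add: pos' neg neg')
  have c2: "center a1 y4" unfolding center_def by (rule exI[of _ a4]) (simp add: pos' neg neg')
  have c3: "center a2 y1" unfolding center_def by (rule exI[of _ a1]) (simp add: pos' neg neg')
  have c4: "center a2 y4" unfolding center_def by (rule exI[of _ a3]) (simp add: pos' neg neg')
  have c5: "center a3 y1" unfolding center_def by (rule exI[of _ a4]) (simp add: pos' neg neg')
  have c6: "center a3 y2" unfolding center_def by (rule exI[of _ a2]) (simp add: pos' neg neg')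
  have c7: "center a4 y2" unfolding center_def by (rule exI[of _ a1]) (simp add: pos' neg neg')
  have c8: "center a4 y3" unfolding center_def by (rule exI[of _ a3]) (simp add: pos' neg neg')
  note ctr = c1 c2 c3 c4 c5 c6 c7 c8
  have "(p, q) \<in> {(y1, y3), (y2, y4), (y3, y1), (y4, y2)} \<or> center p q"
    if "p \<in> {y1, y2, y3, y4, a1, a2, a3, a4}" "q \<in> {y1, y2, y3, y4, a1, a2, a3, a4}" "p \<noteq> q" "\<not> E p q" for p q
    using that(1,2) by (elim insertE emptyE; use that(3,4) pos' ctr ctr[THEN center_sym] in simp)
  then have "(x1, x3) \<in> {(y1, y3), (y2, y4), (y3, y1), (y4, y2)} \<or> center x1 x3" using s sub by simp
  then show ?thesis
  proof
    assume "center x1 x3"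
    then obtain c where c: "E c x1" "E c x3"
      and nb: "\<forall>x\<in>{y1, y2, y3, y4, a1, a2, a3, a4}. E x x1 \<and> E x x3 \<longrightarrow> x = c \<or> E c x"
      unfolding center_def by blast
    have "E x2 x1 \<and> E x2 x3" "E x4 x1 \<and> E x4 x3" using s sym by blast+
    then have "x2 = c \<or> E c x2" "x4 = c \<or> E c x4" using bspec[OF nb mem(1)] bspec[OF nb mem(2)] by simp_all
    moreover have "x2 \<noteq> x4" "\<not> E x2 x4" using s by simp_all
    moreover from this have "\<not> E x4 x2" using sym by blast
    ultimately have "E c x2" "E c x4" by metis+
    then show ?thesis using c by metis
  next
    assume x13: "(x1, x3) \<in> {(y1, y3), (y2, y4), (y3, y1), (y4, y2)}"
    have adj: "E x1 x2" "E x2 x3" "E x3 x4" "E x4 x1" "x2 \<noteq> x4" using s by auto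
    have common: "x \<in> {y2, y4} \<and> x1 \<in> {y1, y3} \<or> x \<in> {y1, y3} \<and> x1 \<in> {y2, y4}"
      if "x \<in> {y1, y2, y3, y4, a1, a2, a3, a4}" "E x1 x" "E x x3" for x
      using x13 that neg neg' by auto
    have ne: "distinct [y1, y2, y3, y4]" using m by simp
    have e: "E x1 x4" "E x4 x3" using adj sym by blast+
    show ?thesis using common[OF mem(1) adj(1,2)] common[OF mem(2) e] adj(5) x13 ne by auto
  qed
qed

lemma square_null:
  assumes "squares_in_W4_or_M4 V E" and sq: "is_square V E x y w z"
  shows "[x, y, w] \<simeq> [x, z, w]"
proof -
  note s = sq[unfolded is_square_def]
  have center: "[x, y, w] \<simeq> [x, z, w]" if "E c x \<and> E c y \<and> E c w \<and> E c z" for c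
    using cone_null[of c x y w z] that s by simp
  from assms consider c y1 y2 y3 y4 where "induced_W4 V E c y1 y2 y3 y4" "{x, y, w, z} \<subseteq> {c, y1, y2, y3, y4}"
    | y1 y2 y3 y4 a1 a2 a3 a4 where "induced_M4 V E y1 y2 y3 y4 a1 a2 a3 a4"
        "{x, y, w, z} \<subseteq> {y1, y2, y3, y4, a1, a2, a3, a4}"
    unfolding squares_in_W4_or_M4_def by metis
  then show ?thesis
  proof cases
    case 1
    \<comment> \<open>The hub sees all other vertices, so no square inside the \<open>W4\<close> can
      contain it.\<close>
    have adj: "E c p" if "p \<in> {c, y1, y2, y3, y4}" "p \<noteq> c" for p using 1(1) that unfolding induced_W4_def by blast
    have "x \<noteq> c" "y \<noteq> c" "w \<noteq> c" "z \<noteq> c" using adj 1(2) s sym by auto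
    then show ?thesis using center[of c] adj 1(2) by simp
  next
    case 2
    note y = 2(1)[unfolded induced_M4_def is_square_def]
    have n1: "[y1, y2, y3] \<simeq> [y1, y4, y3]" using M4_null[OF 2(1)] .
    have n2: "[y2, y3, y4] \<simeq> [y2, y1, y4]" using null_rot[OF n1] y by simp
    have n3: "[y3, y4, y1] \<simeq> [y3, y2, y1]" using null_rot[OF n2] y by simp
    have n4: "[y4, y1, y2] \<simeq> [y4, y3, y2]" using null_rot[OF n3] y by simp
    note n = n1 n2 n3 n4
    show ?thesis using square_in_M4[OF 2(1) sq 2(2)]
    proof
      assume "\<exists>c. E c x \<and> E c y \<and> E c w \<and> E c z" then show ?thesis using center by blast
    next
      assume "[x, y, w, z] \<in> {[y1, y2, y3, y4], [y2, y3, y4, y1], [y3, y4, y1, y2], [y4, y1, y2, y3],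
       [y1, y4, y3, y2], [y4, y3, y2, y1], [y3, y2, y1, y4], [y2, y1, y4, y3]}"
      then show ?thesis using n n[THEN homotopic_sym] by auto
    qed
  qed
qed

lemma walk_snocD:
  "walk V E (p @ [v]) \<Longrightarrow> p \<noteq> [] \<Longrightarrow> walk V E p \<and> E (last p) v"
proof (induction p)
  case (Cons a p)
  then show ?case by (cases p) auto
qed simp

definition geod :: "'a \<Rightarrow> 'a \<Rightarrow> 'a list \<Rightarrow> bool" where
  "geod u v p \<longleftrightarrow> walk V E p \<and> hd p = u \<and> last p = v \<and> length p = Suc (d u v)"

lemma geod_exists: assumes "u \<in> V" "v \<in> V" obtains p where "geod u v p"
  using geodesic[OF assms] unfolding geod_def by blast

lemma geod_snoc: assumes "geod u v p" "E v w" "d u w = Suc (d u v)" shows "geod u w (p @ [w])"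
  using assms walk_append[of V E p "[w]"] inV[OF assms(2)] walk_not_Nil[of V E p] unfolding geod_def by auto

lemma geod_snocD:
  assumes p: "geod u w p" and "u \<in> V" "d u w = Suc n"
  obtains q v where "p = q @ [w]" "geod u v q" "E v w" "d u v = n" "v \<in> V"
proof -
  have "p \<noteq> []" "length p = Suc (Suc n)" using p assms unfolding geod_def by auto
  then obtain q where q: "p = q @ [w]" "length q = Suc n"
    using p unfolding geod_def by (metis append_butlast_last_id length_append_singleton nat.inject)
  then have "q \<noteq> []" by auto
  define v where "v = last q"
  have w: "walk V E q" "E v w" using walk_snocD[OF _ \<open>q \<noteq> []\<close>, of w] p q unfolding geod_def v_def by auto
  have "hd q = u" using p q \<open>q \<noteq> []\<close> unfolding geod_def by simp
  then have "d u v \<le> n" using d_le_walk[OF w(1) _ _ q(2)] v_def by simp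
  moreover have "d u w \<le> Suc (d u v)" using d_step[OF assms(2) w(2)] .
  ultimately have "d u v = n" using assms by simp
  then show ?thesis using that[of q v] q w \<open>hd q = u\<close> v_def inV unfolding geod_def by auto
qed

lemma geod_lastD: assumes "geod u v p" obtains q where "p = q @ [v]"
  using assms walk_not_Nil[of V E p] append_butlast_last_id[of p] unfolding geod_def by metis

end

section \<open>Deforming walks into geodesics\<close>

context wmgraph
begin

context
  assumes squares_null: "\<And>x y w z. is_square V E x y w z \<Longrightarrow> [x, y, w] \<simeq> [x, z, w]"
begin

text \<open>Includes the degenerate cases, so that two lower neighbors may be exchanged without
  asking whether they span a square.\<close>

lemma two_paths_null:
  assumes "E c a" "E a v" "E c b" "E b v"
  shows "[c, a, v] \<simeq> [c, b, v]"
proof -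
  consider "a = b" | "c = v" | "E c v" | "E a b" | "a \<noteq> b" "c \<noteq> v" "\<not> E c v" "\<not> E a b" by blast
  then show ?thesis
  proof cases
    case 2
    then show ?thesis using homotopic_backtrack[of E c a "[]" "[]"] homotopic_backtrack[of E c b "[]" "[]"]
        assms homotopic_sym homotopic_trans by (metis append_Nil)
  next
    case 3
    then show ?thesis using homotopic_triangle[of E c a v "[]" "[]"] homotopic_triangle[of E c b v "[]" "[]"]
        assms homotopic_sym homotopic_trans by (metis append_Nil)
  next
    case 4
    have "[c, b, a, v] \<simeq> [c, a, v]" using homotopic_triangle[of E c b a "[]" "[v]"] 4 assms sym by simp
    moreover have "[c, b, a, v] \<simeq> [c, b, v]" using homotopic_triangle[of E b a v "[c]" "[]"] 4 assms sym by simp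
    ultimately show ?thesis using homotopic_sym homotopic_trans by metis
  next
    case 5
    then have "is_square V E c a v b" using assms inV sym irrefl unfolding is_square_def by auto
    then show ?thesis by (rule squares_null)
  qed simp
qed

lemma geod_homotopic:
  assumes "u \<in> V" "geod u v p" "geod u v q"
  shows "p \<simeq> q"
  using assms(2,3)
proof (induction "d u v" arbitrary: v p q)
  case 0
  have "length p = 1" "length q = 1" "hd p = u" "hd q = u" using 0 unfolding geod_def by auto
  then have "p = [u]" "q = [u]" by (auto simp: length_Suc_conv)
  then show ?case by simp
next
  case (Suc n)
  obtain p0 a where a: "p = p0 @ [v]" "geod u a p0" "E a v" "d u a = n" "a \<in> V"
    using geod_snocD[OF Suc(3) assms(1) Suc(2)[symmetric]] .
  obtain q0 b where b: "q = q0 @ [v]" "geod u b q0" "E b v" "d u b = n" "b \<in> V"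
    using geod_snocD[OF Suc(4) assms(1) Suc(2)[symmetric]] .
  show ?case
  proof (cases "a = b")
    case True
    then have "p0 \<simeq> q0" using Suc(1)[of a p0 q0] a b by simp
    then show ?thesis using a b homotopic_append by blast
  next
    case False
    then have "n \<noteq> 0" using d_0[OF assms(1) a(5)] d_0[OF assms(1) b(5)] a(4) b(4) by metis
    then obtain k where k: "n = Suc k" by (cases n) auto
    \<comment> \<open>By induction both geodesics are traded for geodesics through \<open>c\<close>,
      two levels below \<open>v\<close>; they then differ only in \<open>[c, a, v]\<close> against
      \<open>[c, b, v]\<close>.\<close>
    obtain c where c: "c \<in> V" "E c a" "E c b" "d u c = k"
      using qc[OF assms(1) a(3) b(3) False, of k] a b Suc(2) k by auto
    obtain r where r: "geod u c r" using geod_exists assms(1) c by blast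
    obtain r0 where r0: "r = r0 @ [c]" using geod_lastD[OF r] .
    have "p0 \<simeq> r @ [a]" using Suc(1)[of a p0 "r @ [a]"] a geod_snoc[OF r c(2)] c k by simp
    then have 1: "p \<simeq> r0 @ [c, a, v]" using homotopic_append[of E p0 _ "[v]"] a r0 by fastforce
    have "q0 \<simeq> r @ [b]" using Suc(1)[of b q0 "r @ [b]"] b geod_snoc[OF r c(3)] c k by simp
    then have 2: "q \<simeq> r0 @ [c, b, v]" using homotopic_append[of E q0 _ "[v]"] b r0 by fastforce
    have "r0 @ [c, a, v] \<simeq> r0 @ [c, b, v]"
      using homotopic_context[OF two_paths_null[OF c(2) a(3) c(3) b(3)], of r0 "[]"] by simp
    then show ?thesis using 1 2 homotopic_sym homotopic_trans by metis
  qed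
qed

text \<open>If the added edge ascends, the result is a geodesic; if it descends, it is a backtrack;
  if it is level, the triangle condition supplies a triangle across which to push.\<close>

lemma geod_edge:
  assumes "u \<in> V" "geod u v p" "geod u w q" "E v w"
  shows "p @ [w] \<simeq> q"
proof -
  have "d u w \<le> Suc (d u v)" "d u v \<le> Suc (d u w)" using d_step[OF assms(1)] assms(4) sym by blast+
  then consider "d u w = Suc (d u v)" | "d u v = Suc (d u w)" | "d u v = d u w" by linarith
  then show ?thesis
  proof cases
    case 1
    then show ?thesis using geod_homotopic[OF assms(1) geod_snoc[OF assms(2,4)] assms(3)] by simp
  next
    case 2
    obtain q0 where q0: "q = q0 @ [w]" using geod_lastD[OF assms(3)] .
    have "p \<simeq> q @ [v]" using geod_homotopic[OF assms(1,2) geod_snoc[OF assms(3) sym[OF assms(4)] 2]] .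
    then have "p @ [w] \<simeq> q0 @ [w, v, w]" using homotopic_append[of E p _ "[w]"] q0 by fastforce
    moreover have "q0 @ [w, v, w] \<simeq> q" using homotopic_backtrack[of E w v q0 "[]"] assms(4) sym q0 by simp
    ultimately show ?thesis by (rule homotopic_trans)
  next
    case 3
    have "d u v \<noteq> 0" using d_0[OF assms(1)] inV assms(4) neq 3 by metis
    then obtain k where k: "d u v = Suc k" by (cases "d u v") auto
    obtain c where c: "c \<in> V" "E c v" "E c w" "d u c = k" using tc[OF assms(1,4) k] 3 k by auto
    obtain r where r: "geod u c r" using geod_exists assms(1) c by blast
    obtain r0 where r0: "r = r0 @ [c]" using geod_lastD[OF r] .
    have "p \<simeq> r @ [v]" using geod_homotopic[OF assms(1,2) geod_snoc[OF r c(2)]] c k by simp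
    then have "p @ [w] \<simeq> r0 @ [c, v, w]" using homotopic_append[of E p _ "[w]"] r0 by fastforce
    also have "r0 @ [c, v, w] \<simeq> r0 @ [c, w]" using homotopic_triangle[of E c v w r0 "[]"] c assms(4) by simp
    also have "r0 @ [c, w] \<simeq> q" using geod_homotopic[OF assms(1) geod_snoc[OF r c(3)] assms(3)] c k 3 r0 by simp
    finally show ?thesis .
  qed
qed

lemma walk_homotopic_geod:
  assumes "u \<in> V" "walk V E p" "hd p = u" "geod u (last p) q"
  shows "p \<simeq> q"
  using assms(2-4)
proof (induction p arbitrary: q rule: rev_induct)
  case Nil then show ?case by (simp add: walk_def)
next
  case (snoc v p)
  show ?case
  proof (cases "p = []")
    case True
    then have "v = u" using snoc by simp
    then have "geod u v [u]" using assms unfolding geod_def by simp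
    then show ?thesis using geod_homotopic[OF assms(1)] snoc True \<open>v = u\<close> by simp
  next
    case False
    have w: "walk V E p" "E (last p) v" "hd p = u" using walk_snocD[OF snoc(2) False] snoc(3) False by auto
    obtain r where r: "geod u (last p) r" using geod_exists[OF assms(1)] w inV by blast
    then have "p @ [v] \<simeq> r @ [v]" using snoc.IH w homotopic_append by blast
    also have "r @ [v] \<simeq> q" using geod_edge[OF assms(1) r _ w(2)] snoc(4) by simp
    finally show ?thesis .
  qed
qed

lemma simply_connected_of_squares_null: "triangle_complex_simply_connected V E"
  unfolding triangle_complex_simply_connected_def
proof (intro conjI allI impI conn)
  fix p assume p: "walk V E p \<and> hd p = last p"
  then have u: "hd p \<in> V" unfolding walk_def by auto
  then have "geod (hd p) (last p) [hd p]" using p unfolding geod_def by auto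
  then show "p \<simeq> [hd p]" using walk_homotopic_geod[OF u _ refl] p by blast
qed

end

end

section \<open>Cocycles\<close>

text \<open>The integral of a 1-cochain along an edge path.\<close>

fun path_sum :: "('a \<Rightarrow> 'a \<Rightarrow> int) \<Rightarrow> 'a list \<Rightarrow> int" where
  "path_sum f (x # y # p) = f x y + path_sum f (y # p)"
| "path_sum f p = 0"

lemma path_sum_append: "path_sum f (p @ u # q) = path_sum f (p @ [u]) + path_sum f (u # q)"
proof (induction p)
  case (Cons a p)
  then show ?case by (cases p) auto
qed simp

context cgraph
begin

lemma path_sum_rev:
  assumes "\<And>u v. E u v \<Longrightarrow> f v u = - f u v" "walk V E p"
  shows "path_sum f (rev p) = - path_sum f p"
  using assms(2)
proof (induction p)
  case (Cons a p)
  show ?case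
  proof (cases p)
    case (Cons b q)
    then have "walk V E p" "E a b" using Cons.prems by auto
    then show ?thesis using Cons.IH assms(1) path_sum_append[of f "rev q" b "[a]"] Cons by simp
  qed simp
qed simp

lemma path_sum_homotopic:
  assumes anti: "\<And>u v. E u v \<Longrightarrow> f v u = - f u v"
    and tri: "\<And>u v w. E u v \<Longrightarrow> E v w \<Longrightarrow> E u w \<Longrightarrow> f u v + f v w = f u w"
    and "p \<simeq> q"
  shows "path_sum f p = path_sum f q"
proof -
  have step: "path_sum f p = path_sum f q" if "htpy_step E p q" for p q
  proof -
    from that consider a b u v where "p = a @ u # v # u # b" "q = a @ u # b" "E u v"
      | a b u v w where "p = a @ u # v # w # b" "q = a @ u # w # b" "E u v" "E v w" "E u w"
      unfolding htpy_step_def by auto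
    then show ?thesis
    proof cases
      case 1
      then show ?thesis using anti[OF 1(3)] path_sum_append[of f a u "v # u # b"] path_sum_append[of f a u b] by simp
    next
      case 2
      then show ?thesis using tri[OF 2(3-5)] path_sum_append[of f a u "v # w # b"] path_sum_append[of f a u "w # b"] by simp
    qed
  qed
  show ?thesis using assms(3) unfolding edge_path_homotopic_def
  proof (induction rule: rtranclp_induct)
    case (step y z)
    then show ?case using \<open>\<And>q p. htpy_step E p q \<Longrightarrow> path_sum f p = path_sum f q\<close> by metis
  qed simp
qed

text \<open>Vanishing first cohomology: integrate \<open>f\<close> from a base vertex. The closed
  walk out along \<open>P u\<close>, over the edge and back along \<open>P v\<close> is
  null-homotopic, so its integral is 0.\<close>

lemma potential:
  assumes sc: "triangle_complex_simply_connected V E"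
    and anti: "\<And>u v. E u v \<Longrightarrow> f v u = - f u v"
    and tri: "\<And>u v w. E u v \<Longrightarrow> E v w \<Longrightarrow> E u w \<Longrightarrow> f u v + f v w = f u w"
  obtains \<psi> :: "'a \<Rightarrow> int" where "\<And>u v. E u v \<Longrightarrow> f u v = \<psi> v - \<psi> u"
proof -
  obtain v0 where v0: "v0 \<in> V" using conn unfolding connected_graph_def by blast
  define P where "P v = (SOME p. walk V E p \<and> hd p = v0 \<and> last p = v)" for v
  have P: "walk V E (P v)" "hd (P v) = v0" "last (P v) = v" if "v \<in> V" for v
  proof -
    have "\<exists>p. walk V E p \<and> hd p = v0 \<and> last p = v" using conn v0 that unfolding connected_graph_def by blast
    from someI_ex[OF this] show "walk V E (P v)" "hd (P v) = v0" "last (P v) = v" unfolding P_def by blast+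
  qed
  have "f u v = path_sum f (P v) - path_sum f (P u)" if uv: "E u v" for u v
  proof -
    have V: "u \<in> V" "v \<in> V" using inV uv by blast+
    note Pu = P[OF V(1)] and Pv = P[OF V(2)]
    have ne: "P u \<noteq> []" "P v \<noteq> []" using Pu Pv walk_not_Nil by blast+
    obtain p where p: "P u = p @ [u]" using ne Pu(3) append_butlast_last_id by metis
    obtain q where q: "rev (P v) = v # q" using ne Pv(3) by (metis hd_rev list.exhaust_sel rev_is_Nil_conv)
    have rq: "walk V E (v # q)" using walk_rev[OF sym Pv(1)] q by simp
    have w: "walk V E (P u @ v # q)" using walk_append[OF Pu(1), of "v # q"] Pu(3) uv V rq by simp
    have "last (P u @ v # q) = last (rev (P v))" using q by simp
    also have "\<dots> = v0" using ne Pv(2) by (simp add: last_rev)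
    finally have "hd (P u @ v # q) = last (P u @ v # q)" using ne Pu(2) by simp
    then have "P u @ v # q \<simeq> [hd (P u @ v # q)]"
      using sc w unfolding triangle_complex_simply_connected_def by blast
    then have "path_sum f (P u @ v # q) = 0" using path_sum_homotopic[OF anti tri] by fastforce
    moreover have "path_sum f (P u @ v # q) = path_sum f (P u) + f u v + path_sum f (v # q)"
      using path_sum_append[of f p u "v # q"] p by simp
    moreover have "path_sum f (v # q) = - path_sum f (P v)" using path_sum_rev[OF anti Pv(1)] q by simp
    ultimately show ?thesis by simp
  qed
  then show ?thesis by (rule that)
qed

lemma simply_connected_not_product:
  assumes sc: "triangle_complex_simply_connected V E"
  shows "\<not> is_cartesian_product V E"
proof
  assume "is_cartesian_product V E"
  then obtain V1 V2 :: "'a set" and E1 E2 h where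
    g: "graph V1 E1" "graph V2 E2" and nt: "nontrivial_set V1" "nontrivial_set V2"
    and bij: "bij_betw h V (V1 \<times> V2)" and adj: "\<And>x y. x \<in> V \<Longrightarrow> y \<in> V \<Longrightarrow> E x y \<longleftrightarrow> cprod_adj E1 E2 (h x) (h y)"
    unfolding is_cartesian_product_def by blast
  interpret G1: cgraph V1 E1 by unfold_locales (rule g)
  interpret G2: cgraph V2 E2 by unfold_locales (rule g)
  obtain a b where ab: "E1 a b" using G1.connected_edge[OF nt(1)] by blast
  obtain c e where ce: "E2 c e" using G2.connected_edge[OF nt(2)] by blast
  \<comment> \<open>In the layer of \<open>e\<close>, \<open>f\<close> is the coboundary of the
    indicator of \<open>b\<close>; elsewhere it is 0. A triangle of a product varies in one
    coordinate only, so \<open>f\<close> is a cocycle, but around the square over the edges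
    \<open>ab\<close> and \<open>ce\<close> it sums to -1.\<close>
  define f :: "'a \<Rightarrow> 'a \<Rightarrow> int" where
    "f u v = (if snd (h u) = e \<and> snd (h v) = e then of_bool (fst (h v) = b) - of_bool (fst (h u) = b) else 0)" for u v
  have anti: "f v u = - f u v" for u v unfolding f_def by auto
  have tri: "f u v + f v w = f u w" if "E u v" "E v w" "E u w" for u v w
  proof -
    have "cprod_adj E1 E2 (h u) (h v)" "cprod_adj E1 E2 (h v) (h w)" "cprod_adj E1 E2 (h u) (h w)"
      using adj inV that by blast+
    then have "fst (h u) = fst (h v) \<and> fst (h v) = fst (h w) \<or> snd (h u) = snd (h v) \<and> snd (h v) = snd (h w)"
      unfolding cprod_adj_def using G1.irrefl G2.irrefl by metis
    then show ?thesis unfolding f_def by auto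
  qed
  obtain \<psi> where \<psi>: "\<And>u v. E u v \<Longrightarrow> f u v = \<psi> v - \<psi> u" using potential[OF sc, of f] anti tri by blast
  define k where "k = inv_into V h"
  have k: "k z \<in> V" "h (k z) = z" if "z \<in> V1 \<times> V2" for z
    using bij that unfolding k_def bij_betw_def by (auto simp: inv_into_into f_inv_into_f)
  have mem: "(a, c) \<in> V1 \<times> V2" "(b, c) \<in> V1 \<times> V2" "(b, e) \<in> V1 \<times> V2" "(a, e) \<in> V1 \<times> V2"
    using G1.inV[OF ab] G2.inV[OF ce] by auto
  note K = k[OF mem(1)] k[OF mem(2)] k[OF mem(3)] k[OF mem(4)]
  have "E (k (a, c)) (k (b, c))" "E (k (b, c)) (k (b, e))" "E (k (b, e)) (k (a, e))" "E (k (a, e)) (k (a, c))"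
    using K adj ab ce G1.sym G2.sym by (auto simp: cprod_adj_def)
  from this[THEN \<psi>] have "f (k (a, c)) (k (b, c)) + f (k (b, c)) (k (b, e)) + f (k (b, e)) (k (a, e)) + f (k (a, e)) (k (a, c)) = 0"
    by simp
  moreover have "a \<noteq> b" "c \<noteq> e" using G1.neq ab G2.neq ce by auto
  ultimately show False using K unfolding f_def by simp
qed

text \<open>If \<open>y\<close> has gate \<open>c\<close> in \<open>C\<close>, an edge that leaves the fiber of \<open>c\<close> outside of \<open>C\<close> closes up, through the two
  gates of its ends, to a cycle which the cocycle \<open>f\<close> shows to be essential.\<close>

lemma simply_connected_gated:
  assumes sc: "triangle_complex_simply_connected V E" and tc: "two_connected V E"
    and C: "gated V E C" "nontrivial_set C"
  shows "C = V"
proof (rule ccontr)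
  assume "C \<noteq> V"
  then obtain y where y: "y \<in> V" "y \<notin> C" using gated_subset[OF C(1)] by blast
  define c where "c = g C y"
  have c: "c \<in> C" "c \<in> V" using gate(1)[OF C(1) y(1)] gate_V[OF C(1) y(1)] c_def by auto
  obtain c1 where c1: "c1 \<in> C" "c1 \<noteq> c" using C(2) unfolding nontrivial_set_def by blast
  then have c1V: "c1 \<in> V" using gated_inV[OF C(1)] by blast
  have "connected_graph (V - {c}) (\<lambda>x y. E x y \<and> x \<noteq> c \<and> y \<noteq> c)" using tc c unfolding two_connected_def by blast
  moreover have "y \<in> V - {c}" "c1 \<in> V - {c}" using y c c1 c1V by auto
  moreover have "y \<in> {x. g C x = c}" "c1 \<notin> {x. g C x = c}" using c_def gate_in[OF C(1) c1(1)] c1 by auto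
  \<comment> \<open>Two-connectedness is used here: a path from \<open>y\<close> to
    \<open>c1\<close> that avoids \<open>c\<close> leaves the fiber of \<open>c\<close> by an edge,
    and that edge misses \<open>C\<close>.\<close>
  ultimately obtain s t where st: "g C s = c" "g C t \<noteq> c" "E s t" "s \<noteq> c" "t \<noteq> c"
    using crossing_edge[of "V - {c}" _ y c1 "{x. g C x = c}"] by blast
  have stV: "s \<in> V" "t \<in> V" using inV st by auto
  have nC: "s \<notin> C" "t \<notin> C"
  proof -
    show s: "s \<notin> C" using st gate_in[OF C(1), of s] by auto
    show "t \<notin> C" using s st gate_in[OF C(1), of t] gate_neighbor[OF C(1) s _ st(3)] by auto
  qed
  \<comment> \<open>The coboundary of the indicator of the fiber of \<open>c\<close>, with edges
    meeting \<open>C\<close> set to 0. It stays a cocycle because an edge with exactly one end in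
    \<open>C\<close> joins vertices with the same gate.\<close>
  define f :: "'a \<Rightarrow> 'a \<Rightarrow> int" where
    "f u v = (if u \<notin> C \<and> v \<notin> C then of_bool (g C v = c) - of_bool (g C u = c) else 0)" for u v
  have anti: "f v u = - f u v" for u v unfolding f_def by auto
  have nb: "g C u = g C v" if "E u v" "(u \<in> C) \<noteq> (v \<in> C)" for u v
    using that gate_in[OF C(1)] gate_neighbor[OF C(1), of u v] gate_neighbor[OF C(1), of v u] sym by metis
  have tri: "f u v + f v w = f u w" if "E u v" "E v w" "E u w" for u v w
    using nb[OF that(1)] nb[OF that(2)] nb[OF that(3)] unfolding f_def by (auto split: if_splits)
  obtain \<psi> where \<psi>: "\<And>u v. E u v \<Longrightarrow> f u v = \<psi> v - \<psi> u" using potential[OF sc, of f] anti tri by blast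
  \<comment> \<open>\<open>f\<close> vanishes within each fiber, so a potential is constant along a
    geodesic to the gate. Within \<open>C\<close> it is constant along edges as well, which forces
    \<open>f s t = 0\<close>.\<close>
  have zero: "\<psi> x = \<psi> (g C x)" if "x \<in> V" for x
    using that
  proof (induction "d (g C x) x" arbitrary: x)
    case 0
    then show ?case using d_0[OF gate_V[OF C(1)], of x x] by auto
  next
    case (Suc n)
    note gV = gate_V[OF C(1) Suc(3)]
    obtain w where w: "w \<in> V" "E w x" "d (g C x) w = n" using d_pred[OF gV Suc(3) Suc(2)[symmetric]] .
    have "d x w = 1" "d w (g C x) = n" "d x (g C x) = Suc n"
      using d_edge[OF sym[OF w(2)]] d_sym w gV Suc by auto
    then have gw: "g C w = g C x" using gate_on_geodesic[OF C(1) Suc(3) w(1)] by simp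
    then have "f w x = 0" unfolding f_def by simp
    then show ?case using Suc(1)[of w] w gw \<psi>[OF w(2)] by simp
  qed
  have "E (g C s) (g C t)" using gate_edge[OF C(1) st(3)] st by auto
  moreover have "f (g C s) (g C t) = 0" using gate(1)[OF C(1)] stV unfolding f_def by simp
  ultimately have "\<psi> (g C s) = \<psi> (g C t)" using \<psi> by force
  then have "f s t = 0" using \<psi>[OF st(3)] zero stV by simp
  then show False using st nC unfolding f_def by simp
qed

text \<open>The intersection of the two parts of an amalgam is gated: if nontrivial it would be
  everything, and if a single vertex it would be a cut vertex.\<close>

lemma simply_connected_prime:
  assumes sc: "triangle_complex_simply_connected V E" and tc: "two_connected V E"
  shows "prime_graph V E"
proof -
  have "\<not> is_gated_amalgam V E"
  proof
    assume "is_gated_amalgam V E"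
    then obtain A B where A: "gated V E A" and B: "gated V E B" and ne: "A \<noteq> V" "B \<noteq> V" "A \<inter> B \<noteq> {}"
      and U: "A \<union> B = V" and e: "\<And>x y. E x y \<Longrightarrow> x \<in> A \<and> y \<in> A \<or> x \<in> B \<and> y \<in> B"
      unfolding is_gated_amalgam_def by blast
    have C: "gated V E (A \<inter> B)" using gated_Int A B ne by blast
    show False
    proof (cases "nontrivial_set (A \<inter> B)")
      case True
      then have "A \<inter> B = V" using simply_connected_gated[OF sc tc C] by blast
      then show ?thesis using ne U by blast
    next
      case False
      then obtain c where c: "A \<inter> B = {c}" using ne unfolding nontrivial_set_def by blast
      obtain a b where ab: "a \<in> V" "a \<notin> B" "b \<in> V" "b \<notin> A" using ne U by blast
      have cV: "c \<in> V" using c U by blast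
      have "connected_graph (V - {c}) (\<lambda>x y. E x y \<and> x \<noteq> c \<and> y \<noteq> c)" using tc cV unfolding two_connected_def by blast
      moreover have "a \<in> V - {c}" "b \<in> V - {c}" "a \<in> A" "b \<notin> A" using ab c U by auto
      ultimately obtain s t where "s \<in> A" "t \<notin> A" "E s t" "s \<noteq> c"
        using crossing_edge[of "V - {c}" _ a b A] by blast
      then show ?thesis using e c by blast
    qed
  qed
  then show ?thesis
    using simply_connected_not_product[OF sc] tc unfolding prime_graph_def two_connected_def by blast
qed

end

section \<open>The universal cover of a locally weakly modular graph\<close>

text \<open>A node of level \<open>n\<close> of the universal cover based at \<open>v0\<close> is represented by a reversed path of length \<open>n\<close>
  from \<open>v0\<close>; its head is the image of the node under the covering map. A node \<open>z # Q\<close> of level \<open>n + 1\<close> stands for the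
  class of all pairs \<open>(Q', z)\<close> where \<open>z\<close> is a neighbor of the end of \<open>Q'\<close> not seen below \<open>Q'\<close>, two such pairs being
  identified when \<open>Q'\<close> and \<open>Q\<close> coincide or have a common lower neighbor. The second component of the tower
  is the set of lower neighbors of a node.\<close>

definition free_end :: "('a \<Rightarrow> 'a \<Rightarrow> bool) \<Rightarrow> ('a list \<Rightarrow> 'a list set) \<Rightarrow> 'a list \<Rightarrow> 'a \<Rightarrow> bool" where
  "free_end E D Q z \<longleftrightarrow> E (hd Q) z \<and> (\<forall>C\<in>D Q. z \<noteq> hd C \<and> \<not> E z (hd C))"

definition end_class :: "('a \<Rightarrow> 'a \<Rightarrow> bool) \<Rightarrow> 'a list set \<Rightarrow> ('a list \<Rightarrow> 'a list set) \<Rightarrow> 'a list \<Rightarrow> 'a \<Rightarrow> 'a list set" where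
  "end_class E N D Q z = {Q' \<in> N. free_end E D Q' z \<and> (Q' = Q \<or> D Q' \<inter> D Q \<noteq> {})}"

primrec tower :: "('a \<Rightarrow> 'a \<Rightarrow> bool) \<Rightarrow> 'a \<Rightarrow> nat \<Rightarrow> 'a list set \<times> ('a list \<Rightarrow> 'a list set)" where
  "tower E v0 0 = ({[v0]}, \<lambda>_. {})"
| "tower E v0 (Suc n) = (let (N, D) = tower E v0 n in
     ({z # (SOME Q'. Q' \<in> end_class E N D Q z) | Q z. Q \<in> N \<and> free_end E D Q z},
      \<lambda>P. end_class E N D (tl P) (hd P)))"

locale lwmgraph = cgraph +
  fixes v0 :: 'a
  assumes lwm: "locally_weakly_modular V E" and v0: "v0 \<in> V"
begin

lemma ltc:
  assumes "E v w" "d u v = 2" "d u w = 2" "u \<in> V"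
  obtains x where "E x u" "E x v" "E x w"
  using lwm assms inV[OF assms(1)] unfolding locally_weakly_modular_def by blast

lemma lqc:
  assumes "E z v" "E z w" "d v w = 2" "d u v = 2" "d u w = 2" "d u z = 3" "u \<in> V"
  obtains x where "E x u" "E x v" "E x w"
  using lwm assms inV[OF assms(1)] inV[OF assms(2)] unfolding locally_weakly_modular_def by blast

definition N :: "nat \<Rightarrow> 'a list set" where "N n = fst (tower E v0 n)"
definition D :: "nat \<Rightarrow> 'a list \<Rightarrow> 'a list set" where "D n = snd (tower E v0 n)"

abbreviation "free n \<equiv> free_end E (D n)"

lemma N_0: "N 0 = {[v0]}" and D_0: "D 0 P = {}"
  unfolding N_def D_def by simp_all

lemma N_Suc: "N (Suc n) = {z # (SOME Q'. Q' \<in> end_class E (N n) (D n) Q z) | Q z. Q \<in> N n \<and> free n Q z}"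
  and D_Suc: "D (Suc n) P = end_class E (N n) (D n) (tl P) (hd P)"
  unfolding N_def D_def by (simp_all add: case_prod_unfold Let_def)

lemma free_adj: "free n Q z \<Longrightarrow> E (hd Q) z"
  unfolding free_end_def by blast

lemma D_free: "Q \<in> D (Suc n) P \<Longrightarrow> free n Q (hd P)" and D_N: "Q \<in> D (Suc n) P \<Longrightarrow> Q \<in> N n"
  unfolding D_Suc end_class_def by blast+

lemma D_adj: "Q \<in> D (Suc n) P \<Longrightarrow> E (hd Q) (hd P)"
  using D_free free_adj by blast

lemma D_D: "Q \<in> D (Suc n) P \<Longrightarrow> C \<in> D n Q \<Longrightarrow> hd P \<noteq> hd C \<and> \<not> E (hd P) (hd C)"
  using D_free unfolding free_end_def by blast

lemma N_inV: "P \<in> N n \<Longrightarrow> hd P \<in> V"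
proof (cases n)
  case 0
  then show "P \<in> N n \<Longrightarrow> hd P \<in> V" using N_0 v0 by simp
next
  case (Suc m)
  assume "P \<in> N n"
  then obtain Q z R where "P = z # R" "free m Q z" using N_Suc Suc by blast
  then show "hd P \<in> V" using free_adj inV by fastforce
qed

text \<open>The node stores a chosen member of the class rather than \<open>Q\<close>; by symmetry
  of the identification, \<open>Q\<close> is still among its lower neighbors.\<close>

lemma extend:
  assumes "Q \<in> N n" "free n Q z"
  obtains P where "P \<in> N (Suc n)" "hd P = z" "Q \<in> D (Suc n) P"
proof -
  define R where "R = (SOME Q'. Q' \<in> end_class E (N n) (D n) Q z)"
  have "Q \<in> end_class E (N n) (D n) Q z" using assms unfolding end_class_def by blast
  then have "R \<in> end_class E (N n) (D n) Q z" unfolding R_def by (rule someI)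
  then have "Q \<in> end_class E (N n) (D n) R z" using assms unfolding end_class_def by auto
  then have "Q \<in> D (Suc n) (z # R)" unfolding D_Suc by simp
  moreover have "z # R \<in> N (Suc n)" using assms unfolding N_Suc R_def by blast
  ultimately show ?thesis using that by simp
qed

text \<open>Transitivity of the identification of pairs over level \<open>n\<close>, from which all properties of level \<open>n + 1\<close> follow.\<close>

definition trans_at :: "nat \<Rightarrow> bool" where
  "trans_at n \<longleftrightarrow> (\<forall>z. \<forall>Q1\<in>N n. \<forall>Q2\<in>N n. \<forall>Q3\<in>N n. free n Q1 z \<and> free n Q2 z \<and> free n Q3 z \<and>
     D n Q1 \<inter> D n Q2 \<noteq> {} \<and> D n Q2 \<inter> D n Q3 \<noteq> {} \<longrightarrow> Q1 = Q3 \<or> D n Q1 \<inter> D n Q3 \<noteq> {})"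

lemma end_class_eq:
  assumes tr: "trans_at n" and Q: "Q \<in> N n" "free n Q z" "R \<in> end_class E (N n) (D n) Q z"
  shows "end_class E (N n) (D n) R z = end_class E (N n) (D n) Q z"
proof -
  have R: "R \<in> N n" "free n R z" "R = Q \<or> D n R \<inter> D n Q \<noteq> {}" using Q(3) unfolding end_class_def by auto
  have *: "S = Q' \<or> D n S \<inter> D n Q' \<noteq> {}"
    if S: "S \<in> N n" "free n S z" and SR: "S = R' \<or> D n S \<inter> D n R' \<noteq> {}" and R': "R' \<in> N n" "free n R' z"
      and RQ: "R' = Q' \<or> D n R' \<inter> D n Q' \<noteq> {}" and Q': "Q' \<in> N n" "free n Q' z" for S R' Q'
  proof -
    consider "S = R'" | "R' = Q'" | "D n S \<inter> D n R' \<noteq> {}" "D n R' \<inter> D n Q' \<noteq> {}" using SR RQ by argo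
    then show ?thesis
    proof cases
      case 3
      have "free n S z \<and> free n R' z \<and> free n Q' z \<and> D n S \<inter> D n R' \<noteq> {} \<and> D n R' \<inter> D n Q' \<noteq> {}"
        using S R' Q' 3 by simp
      then show ?thesis by (rule tr[unfolded trans_at_def, rule_format, OF S(1) R'(1) Q'(1)])
    qed (use SR RQ in simp_all)
  qed
  have "S \<in> end_class E (N n) (D n) R z \<longleftrightarrow> S \<in> end_class E (N n) (D n) Q z" for S
    using *[of S R Q] *[of S Q R] R Q(1,2) unfolding end_class_def by (auto simp: Int_commute)
  then show ?thesis by blast
qed

lemma N_SucE:
  assumes tr: "trans_at n" and P: "P \<in> N (Suc n)"
  obtains Q z where "Q \<in> N n" "free n Q z" "P = z # (SOME Q'. Q' \<in> end_class E (N n) (D n) Q z)"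
    "D (Suc n) P = end_class E (N n) (D n) Q z"
proof -
  obtain Q z where Q: "Q \<in> N n" "free n Q z" "P = z # (SOME Q'. Q' \<in> end_class E (N n) (D n) Q z)"
    using P unfolding N_Suc by blast
  have "Q \<in> end_class E (N n) (D n) Q z" using Q unfolding end_class_def by blast
  then have "(SOME Q'. Q' \<in> end_class E (N n) (D n) Q z) \<in> end_class E (N n) (D n) Q z" by (rule someI)
  then have "D (Suc n) P = end_class E (N n) (D n) Q z" using end_class_eq[OF tr Q(1,2)] Q(3) unfolding D_Suc by simp
  then show ?thesis using that Q by blast
qed

lemma D_nonempty:
  assumes "trans_at n" "P \<in> N (Suc n)" obtains Q where "Q \<in> D (Suc n) P"
proof -
  obtain Q z where "Q \<in> N n" "free n Q z" "D (Suc n) P = end_class E (N n) (D n) Q z"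
    using N_SucE[OF assms] .
  then show ?thesis using that unfolding end_class_def by blast
qed

lemma D_class:
  assumes tr: "trans_at n" and P: "P \<in> N (Suc n)" and Q: "Q \<in> D (Suc n) P"
  shows "D (Suc n) P = end_class E (N n) (D n) Q (hd P)"
proof -
  obtain Q0 z where Q0: "Q0 \<in> N n" "free n Q0 z" "P = z # (SOME Q'. Q' \<in> end_class E (N n) (D n) Q0 z)"
    "D (Suc n) P = end_class E (N n) (D n) Q0 z" using N_SucE[OF tr P] .
  then show ?thesis using end_class_eq[OF tr Q0(1,2), of Q] Q by simp
qed

lemma D_common:
  assumes "trans_at n" "P \<in> N (Suc n)" "Q \<in> D (Suc n) P" "Q' \<in> D (Suc n) P" "Q \<noteq> Q'"
  obtains C where "C \<in> D n Q" "C \<in> D n Q'"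
  using D_class[OF assms(1-3)] assms(4,5) unfolding end_class_def by auto

lemma D_closed:
  assumes "trans_at n" "P \<in> N (Suc n)" "Q \<in> D (Suc n) P" "Q' \<in> N n" "free n Q' (hd P)" "C \<in> D n Q" "C \<in> D n Q'"
  shows "Q' \<in> D (Suc n) P"
  using D_class[OF assms(1-3)] assms(4-7) unfolding end_class_def by auto

text \<open>Equal classes have the same chosen representative, so equality of lists is equality in
  the quotient.\<close>

lemma node_unique:
  assumes tr: "trans_at n" and P: "P \<in> N (Suc n)" "P' \<in> N (Suc n)" "hd P = hd P'" "Q \<in> D (Suc n) P" "Q \<in> D (Suc n) P'"
  shows "P = P'"
proof -
  obtain Q1 z1 where 1: "P = z1 # (SOME Q'. Q' \<in> end_class E (N n) (D n) Q1 z1)"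
    "D (Suc n) P = end_class E (N n) (D n) Q1 z1" using N_SucE[OF tr P(1)] .
  obtain Q2 z2 where 2: "P' = z2 # (SOME Q'. Q' \<in> end_class E (N n) (D n) Q2 z2)"
    "D (Suc n) P' = end_class E (N n) (D n) Q2 z2" using N_SucE[OF tr P(2)] .
  have "D (Suc n) P = D (Suc n) P'" using D_class[OF tr P(1,4)] D_class[OF tr P(2,5)] P(3) by simp
  then show ?thesis using 1 2 P(3) by simp
qed

text \<open>Transitivity below \<open>n\<close> governs the nodes of levels up to \<open>n\<close>,
  since \<open>trans_at m\<close> speaks about the formation of level \<open>m + 1\<close>.\<close>

definition stage :: "nat \<Rightarrow> bool" where
  "stage n \<longleftrightarrow> (\<forall>m<n. trans_at m)"

lemma stageD: "stage n \<Longrightarrow> m < n \<Longrightarrow> trans_at m"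
  unfolding stage_def by blast

lemma D_dist2:
  assumes "P \<in> N (Suc (Suc n))" "Q \<in> D (Suc (Suc n)) P" "C \<in> D (Suc n) Q"
  shows "d (hd C) (hd P) = 2"
  using d_2I[OF D_adj[OF assms(3)] D_adj[OF assms(2)]] D_D[OF assms(2,3)] sym by metis

text \<open>A smaller distance would give, at the latest by the local triangle condition, a neighbor
  of \<open>hd A\<close> and \<open>hd C\<close> equal or adjacent to \<open>q\<close>; its lift
  below \<open>C\<close> contradicts freeness. Taking the lifting as hypothesis lets
  \<open>lift_common_neighbor\<close> feed in its own induction hypothesis.\<close>

lemma far_of_lift:
  assumes C: "C \<in> N (Suc (Suc n))" "B \<in> D (Suc (Suc n)) C" "A \<in> D (Suc n) B" and q: "free (Suc (Suc n)) C q"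
    and lift: "\<And>x. E x (hd A) \<Longrightarrow> E x (hd C) \<Longrightarrow> \<exists>X\<in>D (Suc (Suc n)) C. hd X = x"
  shows "d (hd A) q = 3"
proof -
  have AV: "hd A \<in> V" using D_adj[OF C(3)] inV by blast
  have qV: "q \<in> V" and cq: "E (hd C) q" using free_adj[OF q] inV by blast+
  have ac: "d (hd A) (hd C) = 2" using D_dist2[OF C] .
  have fr: "q \<noteq> hd X \<and> \<not> E q (hd X)" if "X \<in> D (Suc (Suc n)) C" for X
    using q that unfolding free_end_def by blast
  have "d (hd A) q \<noteq> 0" using d_0[OF AV qV] ac d_edge[OF sym[OF cq]] by auto
  moreover have "d (hd A) q \<noteq> 1"
  proof
    assume "d (hd A) q = 1"
    then have "E q (hd A)" using d_1[OF AV qV] sym by simp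
    then show False using lift[OF _ sym[OF cq]] fr by blast
  qed
  moreover have "d (hd A) q \<noteq> 2"
  proof
    assume "d (hd A) q = 2"
    then obtain x where "E x (hd A)" "E x (hd C)" "E x q" using ltc[OF cq ac _ AV] by blast
    then show False using lift fr sym by blast
  qed
  moreover have "d (hd A) q \<le> 3" using d_step[OF AV cq] ac by simp
  ultimately show ?thesis by linarith
qed

text \<open>\<open>x\<close> is shown free over \<open>B\<close>, giving a node \<open>X\<close>,
  and \<open>hd Q\<close> free over \<open>X\<close>. As \<open>X\<close> and \<open>C\<close> share
  the lower neighbor \<open>B\<close>, \<open>X\<close> belongs to the class of \<open>C\<close>
  below \<open>Q\<close>.\<close>

lemma lift_common_neighbor:
  assumes "stage (Suc (Suc n))" and Q: "Q \<in> N (Suc (Suc n))" "C \<in> D (Suc (Suc n)) Q" "B \<in> D (Suc n) C"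
    and x: "E x (hd B)" "E x (hd Q)"
  obtains X where "X \<in> D (Suc (Suc n)) Q" "hd X = x" "B \<in> D (Suc n) X"
proof -
  have "\<exists>X\<in>D (Suc (Suc n)) Q. hd X = x \<and> B \<in> D (Suc n) X"
    using assms
  proof (induction n arbitrary: Q C B x)
    case (0 Q C B x)
    have trs: "trans_at 0" "trans_at (Suc 0)" using 0(1) by (auto intro: stageD)
    have B: "B \<in> N 0" using D_N 0 by blast
    have "free 0 B x" using 0 sym unfolding free_end_def D_0 by blast
    then obtain X where X: "X \<in> N (Suc 0)" "hd X = x" "B \<in> D (Suc 0) X" using extend[OF B] by blast
    \<comment> \<open>Level 0 consists of the root alone.\<close>
    have "hd B' = hd B" if "B' \<in> D (Suc 0) X" for B' using D_N[OF that] B N_0 by simp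
    then have "hd Q \<noteq> hd B' \<and> \<not> E (hd Q) (hd B')" if "B' \<in> D (Suc 0) X" for B'
      using D_D[OF 0(3,4)] that by simp
    moreover have "E (hd X) (hd Q)" using X(2) 0(6) by simp
    ultimately have "free (Suc 0) X (hd Q)" unfolding free_end_def by blast
    then show ?case using D_closed[OF trs(2) 0(2,3) X(1) _ 0(4) X(3)] X by blast
  next
    case (Suc m Q C B x)
    define n where "n = Suc m"
    note IH = Suc(1) and st = Suc(2) and Q = Suc(3-5)[folded n_def] and x = Suc(6,7)
    have trs: "trans_at n" "trans_at (Suc n)" using st n_def by (auto intro: stageD)
    have st': "stage (Suc (Suc m))" using st unfolding stage_def by auto
    have far: "d (hd A) (hd Q) = 3" if A: "A \<in> D n B" for A
    proof (rule far_of_lift)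
      show "C \<in> N (Suc (Suc m))" "B \<in> D (Suc (Suc m)) C" "A \<in> D (Suc m) B" "free (Suc (Suc m)) C (hd Q)"
        using D_N[OF Q(2)] D_free[OF Q(2)] Q A unfolding n_def by auto
      fix x assume "E x (hd A)" "E x (hd C)"
      then show "\<exists>X\<in>D (Suc (Suc m)) C. hd X = x"
        using IH[OF st', of C B A x] D_N[OF Q(2)] Q A unfolding n_def by blast
    qed
    \<comment> \<open>Each way in which freeness could fail puts \<open>hd Q\<close> within distance
      two of some \<open>hd A\<close> below \<open>B\<close>, contradicting
      \<open>far\<close>.\<close>
    have near: "d (hd A) (hd Q) < 3" if "E (hd Q) y" "E y (hd A) \<or> y = hd A" "A \<in> N m" for A y
    proof -
      have AV: "hd A \<in> V" using N_inV[OF that(3)] .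
      have "d (hd A) y \<le> 1" using that(2) d_edge[of "hd A" y] AV sym by auto
      then show ?thesis using d_step[OF AV sym[OF that(1)]] by simp
    qed
    have freeB: "free n B x" unfolding free_end_def
    proof (intro conjI ballI)
      fix A assume A: "A \<in> D n B"
      then have "A \<in> N m" using D_N n_def by simp
      then show "x \<noteq> hd A" "\<not> E x (hd A)" using near[of x A] far[OF A] x sym by auto
    qed (use x sym in blast)
    obtain X where X: "X \<in> N (Suc n)" "hd X = x" "B \<in> D (Suc n) X" using extend[OF D_N[OF Q(3)] freeB] .
    have "hd Q \<noteq> hd B' \<and> \<not> E (hd Q) (hd B')" if B': "B' \<in> D (Suc n) X" for B'
    proof (cases "B' = B")
      case True
      then show ?thesis using D_D[OF Q(2,3)] by simp
    next
      case False
      obtain A where A: "A \<in> D n B" "A \<in> D n B'" using D_common[OF trs(1) X(1,3) B'] False by blast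
      have "A \<in> N m" "E (hd B') (hd A)" using A D_N D_adj sym unfolding n_def by blast+
      moreover have "hd Q \<noteq> hd B'"
      proof
        assume "hd Q = hd B'"
        then have "E (hd Q) (hd A)" using \<open>E (hd B') (hd A)\<close> by simp
        then show False using near[of "hd A" A] \<open>A \<in> N m\<close> far[OF A(1)] by simp
      qed
      ultimately show ?thesis using near[of "hd B'" A] far[OF A(1)] by auto
    qed
    then have "free (Suc n) X (hd Q)" using X x sym unfolding free_end_def by blast
    then show ?case using D_closed[OF trs(2) Q(1,2) X(1) _ Q(3) X(3)] X unfolding n_def by blast
  qed
  then show ?thesis using that by blast
qed

lemma free_far:
  assumes "stage (Suc (Suc n))" "C \<in> N (Suc (Suc n))" "B \<in> D (Suc (Suc n)) C" "A \<in> D (Suc n) B" "free (Suc (Suc n)) C q"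
  shows "d (hd A) q = 3"
  using far_of_lift[OF assms(2-5)] lift_common_neighbor[OF assms(1-4)] by metis

text \<open>Below \<open>C1\<close> and \<open>C2\<close> there is a common \<open>B\<close>, at
  distance three from \<open>z\<close> and two from both outer ends. The local triangle or
  quadrangle condition gives a common neighbor \<open>x\<close>, whose lifts below \<open>Q1\<close>
  and \<open>Q3\<close> both lie over \<open>B\<close> and hence coincide.\<close>

lemma stage_Suc:
  assumes st: "stage n" shows "trans_at n"
  unfolding trans_at_def
proof (intro allI ballI impI)
  fix z Q1 Q2 Q3
  assume Q: "Q1 \<in> N n" "Q2 \<in> N n" "Q3 \<in> N n"
    and *: "free n Q1 z \<and> free n Q2 z \<and> free n Q3 z \<and> D n Q1 \<inter> D n Q2 \<noteq> {} \<and> D n Q2 \<inter> D n Q3 \<noteq> {}"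
  obtain C1 C2 where C: "C1 \<in> D n Q1" "C1 \<in> D n Q2" "C2 \<in> D n Q2" "C2 \<in> D n Q3" using * by blast
  show "Q1 = Q3 \<or> D n Q1 \<inter> D n Q3 \<noteq> {}"
  proof (cases "C1 = C2")
    case True
    then show ?thesis using C by blast
  next
    case False
    obtain m where m: "n = Suc m" using C D_0 by (cases n) auto
    have "C1 \<in> N m" "C2 \<in> N m" using C D_N m by blast+
    then obtain k where k: "m = Suc k" using False N_0 by (cases m) auto
    note n = m[unfolded k]
    have trs: "trans_at k" "trans_at (Suc k)" using st n by (auto intro: stageD)
    obtain B where B: "B \<in> D (Suc k) C1" "B \<in> D (Suc k) C2"
      using D_common[OF trs(2), of Q2 C1 C2] C Q False n by auto
    have bz: "d (hd B) z = 3" using free_far[of k Q2 C1 B z] st Q C B * n by simp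
    have bq: "d (hd B) (hd Q1) = 2" "d (hd B) (hd Q3) = 2"
      using D_dist2[of Q1 k C1 B] D_dist2[of Q3 k C2 B] Q C B n by auto
    have BV: "hd B \<in> V" using D_adj[OF B(1)] inV by blast
    have zq: "E z (hd Q1)" "E z (hd Q3)" using * free_adj sym by blast+
    have "\<exists>x. E x (hd B) \<and> E x (hd Q1) \<and> E x (hd Q3)"
    proof -
      consider "hd Q1 = hd Q3" | "E (hd Q1) (hd Q3)" | "d (hd Q1) (hd Q3) = 2"
        using d_2I[OF sym[OF zq(1)] zq(2)] by blast
      then show ?thesis
      proof cases
        case 1
        then show ?thesis using D_adj[OF B(1)] D_adj[of C1 m Q1] C(1) m sym by auto
      next
        case 2
        then show ?thesis using ltc[OF 2 bq BV] by metis
      next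
        case 3
        then show ?thesis using lqc[OF zq 3 bq bz BV] by metis
      qed
    qed
    then obtain x where x: "E x (hd B)" "E x (hd Q1)" "E x (hd Q3)" by blast
    obtain X1 where X1: "X1 \<in> D n Q1" "hd X1 = x" "B \<in> D (Suc k) X1"
      using lift_common_neighbor[of k Q1 C1 B x] st Q C B x n by auto
    obtain X3 where X3: "X3 \<in> D n Q3" "hd X3 = x" "B \<in> D (Suc k) X3"
      using lift_common_neighbor[of k Q3 C2 B x] st Q C B x n by auto
    have "X1 = X3" using node_unique[OF trs(1), of X1 X3 B] X1 X3 D_N m k by auto
    then show ?thesis using X1 X3 by blast
  qed
qed

lemma stage: "stage n"
proof (induction n)
  case 0 then show ?case unfolding stage_def by simp
next
  case (Suc n)
  then show ?case using stage_Suc[OF Suc] unfolding stage_def by (auto simp: less_Suc_eq)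
qed

lemma trans_at: "trans_at n"
  using stage_Suc stage by blast

section \<open>The cover as a graph, and the covering property of its end map\<close>

definition node_adj :: "nat \<times> 'a list \<Rightarrow> nat \<times> 'a list \<Rightarrow> bool" where
  "node_adj a b \<longleftrightarrow> snd a \<in> N (fst a) \<and> snd b \<in> N (fst b) \<and>
     (fst b = Suc (fst a) \<and> snd a \<in> D (fst b) (snd b) \<or>
      fst a = Suc (fst b) \<and> snd b \<in> D (fst a) (snd a) \<or>
      fst a = fst b \<and> E (hd (snd a)) (hd (snd b)) \<and> D (fst a) (snd a) \<inter> D (fst b) (snd b) \<noteq> {})"

abbreviation "en a \<equiv> hd (snd a)"

abbreviation "node a \<equiv> snd a \<in> N (fst a)"

lemma node_adj_sym: "node_adj a b \<Longrightarrow> node_adj b a"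
  unfolding node_adj_def using sym by (auto simp: Int_commute)

lemma node_adj_node: "node_adj a b \<Longrightarrow> node a" "node_adj a b \<Longrightarrow> node b"
  unfolding node_adj_def by blast+

lemma node_adj_cases:
  assumes "node_adj (n, P) b"
  obtains (up) Z where "b = (Suc n, Z)" "P \<in> N n" "Z \<in> N (Suc n)" "P \<in> D (Suc n) Z" "free n P (hd Z)"
  | (down) m Z where "n = Suc m" "b = (m, Z)" "P \<in> N (Suc m)" "Z \<in> N m" "Z \<in> D (Suc m) P"
  | (flat) m Z C where "n = Suc m" "b = (Suc m, Z)" "P \<in> N (Suc m)" "Z \<in> N (Suc m)" "E (hd P) (hd Z)"
      "C \<in> D (Suc m) P" "C \<in> D (Suc m) Z" "C \<in> N m"
proof -
  obtain k Z where b: "b = (k, Z)" by (cases b)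
  have N: "P \<in> N n" "Z \<in> N k" using assms unfolding node_adj_def b by auto
  consider "k = Suc n" "P \<in> D (Suc n) Z" | "n = Suc k" "Z \<in> D (Suc k) P"
    | C where "k = n" "E (hd P) (hd Z)" "C \<in> D n P" "C \<in> D n Z"
    using assms unfolding node_adj_def b by auto
  then show ?thesis
  proof cases
    case 1 then show ?thesis using up[of Z] b N D_free by simp
  next
    case 2 then show ?thesis using down[of k Z] b N by simp
  next
    case 3
    then obtain m where "n = Suc m" using D_0 by (cases n) auto
    then show ?thesis using 3 flat[of m Z C] b N D_N by simp
  qed
qed

lemma node_adj_up: "P \<in> N n \<Longrightarrow> Z \<in> N (Suc n) \<Longrightarrow> P \<in> D (Suc n) Z \<Longrightarrow> node_adj (n, P) (Suc n, Z)"
  unfolding node_adj_def by simp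

lemma node_adj_flat:
  "P \<in> N n \<Longrightarrow> Z \<in> N n \<Longrightarrow> E (hd P) (hd Z) \<Longrightarrow> C \<in> D n P \<Longrightarrow> C \<in> D n Z \<Longrightarrow> node_adj (n, P) (n, Z)"
  unfolding node_adj_def by auto

lemma D_SucE: assumes "C \<in> D n P" obtains m where "n = Suc m"
  using assms D_0 by (cases n) auto

text \<open>Local surjectivity. A free \<open>z\<close> lifts upward and the end of a lower neighbor
  downward. Otherwise \<open>z\<close> sees the end of a lower \<open>C\<close>: if free over
  \<open>C\<close> it lifts to a level neighbor, and if not, it is a common neighbor of
  \<open>P\<close> and some \<open>B\<close>, which lifts downward.\<close>

lemma node_adj_exists:
  assumes P: "P \<in> N n" and z: "E (hd P) z"
  obtains b where "node_adj (n, P) b" "en b = z"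
proof (cases "free n P z")
  case True
  obtain Z where "Z \<in> N (Suc n)" "hd Z = z" "P \<in> D (Suc n) Z" using extend[OF P True] .
  then show ?thesis using that[OF node_adj_up[OF P]] by simp
next
  case False
  then obtain C where C: "C \<in> D n P" "z = hd C \<or> E z (hd C)" using z unfolding free_end_def by blast
  obtain m where m: "n = Suc m" using D_SucE[OF C(1)] .
  have down: ?thesis if "Z \<in> D (Suc m) P" "hd Z = z" for Z
    using \<open>\<And>b. node_adj (n, P) b \<Longrightarrow> en b = z \<Longrightarrow> thesis\<close>[of "(m, Z)"]
      node_adj_sym[OF node_adj_up[OF D_N[OF that(1)] _ that(1)]] P m that by simp
  show ?thesis
  proof (cases "z = hd C")
    case True
    then show ?thesis using down C m by blast
  next
    case zC: False
    show ?thesis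
    proof (cases "free m C z")
      case True
      obtain Z where Z: "Z \<in> N (Suc m)" "hd Z = z" "C \<in> D (Suc m) Z" using extend[OF _ True] D_N C m by blast
      then show ?thesis using that[OF node_adj_flat[OF P, of Z C]] z C m by simp
    next
      case False
      then obtain B where B: "B \<in> D m C" "z = hd B \<or> E z (hd B)" using C zC sym unfolding free_end_def by blast
      obtain k where k: "m = Suc k" using D_SucE[OF B(1)] .
      have "z \<noteq> hd B" using D_D[of C m P B] C B m z by auto
      then have "E z (hd B)" using B by blast
      then obtain X where "X \<in> D (Suc (Suc k)) P" "hd X = z"
        using lift_common_neighbor[OF stage, of P k C B z] P C B m k z sym by blast
      then show ?thesis using down k by blast
    qed
  qed
qed

lemma D_unique:
  assumes "Q \<in> D (Suc (Suc k)) P" "Q' \<in> D (Suc (Suc k)) P'" "hd Q = hd Q'" "B \<in> D (Suc k) Q" "B \<in> D (Suc k) Q'"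
  shows "Q = Q'"
  using node_unique[OF trans_at D_N[OF assms(1)] D_N[OF assms(2)] assms(3-5)] .

lemma lift_lower:
  assumes "W \<in> N (Suc (Suc k))" "C \<in> D (Suc (Suc k)) W" "B \<in> D (Suc k) C"
    "Z \<in> D (Suc (Suc k)) P" "B \<in> D (Suc k) Z" "E (hd Z) (hd W)"
  shows "Z \<in> D (Suc (Suc k)) W"
proof -
  obtain X where "X \<in> D (Suc (Suc k)) W" "hd X = hd Z" "B \<in> D (Suc k) X"
    using lift_common_neighbor[OF stage assms(1-3) sym[OF D_adj[OF assms(5)]] assms(6)] .
  then show ?thesis using D_unique[OF _ assms(4)] assms(5) by blast
qed

lemma D_common':
  assumes "P \<in> N (Suc m)" "Q \<in> D (Suc m) P" "Q' \<in> D (Suc m) P" "Q \<noteq> Q'"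
  obtains k B where "m = Suc k" "B \<in> D (Suc k) Q" "B \<in> D (Suc k) Q'"
  using D_common[OF trans_at assms] D_SucE by metis

text \<open>Two lower neighbors \<open>Z\<close>, \<open>C\<close> of \<open>P\<close> share some
  \<open>B\<close>. As \<open>W\<close> is two levels above \<open>B\<close>, its end differs from
  that of \<open>Z\<close>, and adjacency of the ends lifts over \<open>B\<close>.\<close>

lemma down_flat:
  assumes "P \<in> N (Suc m)" "Z \<in> D (Suc m) P" "W \<in> N (Suc m)" "C \<in> D (Suc m) P" "C \<in> D (Suc m) W"
  shows "hd Z \<noteq> hd W" "E (hd Z) (hd W) \<Longrightarrow> Z \<in> D (Suc m) W"
proof -
  show "hd Z \<noteq> hd W"
  proof (cases "Z = C")
    case True
    then show ?thesis using D_adj[OF assms(5)] neq by simp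
  next
    case False
    then obtain k B where B: "m = Suc k" "B \<in> D (Suc k) Z" "B \<in> D (Suc k) C"
      using D_common'[OF assms(1,2,4)] by blast
    then show ?thesis using D_D[OF assms(5), of B] D_adj[OF B(2)] sym by auto
  qed
  show "Z \<in> D (Suc m) W" if "E (hd Z) (hd W)"
  proof (cases "Z = C")
    case False
    then obtain k B where "m = Suc k" "B \<in> D (Suc k) Z" "B \<in> D (Suc k) C"
      using D_common'[OF assms(1,2,4)] by blast
    then show ?thesis using lift_lower[of W k C B Z P] assms that by simp
  qed (use assms in simp)
qed

text \<open>The end of \<open>Z\<close> is three away from every \<open>B\<close> two levels below
  \<open>P\<close>, so no lower neighbor of \<open>W\<close> comes near it: \<open>hd Z\<close> is
  free over \<open>W\<close> too.\<close>

lemma up_flat: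
  assumes "P \<in> N (Suc m)" "Z \<in> N (Suc (Suc m))" "P \<in> D (Suc (Suc m)) Z"
    and W: "W \<in> N (Suc m)" "C \<in> D (Suc m) P" "C \<in> D (Suc m) W" "E (hd Z) (hd W)"
  shows "W \<in> D (Suc (Suc m)) Z"
proof -
  note fr = D_free[OF assms(3)]
  have "hd Z \<noteq> hd C' \<and> \<not> E (hd Z) (hd C')" if C': "C' \<in> D (Suc m) W" for C'
  proof (cases "C' = C")
    case True
    then show ?thesis using D_D[OF assms(3) W(2)] by simp
  next
    case False
    then obtain k B where k: "m = Suc k" and B: "B \<in> D (Suc k) C" "B \<in> D (Suc k) C'"
      using D_common'[OF W(1,3) C'] by blast
    have "d (hd B) (hd Z) = 3" using free_far[OF stage, of P k C B "hd Z"] assms B fr k by simp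
    moreover have "E (hd B) (hd C')" using D_adj[OF B(2)] .
    moreover have "d (hd B) (hd C') = 1" using d_edge[OF D_adj[OF B(2)]] by simp
    moreover have "d (hd B) (hd Z) \<le> Suc (d (hd B) (hd C'))" if "E (hd C') (hd Z)"
      using d_step[OF _ that] inV D_adj[OF B(2)] by blast
    ultimately show ?thesis using sym[of "hd Z" "hd C'"] by auto
  qed
  then have "free (Suc m) W (hd Z)" using W sym unfolding free_end_def by blast
  then show ?thesis using D_closed[OF trans_at assms(2,3) W(1) _ W(2,3)] by blast
qed

text \<open>Local injectivity. By symmetry \<open>b\<close> may be assumed at least as high as
  \<open>c\<close>; the six cases reduce to freeness, \<open>down_flat\<close> and
  \<open>node_unique\<close>.\<close>

lemma node_adj_unique:
  assumes b: "node_adj a b" and c: "node_adj a c" and e: "en b = en c"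
  shows "b = c"
proof -
  obtain n P where a: "a = (n, P)" by (cases a)
  have *: "b = c" if b: "node_adj (n, P) b" and c: "node_adj (n, P) c" and e: "en b = en c" and "fst b \<ge> fst c" for b c
    using b
  proof (cases rule: node_adj_cases)
    case (up Z)
    note u = this
    show ?thesis using c
    proof (cases rule: node_adj_cases)
      case (up Z')
      then show ?thesis using u e node_unique[OF trans_at, of Z n Z' P] by simp
    next
      case (down m Z')
      then show ?thesis using u e unfolding free_end_def by simp
    next
      case (flat m Z' C)
      then show ?thesis using u e sym[OF D_adj[OF flat(7)]] unfolding free_end_def by auto
    qed
  next
    case (down m Z)
    note u = this
    show ?thesis using c
    proof (cases rule: node_adj_cases)
      case (down m' Z')
      have "Z = Z'"
      proof (rule ccontr)
        assume "Z \<noteq> Z'"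
        then obtain k B where k: "m = Suc k" and B: "B \<in> D (Suc k) Z" "B \<in> D (Suc k) Z'"
          using D_common'[of P m Z Z'] u down by auto
        then have "Z = Z'" using D_unique[of Z k P Z' P B] u down e by simp
        then show False using \<open>Z \<noteq> Z'\<close> by simp
      qed
      then show ?thesis using u down by simp
    qed (use u \<open>fst b \<ge> fst c\<close> in auto)
  next
    case (flat m Z C)
    note u = this
    show ?thesis using c
    proof (cases rule: node_adj_cases)
      case (up Z')
      then show ?thesis using u \<open>fst b \<ge> fst c\<close> by simp
    next
      case (down m' Z')
      then show ?thesis using u e down_flat(1)[of P m Z' Z C] by simp
    next
      case (flat m' Z' C')
      have "C' \<in> D (Suc m) Z" using down_flat(2)[of P m C' Z C] D_adj[OF flat(7)] u flat e by simp
      then show ?thesis using node_unique[OF trans_at, of Z m Z' C'] u flat e by simp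
    qed
  qed
  show ?thesis using *[of b c] *[of c b] assms a by (cases "fst b \<ge> fst c") auto
qed

text \<open>With the two preceding properties this makes the end map a covering of triangle
  complexes. The case of two level neighbors is where the local triangle condition is used, to find
  a common lower neighbor.\<close>

lemma node_adj_triangle:
  assumes b: "node_adj a b" and c: "node_adj a c" and e: "E (en b) (en c)"
  shows "node_adj b c"
proof -
  obtain n P where a: "a = (n, P)" by (cases a)
  have *: "node_adj b c" if b: "node_adj (n, P) b" and c: "node_adj (n, P) c" and e: "E (en b) (en c)" and "fst b \<ge> fst c" for b c
    using b
  proof (cases rule: node_adj_cases)
    case (up Z)
    note u = this
    show ?thesis using c
    proof (cases rule: node_adj_cases)
      case (up Z')
      then show ?thesis using u e node_adj_flat[of Z "Suc n" Z' P] by simp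
    next
      case (down m Z')
      then show ?thesis using u e unfolding free_end_def by simp
    next
      case (flat m Z' C)
      then have "Z' \<in> D (Suc n) Z" using up_flat[of P m Z Z' C] u e by simp
      then show ?thesis using node_adj_sym[OF node_adj_up[of Z' n Z]] u flat by simp
    qed
  next
    case (down m Z)
    note u = this
    show ?thesis using c
    proof (cases rule: node_adj_cases)
      case (down m' Z')
      have "Z \<noteq> Z'" using e irrefl u down by auto
      then obtain k B where "m = Suc k" "B \<in> D (Suc k) Z" "B \<in> D (Suc k) Z'"
        using D_common'[of P m Z Z'] u down by auto
      then show ?thesis using node_adj_flat[of Z m Z' B] u down e by simp
    qed (use u \<open>fst b \<ge> fst c\<close> in auto)
  next
    case (flat m Z C)
    note u = this
    show ?thesis using c
    proof (cases rule: node_adj_cases)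
      case (up Z')
      then show ?thesis using u \<open>fst b \<ge> fst c\<close> by simp
    next
      case (down m' Z')
      then have "Z' \<in> D (Suc m) Z" using down_flat(2)[of P m Z' Z C] u e sym by simp
      then show ?thesis using node_adj_sym[OF node_adj_up[of Z' m Z]] u down by simp
    next
      case (flat m' Z' C')
      note v = this
      have "\<exists>X. X \<in> D (Suc m) Z \<and> X \<in> D (Suc m) Z'"
      proof (cases "C = C'")
        case True
        then show ?thesis using u v by auto
      next
        case False
        then obtain k B where k: "m = Suc k" and B: "B \<in> D (Suc k) C" "B \<in> D (Suc k) C'"
          using D_common'[of P m C C'] u v by auto
        have BV: "hd B \<in> V" using D_adj[OF B(1)] inV by blast
        have d2: "d (hd B) (hd Z) = 2" "d (hd B) (hd Z') = 2"
          using D_dist2[of Z k C B] D_dist2[of Z' k C' B] u v k B by simp_all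
        have zz: "E (hd Z) (hd Z')" using e u v by simp
        obtain x where x: "E x (hd B)" "E x (hd Z)" "E x (hd Z')" using ltc[OF zz d2 BV] .
        obtain X where X: "X \<in> D (Suc m) Z" "hd X = x" "B \<in> D (Suc k) X"
          using lift_common_neighbor[OF stage, of Z k C B x] u k B x by auto
        obtain X' where X': "X' \<in> D (Suc m) Z'" "hd X' = x" "B \<in> D (Suc k) X'"
          using lift_common_neighbor[OF stage, of Z' k C' B x] v u k B x by auto
        then have "X = X'" using D_unique[of X k Z X' Z' B] X k by simp
        then show ?thesis using X X' by blast
      qed
      then show ?thesis using node_adj_flat[of Z "Suc m" Z'] u v e by auto
    qed
  qed
  show ?thesis using *[of b c] *[of c b] assms a sym[OF e] node_adj_sym by (cases "fst b \<ge> fst c") auto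
qed

lemma neighbor_over:
  assumes "node a" "E (en a) z"
  obtains b where "node_adj a b" "en b = z"
proof -
  obtain b where "node_adj (fst a, snd a) b" "en b = z" using node_adj_exists[OF assms] .
  then show ?thesis using that by simp
qed

section \<open>Lifting paths and homotopies to the cover\<close>

context
  notes split_paired_Ex [simp del] split_paired_All [simp del]
begin

fun path_lift :: "nat \<times> 'a list \<Rightarrow> 'a list \<Rightarrow> nat \<times> 'a list \<Rightarrow> bool" where
  "path_lift a [] b \<longleftrightarrow> False"
| "path_lift a [x] b \<longleftrightarrow> a = b \<and> node a \<and> en a = x"
| "path_lift a (x # y # p) b \<longleftrightarrow> en a = x \<and> (\<exists>c. node_adj a c \<and> path_lift c (y # p) b)"

lemma path_lift_node: "path_lift a p b \<Longrightarrow> node a \<and> node b \<and> en a = hd p \<and> en b = last p"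
proof (induction a p b rule: path_lift.induct)
  case (3 a x y p b)
  obtain c where c: "en a = x" "node_adj a c" "path_lift c (y # p) b" using 3(2) by auto
  show ?case using 3(1)[OF c(3)] c(1) node_adj_node(1)[OF c(2)] by simp
qed simp_all

lemma path_lift_append: "path_lift a (p @ u # q) b \<longleftrightarrow> (\<exists>c. path_lift a (p @ [u]) c \<and> path_lift c (u # q) b)"
proof (induction p arbitrary: a)
  case Nil
  show ?case using path_lift_node[of a "u # q" b] by auto
next
  case (Cons x p)
  have *: "path_lift c (u # q) b \<Longrightarrow> node c \<and> en c = u" for c using path_lift_node[of c "u # q" b] by simp
  show ?case
  proof (cases p)
    case Nil
    then show ?thesis using * by auto
  next
    case (Cons y r)
    then show ?thesis using Cons.IH by auto
  qed
qed

lemma path_lift_exists: "walk V E p \<Longrightarrow> node a \<Longrightarrow> en a = hd p \<Longrightarrow> \<exists>b. path_lift a p b"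
proof (induction p arbitrary: a)
  case Nil then show ?case by (simp add: walk_def)
next
  case (Cons x p)
  show ?case
  proof (cases p)
    case Nil
    then show ?thesis using Cons by auto
  next
    case (Cons y r)
    then have "E (en a) y" "walk V E p" using Cons.prems by auto
    then obtain c where "node_adj a c" "en c = y" using neighbor_over[of a y] Cons.prems by auto
    moreover obtain b where "path_lift c p b"
      using Cons.IH[OF \<open>walk V E p\<close>, of c] \<open>node_adj a c\<close> \<open>en c = y\<close> node_adj_node(2) Cons by auto
    ultimately have "path_lift a (x # p) b" using Cons Cons.prems by auto
    then show ?thesis by blast
  qed
qed

lemma path_lift_unique: "path_lift a p b \<Longrightarrow> path_lift a p c \<Longrightarrow> b = c"
proof (induction a p b arbitrary: c rule: path_lift.induct)
  case (3 a x y p b c)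
  obtain e f where e: "node_adj a e" "path_lift e (y # p) b" and f: "node_adj a f" "path_lift f (y # p) c"
    using 3(2,3) by auto
  have "e = f" using node_adj_unique[OF e(1) f(1)] path_lift_node[OF e(2)] path_lift_node[OF f(2)] by simp
  then show ?case using 3(1)[OF e(2)] f(2) by simp
qed simp_all

lemma path_lift_snoc: "path_lift a p b \<Longrightarrow> node_adj b c \<Longrightarrow> path_lift a (p @ [en c]) c"
proof (induction a p b rule: path_lift.induct)
  case (2 a x b)
  then show ?case using node_adj_node(2)[of a c] by auto
next
  case (3 a x y p b)
  then obtain e where e: "en a = x" "node_adj a e" "path_lift e (y # p) b" by auto
  then show ?case using 3(1)[OF e(3) 3(3)] by auto
qed simp_all

lemma path_lift_rev: "path_lift a p b \<Longrightarrow> path_lift b (rev p) a"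
proof (induction a p b rule: path_lift.induct)
  case (3 a x y p b)
  obtain c where c: "en a = x" "node_adj a c" "path_lift c (y # p) b" using 3(2) by auto
  show ?case using path_lift_snoc[OF 3(1)[OF c(3)] node_adj_sym[OF c(2)]] c(1) by simp
qed simp_all

lemma path_lift_level: "path_lift a p b \<Longrightarrow> fst b < fst a + length p"
proof (induction a p b rule: path_lift.induct)
  case (3 a x y p b)
  obtain c where c: "en a = x" "node_adj a c" "path_lift c (y # p) b" using 3(2) by auto
  show ?case using 3(1)[OF c(3)] c(2) unfolding node_adj_def by auto
qed simp_all

text \<open>Lifted backtracks close up by uniqueness of lifted neighbors, and lifted triangles by
  \<open>node_adj_triangle\<close>.\<close>

lemma path_lift_step:
  assumes "htpy_step E p q"
  shows "path_lift a p b \<longleftrightarrow> path_lift a q b"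
proof -
  from assms consider xs ys u v where "p = xs @ u # v # u # ys" "q = xs @ u # ys" "E u v"
    | xs ys u v w where "p = xs @ u # v # w # ys" "q = xs @ u # w # ys" "E u v" "E v w" "E u w"
    unfolding htpy_step_def by auto
  then show ?thesis
  proof cases
    case 1
    have "path_lift c (u # v # u # ys) b \<longleftrightarrow> path_lift c (u # ys) b" for c
    proof
      assume "path_lift c (u # v # u # ys) b"
      then obtain c1 c2 where c: "en c = u" "node_adj c c1" "node_adj c1 c2" "path_lift c2 (u # ys) b"
        unfolding path_lift.simps by blast
      have "en c2 = en c" using path_lift_node[OF c(4)] c(1) by simp
      then have "c2 = c" using node_adj_unique[OF c(3) node_adj_sym[OF c(2)]] by simp
      then show "path_lift c (u # ys) b" using c(4) by simp
    next
      assume l: "path_lift c (u # ys) b"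
      have c: "snd c \<in> N (fst c)" "en c = u" using path_lift_node[OF l] by simp_all
      have "E (en c) v" using 1(3) c(2) by simp
      from neighbor_over[OF c(1) this] obtain c1 where c1: "node_adj c c1" "en c1 = v" .
      have "path_lift c1 (v # u # ys) b"
        unfolding path_lift.simps using node_adj_sym[OF c1(1)] c1(2) l by blast
      then show "path_lift c (u # v # u # ys) b"
        unfolding path_lift.simps(3)[of c] using c1(1) c(2) by blast
    qed
    then show ?thesis 
      using path_lift_append[of a xs u "v # u # ys" b] path_lift_append[of a xs u ys b] unfolding 1(1,2) by blast
  next
    case 2
    have "path_lift c (u # v # w # ys) b \<longleftrightarrow> path_lift c (u # w # ys) b" for c
    proof
      assume "path_lift c (u # v # w # ys) b"
      then obtain c1 c2 where c: "en c = u" "node_adj c c1" "en c1 = v" "node_adj c1 c2" "path_lift c2 (w # ys) b"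
        unfolding path_lift.simps by blast
      have "E (en c) (en c2)" using path_lift_node[OF c(5)] c(1) 2(5) by simp
      then have "node_adj c c2" using node_adj_triangle[OF node_adj_sym[OF c(2)] c(4)] by simp
      then show "path_lift c (u # w # ys) b" unfolding path_lift.simps using c by blast
    next
      assume "path_lift c (u # w # ys) b"
      then obtain c2 where c: "en c = u" "node_adj c c2" "path_lift c2 (w # ys) b"
        unfolding path_lift.simps by blast
      have "E (en c) v" using 2(3) c(1) by simp
      from neighbor_over[OF node_adj_node(1)[OF c(2)] this]
      obtain c1 where c1: "node_adj c c1" "en c1 = v" .
      have "E (en c1) (en c2)" using path_lift_node[OF c(3)] c1(2) 2(4) by simp
      then have "node_adj c1 c2" using node_adj_triangle[OF c1(1) c(2)] by simp
      then have "path_lift c1 (v # w # ys) b" unfolding path_lift.simps using c1(2) c(3) by blast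
      then show "path_lift c (u # v # w # ys) b"
        unfolding path_lift.simps(3)[of c] using c1(1) c(1) by blast
    qed
    then show ?thesis 
      using path_lift_append[of a xs u "v # w # ys" b] path_lift_append[of a xs u "w # ys" b] unfolding 2(1,2) by blast
  qed
qed

lemma path_lift_homotopic:
  assumes "p \<simeq> q" shows "path_lift a p b \<longleftrightarrow> path_lift a q b"
  using assms unfolding edge_path_homotopic_def
proof (induction rule: rtranclp_induct)
  case (step y z)
  then show ?case using path_lift_step[of y z a b] path_lift_step[of z y a b] by blast
qed simp

end

section \<open>Identification of the cover with the graph\<close>

abbreviation "root \<equiv> (0, [v0])"

lemma path_to_node:
  "P \<in> N n \<Longrightarrow> \<exists>p. walk V E p \<and> hd p = v0 \<and> last p = hd P \<and> length p = Suc n \<and> path_lift root p (n, P)"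
proof (induction n arbitrary: P)
  case 0
  then show ?case using N_0 v0 by (intro exI[of _ "[v0]"]) simp
next
  case (Suc n)
  obtain Q where Q: "Q \<in> D (Suc n) P" using D_nonempty[OF trans_at Suc(2)] .
  obtain p where p: "walk V E p" "hd p = v0" "last p = hd Q" "length p = Suc n" "path_lift root p (n, Q)"
    using Suc(1)[OF D_N[OF Q]] by blast
  have e: "E (hd Q) (hd P)" using D_adj[OF Q] .
  have "path_lift root (p @ [hd P]) (Suc n, P)"
    using path_lift_snoc[OF p(5) node_adj_up[OF D_N[OF Q] Suc(2) Q]] by simp
  moreover have "walk V E (p @ [hd P])" using walk_append[OF p(1), of "[hd P]"] p(3) e inV by simp
  ultimately show ?case using p walk_not_Nil[OF p(1)] by (intro exI[of _ "p @ [hd P]"]) simp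
qed

context
  assumes sc: "triangle_complex_simply_connected V E"
begin

lemma closed_walk_lift:
  assumes p: "walk V E p" "hd p = v0" "last p = v0" "path_lift root p a" shows "a = root"
proof -
  have "p \<simeq> [v0]" using sc p unfolding triangle_complex_simply_connected_def by metis
  then have "path_lift root [v0] a" using path_lift_homotopic p(4) by blast
  then show ?thesis by simp
qed

text \<open>Go from the root to \<open>a\<close> along the lift of \<open>p\<close>, then lift
  \<open>q\<close> backwards. The composite lifts a closed walk, so it ends at the root; read in
  reverse, \<open>q\<close> lifts to a path ending in \<open>a\<close> as well as in
  \<open>b\<close>.\<close>

lemma node_eq_of_end:
  assumes "node a" "node b" "en a = en b" shows "a = b"
proof -
  obtain p where p: "walk V E p" "hd p = v0" "last p = en a" "path_lift root p a"
    using path_to_node[of "snd a" "fst a"] assms by auto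
  obtain q where q: "walk V E q" "hd q = v0" "last q = en b" "path_lift root q b"
    using path_to_node[of "snd b" "fst b"] assms by auto
  note ne = walk_not_Nil[OF p(1)] walk_not_Nil[OF q(1)]
  obtain p' where p': "p = p' @ [en a]" using ne p(3) append_butlast_last_id by metis
  obtain q' where q': "rev q = en a # q'" using ne q(3) assms(3) by (metis hd_rev list.exhaust_sel rev_is_Nil_conv)
  have rq: "walk V E (rev q)" using walk_rev[OF sym q(1)] .
  obtain c where c: "path_lift a (rev q) c" using path_lift_exists[OF rq assms(1)] q' by auto
  have l: "path_lift root (p' @ en a # q') c" 
  proof -
    have "path_lift root (p' @ [en a]) a" "path_lift a (en a # q') c" using p(4) p' c q' by simp_all
    then show ?thesis using path_lift_append[of root p' "en a" q' c] by blast
  qed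
  have "walk V E (p @ q')" using walk_append[OF p(1), of q'] p(3) rq q' by simp
  then have w: "walk V E (p' @ en a # q')" using p' by simp
  have "last (p' @ en a # q') = last (rev q)" using q' by simp
  then have "last (p' @ en a # q') = v0" using ne q(2) by (simp add: last_rev)
  moreover have "hd (p' @ en a # q') = v0" using p(2) p' by (cases p') auto
  ultimately have "c = root" using closed_walk_lift[OF w _ _ l] by blast
  then have "path_lift root q a" using path_lift_rev[OF c] by simp
  then show ?thesis using path_lift_unique q(4) by blast
qed

text \<open>A node of level \<open>n\<close> ends a lift of a walk with \<open>n\<close> edges.
  Conversely, the lift of a geodesic gains at most one level per edge and ends at the same
  node.\<close>

lemma node_level: assumes "P \<in> N n" shows "d v0 (hd P) = n"
proof -
  obtain p where p: "walk V E p" "hd p = v0" "last p = hd P" "length p = Suc n"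
    using path_to_node[OF assms] by blast
  have le: "d v0 (hd P) \<le> n" using d_le_walk[OF p] .
  obtain q where q: "walk V E q" "hd q = v0" "last q = hd P" "length q = Suc (d v0 (hd P))"
    using geodesic[OF v0 N_inV[OF assms]] .
  obtain b where b: "path_lift root q b" using path_lift_exists[OF q(1), of root] q N_0 by auto
  then have "b = (n, P)" using node_eq_of_end[of b "(n, P)"] path_lift_node[OF b] assms q by simp
  then show ?thesis using path_lift_level[OF b] q le by simp
qed

lemma node_over: assumes "v \<in> V" obtains P where "P \<in> N (d v0 v)" "hd P = v"
proof -
  obtain q where q: "walk V E q" "hd q = v0" "last q = v" using geodesic[OF v0 assms] by blast
  obtain b where b: "path_lift root q b" using path_lift_exists[OF q(1), of root] q N_0 by auto
  then have "node b" "en b = v" using path_lift_node[OF b] q by auto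
  then show ?thesis using that[of "snd b"] node_level[of "snd b" "fst b"] by simp
qed

lemma adjacent_nodes:
  assumes "P \<in> N n" "Q \<in> N m" "E (hd P) (hd Q)" shows "node_adj (n, P) (m, Q)"
proof -
  obtain b where b: "node_adj (n, P) b" "en b = hd Q" using node_adj_exists[OF assms(1,3)] .
  then have "b = (m, Q)" using node_eq_of_end[of b "(m, Q)"] node_adj_node assms by simp
  then show ?thesis using b by simp
qed

text \<open>An edge between vertices equidistant from the base lifts to a level edge, which by
  construction has a common lower neighbor.\<close>

lemma base_tc:
  assumes "E v w" "d v0 v = n" "d v0 w = n"
  shows "\<exists>x\<in>V. E x v \<and> E x w \<and> d v0 x = n - 1"
proof -
  obtain P where P: "P \<in> N n" "hd P = v" using node_over[of v] inV assms by metis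
  obtain Q where Q: "Q \<in> N n" "hd Q = w" using node_over[of w] inV assms by metis
  have "node_adj (n, P) (n, Q)" using adjacent_nodes P Q assms by simp
  then show ?thesis
  proof (cases rule: node_adj_cases)
    case (flat m Z C)
    then show ?thesis using node_level[OF flat(8)] N_inV[OF flat(8)] D_adj[OF flat(6)] D_adj[OF flat(7)] P Q
      by (intro bexI[of _ "hd C"]) auto
  qed auto
qed

text \<open>Two different lower neighbors of one node were identified through a common lower
  neighbor (\<open>D_common'\<close>).\<close>

lemma base_qc:
  assumes "E v z" "E w z" "v \<noteq> w" "d v0 v = n" "d v0 w = n" "d v0 z = Suc n"
  shows "\<exists>x\<in>V. E x v \<and> E x w \<and> d v0 x = n - 1"
proof -
  obtain P where P: "P \<in> N n" "hd P = v" using node_over[of v] inV assms by metis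
  obtain Q where Q: "Q \<in> N n" "hd Q = w" using node_over[of w] inV assms by metis
  obtain Z where Z: "Z \<in> N (Suc n)" "hd Z = z" using node_over[of z] inV assms by metis
  have "node_adj (Suc n, Z) (n, P)" "node_adj (Suc n, Z) (n, Q)" using adjacent_nodes P Q Z assms sym by simp_all
  then have "P \<in> D (Suc n) Z" "Q \<in> D (Suc n) Z" unfolding node_adj_def by auto
  moreover have "P \<noteq> Q" using P Q assms by auto
  ultimately obtain k B where B: "n = Suc k" "B \<in> D (Suc k) P" "B \<in> D (Suc k) Q" using D_common'[OF Z(1)] by blast
  then show ?thesis using node_level[OF D_N[OF B(2)]] N_inV[OF D_N[OF B(2)]] D_adj[OF B(2)] D_adj[OF B(3)] P Q
    by (intro bexI[of _ "hd B"]) auto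
qed

end

end

text \<open>The tower controls distances from its base vertex only, so it is rebuilt with base
  \<open>u\<close> for every \<open>u\<close>.\<close>

lemma (in cgraph) weakly_modular_of_local:
  assumes "locally_weakly_modular V E" "triangle_complex_simply_connected V E"
  shows "weakly_modular V E"
  unfolding weakly_modular_def
proof (intro conjI ballI impI)
  fix u v w assume V: "u \<in> V" "v \<in> V" "w \<in> V" and *: "d v w = 1 \<and> 1 < d u v \<and> d u v = d u w"
  interpret lwmgraph V E u by unfold_locales (use assms V in auto)
  have "E v w" "d u w = d u v" using * d_1[OF V(2,3)] by simp_all
  then show "\<exists>x\<in>V. E x v \<and> E x w \<and> d u x = d u v - 1" using base_tc[OF assms(2) _ refl] by blast
next
  fix u v w z assume V: "u \<in> V" "v \<in> V" "w \<in> V" "z \<in> V"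
    and *: "d v z = 1 \<and> d w z = 1 \<and> d v w = 2 \<and> 2 \<le> d u v \<and> d u v = d u w \<and> d u v = d u z - 1"
  interpret lwmgraph V E u by unfold_locales (use assms V in auto)
  have "v \<noteq> w" using * d_refl[OF V(2)] by auto
  moreover have "E v z" "E w z" "d u w = d u v" "d u z = Suc (d u v)"
    using * d_1[OF V(2,4)] d_1[OF V(3,4)] by auto
  ultimately show "\<exists>x\<in>V. E x v \<and> E x w \<and> d u x = d u v - 1"
    using base_qc[OF assms(2) _ _ _ refl] by blast
qed

lemma (in wmgraph) locally_weakly_modular: "locally_weakly_modular V E"
  unfolding locally_weakly_modular_def
proof (intro conjI ballI impI)
  fix u v w assume V: "u \<in> V" "v \<in> V" "w \<in> V" and *: "E v w \<and> d u v = 2 \<and> d u w = 2"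
  then obtain x where "x \<in> V" "E x v" "E x w" "d u x = 1"
    using tc[of u v w 1] by (auto simp: numeral_2_eq_2)
  then show "\<exists>x\<in>V. E x u \<and> E x v \<and> E x w" using d_1[OF V(1), of x] sym by auto
next
  fix u v w z assume V: "u \<in> V" "v \<in> V" "w \<in> V" "z \<in> V"
    and *: "E z v \<and> E z w \<and> d v w = 2 \<and> d u v = 2 \<and> d u w = 2 \<and> d u z = 3"
  then have "v \<noteq> w" "E v z" "E w z" using sym by auto
  then obtain x where "x \<in> V" "E x v" "E x w" "d u x = 1"
    using qc[of u v z w 1] * V by (auto simp: numeral_2_eq_2 numeral_3_eq_3)
  then show "\<exists>x\<in>V. E x u \<and> E x v \<and> E x w" using d_1[OF V(1), of x] sym by auto
qed

theorem theorem4p3: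
  fixes V :: "'a set" and E :: "'a \<Rightarrow> 'a \<Rightarrow> bool"
  assumes "graph V E"
  shows "(prime_graph V E \<and> pre_median V E
            \<longleftrightarrow> two_connected V E \<and> pre_median V E \<and> squares_in_W4_or_M4 V E)
       \<and> (two_connected V E \<and> pre_median V E \<and> squares_in_W4_or_M4 V E
            \<longleftrightarrow> two_connected V E \<and> pre_median V E \<and> triangle_complex_simply_connected V E)
       \<and> (two_connected V E \<and> pre_median V E \<and> triangle_complex_simply_connected V E
            \<longleftrightarrow> two_connected V E \<and> locally_weakly_modular V E \<and> \<not> has_induced_K23 V E
                \<and> \<not> has_induced_W4_minus V E \<and> triangle_complex_simply_connected V E)"
proof -
  interpret cgraph V E by unfold_locales (rule assms)
  have i_ii: "two_connected V E \<and> squares_in_W4_or_M4 V E" if "prime_graph V E" "pre_median V E"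
  proof -
    interpret premedian V E by unfold_locales (rule that(2))
    show ?thesis
      using two_connected_of_no_amalgam squares_of_link_connected prime_link_connected[OF that(1)] that(1)
      unfolding prime_graph_def by blast
  qed
  have ii_iii: "triangle_complex_simply_connected V E" if "pre_median V E" "squares_in_W4_or_M4 V E"
  proof -
    interpret premedian V E by unfold_locales (rule that(1))
    show ?thesis using simply_connected_of_squares_null square_null[OF that(2)] by blast
  qed
  have iii_i: "prime_graph V E" if "two_connected V E" "triangle_complex_simply_connected V E"
    using simply_connected_prime that by blast
  have iii_iv: "locally_weakly_modular V E" if "pre_median V E"
  proof -
    interpret premedian V E by unfold_locales (rule that)
    show ?thesis by (rule locally_weakly_modular)
  qed
  have iv_iii: "weakly_modular V E" if "locally_weakly_modular V E" "triangle_complex_simply_connected V E"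
    using weakly_modular_of_local that by blast
  \<comment> \<open>(i), (ii), (iii) are closed into a cycle; (iii) and (iv) differ only in weak
    against local weak modularity.\<close>
  show ?thesis
    using i_ii ii_iii iii_i iii_iv iv_iii unfolding pre_median_def by blast
qed

end
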